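(* For each non-zero element $(\nu,\mu,\epsilon,k)\in\{0,1\}^3\times\mathbb N$ there exist finite subsets $\alpha,\beta\subseteq S$ such that $\mathcal A_\alpha\simeq A_5$ and $\mathcal A_\beta\simeq S_4$, with icosahedral component index of $\alpha$ and octahedral component index of $\beta$ both equal to $(\nu,\mu,\epsilon,k)$. Furthermore, $$\{|\alpha| : \alpha\subseteq S \text{ finite},\ \mathcal A_\alpha\simeq A_5\}=\{x+60k\mid x\in\{0,12,20,30,32,42,50,62\},\ k\in\mathbb N,\ x^2+k^2\ne0\},$$ $$\{|\beta| : \beta\subseteq S \text{ finite},\ \mathcal A_\beta\simeq S_4\}=\{x+24k\mid x\in\{0,6,8,12,14,18,20,26\},\ k\in\mathbb N,\ x^2+k^2\ne0\}.$$
   Context: $\mathbb N=\{0,1,2,\dots\}$. $S=\{(x_1,x_2,x_3)\in\mathbb R^3: x_1^2+x_2^2+x_3^2=1\}$ is the Riemann sphere, identified with $\widehat{\mathbb C}=\mathbb C\cup\{\infty\}$ by stereographic projection, so that Möbius transformations ($\mathrm{PSL}(2,\mathbb C)$) act on $S$ and rotations about the origin are Möbius transformations. For $\alpha\subseteq S$, $\mathcal A_\alpha$ is the group of all Möbius transformations $f$ with $f(\alpha)=\alpha$. Let $G$ be the icosahedral group ($\simeq A_5$) of rotations preserving a regular dodecahedron (resp. the octahedral group, $\simeq S_4$, of rotations preserving a cube) centred at the origin and inscribed in $S$. $V\subseteq S$ is its set of vertices, $F\subseteq S$ the set of projections from the origin onto $S$ of the centres of its faces, $E\subseteq S$ the set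 of projections from the origin onto $S$ of the midpoints of its edges. For $X\in S\setminus(V\cup F\cup E)$, $B(X)$ is the orbit of $X$ under $G$. For a subset $\alpha\subseteq S$ that is a finite union of $G$-orbits, its icosahedral (resp. octahedral) component index is $(\nu,\mu,\epsilon,k)\in\{0,1\}^3\times\mathbb N$, where $\nu,\mu,\epsilon,k$ are the numbers of $G$-orbits in $\alpha$ of type $V$, $F$, $E$ and $B$ respectively. *)

theory Defs
  imports "HOL-Analysis.Analysis" "HOL-Algebra.Bij" "HOL-Algebra.Sym_Groups"
begin

section \<open>Moebius transformations of the Riemann sphere\<close>

abbreviation S2 :: "(real^3) set" where
  "S2 \<equiv> sphere 0 1"

text \<open>The extended complex plane is \<open>complex option\<close>, with \<open>None\<close> as the point at infinity.
  The projection is from the north pole onto the equatorial plane.\<close>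

definition stereo :: "real^3 \<Rightarrow> complex option" where
  "stereo x = (if x$3 = 1 then None else Some (Complex (x$1 / (1 - x$3)) (x$2 / (1 - x$3))))"

fun moebius :: "complex \<Rightarrow> complex \<Rightarrow> complex \<Rightarrow> complex \<Rightarrow> complex option \<Rightarrow> complex option" where
  "moebius a b c d None = (if c = 0 then None else Some (a / c))"
| "moebius a b c d (Some z) = (if c * z + d = 0 then None else Some ((a * z + b) / (c * z + d)))"

text \<open>Maps are taken extensional outside the sphere, so that two of them are equal
  iff they agree on the sphere.\<close>

definition moebius_S2 :: "(real^3 \<Rightarrow> real^3) set" where
  "moebius_S2 = {f \<in> Bij S2. \<exists>a b c d. a * d - b * c \<noteq> 0 \<and>
     (\<forall>x\<in>S2. stereo (f x) = moebius a b c d (stereo x))}"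

definition moebius_stabilizer :: "(real^3) set \<Rightarrow> (real^3 \<Rightarrow> real^3) monoid" where
  "moebius_stabilizer \<alpha> = (BijGroup S2) \<lparr>carrier := {f \<in> moebius_S2. f ` \<alpha> = \<alpha>}\<rparr>"

section \<open>Regular dodecahedra and cubes inscribed in the sphere\<close>

definition phi :: real where
  "phi = (1 + sqrt 5) / 2"

definition signs :: "real set" where
  "signs = {-1, 1}"

definition std_cube :: "(real^3) set" where
  "std_cube = convex hull {vector [s, t, u] /\<^sub>R sqrt 3 | s t u. s \<in> signs \<and> t \<in> signs \<and> u \<in> signs}"

definition std_dodecahedron :: "(real^3) set" where
  "std_dodecahedron = convex hull
     ({vector [s, t, u] /\<^sub>R sqrt 3 | s t u. s \<in> signs \<and> t \<in> signs \<and> u \<in> signs}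
    \<union> {vector [0, s / phi, t * phi] /\<^sub>R sqrt 3 | s t. s \<in> signs \<and> t \<in> signs}
    \<union> {vector [s / phi, t * phi, 0] /\<^sub>R sqrt 3 | s t. s \<in> signs \<and> t \<in> signs}
    \<union> {vector [t * phi, 0, s / phi] /\<^sub>R sqrt 3 | s t. s \<in> signs \<and> t \<in> signs})"

text \<open>All regular dodecahedra (cubes) that are centred at the origin and inscribed in the unit
  sphere, in arbitrary position.\<close>

definition inscribed_dodecahedron :: "(real^3) set \<Rightarrow> bool" where
  "inscribed_dodecahedron P \<longleftrightarrow> (\<exists>f. orthogonal_transformation f \<and> P = f ` std_dodecahedron)"

definition inscribed_cube :: "(real^3) set \<Rightarrow> bool" where
  "inscribed_cube P \<longleftrightarrow> (\<exists>f. orthogonal_transformation f \<and> P = f ` std_cube)"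

section \<open>Rotation groups, orbits and the component index\<close>

definition rotations :: "(real^3) set \<Rightarrow> (real^3 \<Rightarrow> real^3) set" where
  "rotations P = {f. orthogonal_transformation f \<and> det (matrix f) = 1 \<and> f ` P = P}"

definition rot_orbit :: "(real^3) set \<Rightarrow> real^3 \<Rightarrow> (real^3) set" where
  "rot_orbit P X = {f X | f. f \<in> rotations P}"

definition rot_orbits :: "(real^3) set \<Rightarrow> (real^3) set set" where
  "rot_orbits P = rot_orbit P ` S2"

text \<open>The radial projection onto the sphere is \<^term>\<open>sgn\<close>.\<close>

definition vertex_set :: "(real^3) set \<Rightarrow> (real^3) set" where
  "vertex_set P = {v. v extreme_point_of P}"

definition centroid :: "(real^3) set \<Rightarrow> real^3" where
  "centroid A = (\<Sum>v\<in>A. v) /\<^sub>R real (card A)"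

definition face_points :: "(real^3) set \<Rightarrow> (real^3) set" where
  "face_points P = {sgn (centroid (vertex_set A)) | A. A facet_of P}"

definition edge_points :: "(real^3) set \<Rightarrow> (real^3) set" where
  "edge_points P = {sgn (midpoint a b) | a b. closed_segment a b edge_of P}"

definition generic_points :: "(real^3) set \<Rightarrow> (real^3) set" where
  "generic_points P = S2 - (vertex_set P \<union> face_points P \<union> edge_points P)"

definition finite_union_of_orbits :: "(real^3) set \<Rightarrow> (real^3) set \<Rightarrow> bool" where
  "finite_union_of_orbits P \<alpha> \<longleftrightarrow> (\<exists>Z. finite Z \<and> Z \<subseteq> rot_orbits P \<and> \<alpha> = \<Union>Z)"

text \<open>Meaningful only for a finite union of orbits. The first three entries are the numbers
  of orbits in \<open>\<alpha>\<close> equal to the set of vertices, of face points and of edge points, respectively;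
  each of these sets is a single orbit for the dodecahedron and for the cube.\<close>

definition component_index :: "(real^3) set \<Rightarrow> (real^3) set \<Rightarrow> nat \<times> nat \<times> nat \<times> nat" where
  "component_index P \<alpha> =
    (card {Z \<in> rot_orbits P. Z \<subseteq> \<alpha> \<and> Z = vertex_set P},
     card {Z \<in> rot_orbits P. Z \<subseteq> \<alpha> \<and> Z = face_points P},
     card {Z \<in> rot_orbits P. Z \<subseteq> \<alpha> \<and> Z = edge_points P},
     card {Z \<in> rot_orbits P. Z \<subseteq> \<alpha> \<and> (\<exists>X \<in> generic_points P. Z = rot_orbit P X)})"

end

theory Submission
  imports Defs "HOL-Algebra.Group_Action" "HOL-Algebra.Multiplicative_Group"
begin

text \<open>
  Let \<open>G\<close> be the rotation group of the solid and \<open>\<alpha>\<close> a nonempty finite union of \<open>G\<close>-orbits.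
  The heart of the matter is that \<open>G\<close> is already the full Moebius stabilizer of \<open>\<alpha>\<close>, and this is a
  matter of counting. A Moebius transformation of finite order, other than the identity, fixes exactly
  two points. In a finite Moebius group of order \<open>N\<close>, counting the pairs of an element and a fixed
  point therefore gives \<open>\<Sum> (N - s) = 2 * N - 2\<close>, where \<open>s\<close> runs through the sizes of the orbits
  with fewer than \<open>N\<close> points. If every orbit has at least three points, this leaves only the orders
  12, 24 and 60, with exceptional orbits of sizes 6, 4, 4 and 12, 8, 6 and 30, 20, 12
  (\<open>exceptional_orbits_classification\<close>).

  Orbits with one or two points are excluded by a property of the abstract group. All squares fix
  the points of such an orbit, and elements of a finite Moebius group with a common fixed point
  commute, so any two squares would commute. In \<open>S\<^sub>4\<close> and \<open>A\<^sub>5\<close> they do not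
  (\<open>noncommuting_three_cycles\<close>). Now the stabilizer of \<open>\<alpha>\<close> is finite, because \<open>\<alpha>\<close> has at least
  three points, and it contains \<open>G\<close>. Its order is 12, 24 or 60 and a multiple of the order of \<open>G\<close>,
  which is 24 or 60, so it equals \<open>G\<close> (\<open>moebius_fixing_eq\<close>). The same count yields the possible
  cardinalities: a finite set whose stabilizer is isomorphic to \<open>A\<^sub>5\<close> or \<open>S\<^sub>4\<close> is a union of orbits
  of its stabilizer, whose sizes are known, and every nonempty choice of finitely many orbits of \<open>G\<close>
  does occur (\<open>stabilizer_cards\<close>).

  It remains to identify \<open>G\<close> and the orbits formed by the vertices, face points and edge points.
  Three edges meet in each vertex, and the basis dual to the three edge vectors describes all
  faces through that vertex (locale \<open>simple_vertex\<close>). As \<open>G\<close> is transitive on the vertices and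
  contains a rotation that permutes the three edges at a vertex cyclically, all edges are equivalent
  and so are all faces (locale \<open>regular_solid\<close>). The number of vertices determines the order of \<open>G\<close>:
  8 is an orbit size only for order 24, and 20 only for order 60. Finally \<open>G\<close> permutes faithfully
  the four diagonals of the cube, and in the case of the dodecahedron the five orthogonal frames formed
  by edge points (\<open>block_action_embedding\<close>). So \<open>G\<close> is \<open>S\<^sub>4\<close> for the cube; for the dodecahedron it is
  a subgroup of index two in \<open>S\<^sub>5\<close>, that is \<open>A\<^sub>5\<close>.
\<close>


section \<open>Group actions in which every nontrivial element fixes two points\<close>

text \<open>
  Since \<open>3 * a \<ge> N + 2\<close>, the largest size is \<open>N / 2\<close>, so \<open>b + c = N / 2 + 2\<close>. Here \<open>b = N / 2\<close> would
  leave \<open>c = 2\<close>, and \<open>b \<le> N / 4\<close> is too small, so \<open>b = N / 3\<close>. With \<open>a = 3 * t\<close> the remaining size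
  is \<open>t + 2\<close>, and it divides \<open>6 * t\<close> only if it divides 12.
\<close>

lemma three_orbit_sizes:
  fixes N a b c :: nat
  assumes "a \<ge> b" "b \<ge> c" "c \<ge> 3" and "a dvd N" "b dvd N" "c dvd N"
    and "2 * a \<le> N" and sum: "a + b + c = N + 2"
  shows "(N, a, b, c) \<in> {(12, 6, 4, 4), (24, 12, 8, 6), (60, 30, 20, 12)}"
proof -
  obtain m1 m2 m3 where m: "N = a * m1" "N = b * m2" "N = c * m3"
    using assms(4-6) unfolding dvd_def by blast
  have "m1 \<ge> 2" using m(1) assms by (cases "m1 < 2") (auto simp: less_2_cases_iff)
  moreover have "m1 < 3"
  proof (rule ccontr)
    assume "\<not> m1 < 3" then have "a * 3 \<le> a * m1" by (intro mult_left_mono) auto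
    with m(1) assms show False by linarith
  qed
  ultimately have N: "N = 2 * a" using m(1) by auto
  have "m2 < 4"
  proof (rule ccontr)
    assume "\<not> m2 < 4" then have "b * 4 \<le> b * m2" by (intro mult_left_mono) auto
    with m(2) N assms show False by linarith
  qed
  moreover have "m2 \<noteq> 0" using m(2) assms(1-3,7) by (metis le_zero_eq mult_0_right mult_is_0 not_numeral_le_zero zero_neq_numeral)
  moreover have "m2 \<noteq> 1" using m(2) N assms by auto
  moreover have "m2 \<noteq> 2" using m(2) N assms by auto
  ultimately have "m2 = 3" by linarith
  with m(2) N have ab: "2 * a = 3 * b" by simp
  define t where "t = a div 3"
  have t: "a = 3 * t" "b = 2 * t"
    using ab unfolding t_def by presburger+
  with sum N have c: "c = t + 2" by simp
  have "t \<ge> 2" using t c assms by simp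
  have "t + 2 dvd 6 * t" using assms(6) N t c by simp
  then have "t + 2 dvd 6 * (t + 2) - 6 * t"
    by (rule dvd_diff_nat[OF dvd_triv_right])
  then have d: "t + 2 dvd 12" by simp
  then have "t \<le> 10" using dvd_imp_le[OF d] by simp
  then have "t \<in> {0..10}" by simp
  then have "t = 0 \<or> t = 1 \<or> t = 2 \<or> t = 3 \<or> t = 4 \<or> t = 5 \<or> t = 6 \<or> t = 7 \<or> t = 8 \<or> t = 9 \<or> t = 10"
    by (simp only: atLeastAtMost_iff) presburger
  with d \<open>t \<ge> 2\<close> have "t \<in> {2, 4, 10}"
    by (elim disjE) (simp_all add: dvd_eq_mod_eq_0)
  then show ?thesis using t c N by auto
qed

text \<open>
  This is the situation of a finite group of Moebius transformations acting on the sphere. The lower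
  bound on the orbits excludes the cyclic and the dihedral groups, whose axis endpoints form orbits
  of one or two points, and leaves the tetrahedral, octahedral and icosahedral groups.
\<close>

locale two_fixed_points_action = group_action G E \<phi> for G (structure) and E :: "'b set" and \<phi> :: "'a \<Rightarrow> 'b \<Rightarrow> 'b" +
  assumes finite_group: "finite (carrier G)"
    and two_fixed: "\<And>g. g \<in> carrier G \<Longrightarrow> g \<noteq> \<one> \<Longrightarrow> card (invariants E \<phi> g) = 2"
    and orbit_ge_3: "\<And>x. x \<in> E \<Longrightarrow> card (orbit G \<phi> x) \<ge> 3"
    and nonempty: "E \<noteq> {}"
begin

lemma group_G: "group G"
  using group_hom group_hom.axioms(1) by blast

lemma finite_orbit: "finite (orbit G \<phi> x)"
  unfolding orbit_def using finite_group by (auto simp: setcompr_eq_image)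

lemma orbit_subset: "x \<in> E \<Longrightarrow> orbit G \<phi> x \<subseteq> E"
  unfolding orbit_def using element_image by auto

lemma orbit_eqI: "x \<in> E \<Longrightarrow> y \<in> orbit G \<phi> x \<Longrightarrow> orbit G \<phi> y = orbit G \<phi> x"
proof -
  assume x: "x \<in> E" and y: "y \<in> orbit G \<phi> x"
  then have "y \<in> E" using orbit_subset by blast
  have "orbit G \<phi> b \<subseteq> orbit G \<phi> a" if "a \<in> E" "b \<in> E" "b \<in> orbit G \<phi> a" for a b
    using orbit_trans[OF that(1,2) _ that(3)] orbit_subset[OF that(2)] by (auto simp: subset_iff)
  from this[OF x \<open>y \<in> E\<close> y] this[OF \<open>y \<in> E\<close> x orbit_sym[OF x \<open>y \<in> E\<close> y]]
  show ?thesis by (rule equalityI)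
qed

lemma order_ge_3: "order G \<ge> 3"
proof -
  obtain x where x: "x \<in> E" using nonempty by blast
  have "order G > 0"
    unfolding order_def using finite_group monoid.one_closed[OF group.is_monoid[OF group_G]]
    by (auto simp: card_gt_0_iff)
  have "card (orbit G \<phi> x) dvd order G"
    using orbit_stabilizer_theorem[OF x] by (metis dvd_triv_left)
  then show ?thesis using orbit_ge_3[OF x] \<open>order G > 0\<close> by (meson dvd_imp_le le_trans)
qed

text \<open>
  The points with a nontrivial stabilizer, see \<open>exceptional_eq_fixed\<close>. Characterized by the size of
  the orbit, they are visibly a union of orbits.
\<close>

definition exceptional :: "'b set" where
  "exceptional = {x \<in> E. card (orbit G \<phi> x) \<noteq> order G}"

definition exceptional_orbits :: "'b set set" where
  "exceptional_orbits = {Z \<in> orbits G E \<phi>. card Z \<noteq> order G}"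

lemma exceptional_eq_fixed:
  "exceptional = (\<Union>g \<in> carrier G - {\<one>}. invariants E \<phi> g)"
proof -
  have "card (orbit G \<phi> x) \<noteq> order G \<longleftrightarrow> (\<exists>g \<in> carrier G - {\<one>}. \<phi> g x = x)" if x: "x \<in> E" for x
  proof -
    have fin: "finite (stabilizer G \<phi> x)"
      using finite_subset[OF stabilizer_subset finite_group] .
    have one: "\<one> \<in> stabilizer G \<phi> x" by (rule stabilizer_one_closed[OF x])
    have "card (orbit G \<phi> x) \<noteq> order G \<longleftrightarrow> card (stabilizer G \<phi> x) \<noteq> 1"
      using orbit_stabilizer_theorem[OF x] order_ge_3 by auto
    also have "\<dots> \<longleftrightarrow> stabilizer G \<phi> x \<noteq> {\<one>}"
      using one by (auto simp: card_1_singleton_iff)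
    also have "\<dots> \<longleftrightarrow> (\<exists>g \<in> carrier G - {\<one>}. \<phi> g x = x)"
      using one by (auto simp: stabilizer_def)
    finally show ?thesis .
  qed
  then show ?thesis by (auto simp: exceptional_def invariants_def)
qed

lemma finite_exceptional: "finite exceptional"
  unfolding exceptional_eq_fixed using finite_group two_fixed
  by (intro finite_UN_I) (auto intro!: card_ge_0_finite)

lemma Union_exceptional_orbits: "\<Union> exceptional_orbits = exceptional"
proof
  show "\<Union> exceptional_orbits \<subseteq> exceptional"
  proof
    fix y assume "y \<in> \<Union> exceptional_orbits"
    then obtain x where x: "x \<in> E" "card (orbit G \<phi> x) \<noteq> order G" "y \<in> orbit G \<phi> x"
      by (auto simp: exceptional_orbits_def orbits_def)
    then show "y \<in> exceptional"
      using orbit_eqI[OF x(1,3)] orbit_subset[OF x(1)] by (auto simp: exceptional_def)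
  qed
  show "exceptional \<subseteq> \<Union> exceptional_orbits"
    using orbit_refl by (fastforce simp: exceptional_orbits_def exceptional_def orbits_def)
qed

lemma finite_exceptional_orbits: "finite exceptional_orbits"
  using finite_exceptional Union_exceptional_orbits by (metis finite_UnionD)

text \<open>
  Double counting of the pairs of a group element and an exceptional point that it fixes. Summed
  over the points, each orbit contributes the order of the group, by the orbit-stabilizer theorem.
  Summed over the elements, the identity contributes all exceptional points and every other element
  contributes two.
\<close>

lemma exceptional_orbits_count:
  "(\<Sum>Z\<in>exceptional_orbits. card Z) + 2 * order G = card exceptional_orbits * order G + 2"
proof -
  let ?I = "\<lambda>g. {x \<in> exceptional. \<phi> g x = x}"
  have sub: "exceptional_orbits \<subseteq> orbits G E \<phi>" by (auto simp: exceptional_orbits_def)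
  have fin: "finite Z" if "Z \<in> exceptional_orbits" for Z
    using that sub finite_orbit by (auto simp: orbits_def)
  have disj: "\<forall>Z\<in>exceptional_orbits. \<forall>Z'\<in>exceptional_orbits. Z \<noteq> Z' \<longrightarrow> Z \<inter> Z' = {}"
    using disjoint_union sub by blast
  have cP: "card exceptional = (\<Sum>Z\<in>exceptional_orbits. card Z)"
    unfolding Union_exceptional_orbits[symmetric]
    by (rule card_Union_disjoint) (use disj fin in \<open>auto simp: pairwise_def disjnt_def\<close>)
  have "card exceptional_orbits * order G = (\<Sum>Z\<in>exceptional_orbits. \<Sum>x\<in>Z. card (stabilizer G \<phi> x))"
    using card_stablizer_sum[OF finite_group] sub by (simp add: subset_iff)
  also have "\<dots> = (\<Sum>x\<in>exceptional. card (stabilizer G \<phi> x))"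
    unfolding Union_exceptional_orbits[symmetric]
    using sum.Union_disjoint[OF _ disj, of "\<lambda>x. card (stabilizer G \<phi> x)"] fin by (simp add: comp_def)
  also have "\<dots> = (\<Sum>x\<in>exceptional. \<Sum>g\<in>carrier G. if \<phi> g x = x then 1 else 0)"
    using finite_group by (intro sum.cong refl card_as_sums) (auto simp: stabilizer_def)
  also have "\<dots> = (\<Sum>g\<in>carrier G. \<Sum>x\<in>exceptional. if \<phi> g x = x then 1 else 0)"
    by (rule sum.swap)
  also have "\<dots> = (\<Sum>g\<in>carrier G. card (?I g))"
    using finite_exceptional by (intro sum.cong refl card_as_sums[symmetric]) auto
  also have "\<dots> = card (?I \<one>) + (\<Sum>g\<in>carrier G - {\<one>}. card (?I g))"
    by (rule sum.remove[OF finite_group monoid.one_closed[OF group.is_monoid[OF group_G]]])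
  also have "?I \<one> = exceptional"
    by (auto simp: exceptional_def id_eq_one[symmetric])
  also have "(\<Sum>g\<in>carrier G - {\<one>}. card (?I g)) = (\<Sum>g\<in>carrier G - {\<one>}. 2)"
  proof (intro sum.cong refl)
    fix g assume g: "g \<in> carrier G - {\<one>}"
    then have "?I g = invariants E \<phi> g"
      unfolding exceptional_eq_fixed by (auto simp: invariants_def)
    then show "card (?I g) = 2" using two_fixed g by simp
  qed
  also have "\<dots> = 2 * (order G - 1)"
    using finite_group by (simp add: order_def monoid.one_closed[OF group.is_monoid[OF group_G]])
  finally show ?thesis using cP order_ge_3 by simp
qed

text \<open>
  An exceptional orbit has at most half as many points as the group has elements. So four or more of
  them would violate the counting formula, and so would two or fewer when every orbit has at least
  three points. For exactly three orbits the formula and divisibility leave the listed sizes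
  (\<open>three_orbit_sizes\<close>).
\<close>

theorem exceptional_orbits_classification:
  obtains A B C where "exceptional_orbits = {A, B, C}" "A \<noteq> B" "A \<noteq> C" "B \<noteq> C"
    "(order G, card A, card B, card C) \<in> {(12, 6, 4, 4), (24, 12, 8, 6), (60, 30, 20, 12)}"
proof -
  let ?N = "order G" and ?r = "card exceptional_orbits"
  have Z: "card Z \<ge> 3 \<and> card Z dvd ?N \<and> 2 * card Z \<le> ?N" if ZX: "Z \<in> exceptional_orbits" for Z
  proof -
    obtain x where x: "x \<in> E" "Z = orbit G \<phi> x" and ne: "card Z \<noteq> ?N"
      using ZX by (auto simp: exceptional_orbits_def orbits_def)
    have mult: "card Z * card (stabilizer G \<phi> x) = ?N" using orbit_stabilizer_theorem x by simp
    have "card (stabilizer G \<phi> x) \<noteq> 0" using mult order_ge_3 by (metis mult_0_right not_numeral_le_zero)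
    moreover have "card (stabilizer G \<phi> x) \<noteq> 1" using mult ne by auto
    ultimately have "card Z * 2 \<le> card Z * card (stabilizer G \<phi> x)" by (intro mult_left_mono) auto
    moreover have "card Z dvd ?N" unfolding mult[symmetric] by (rule dvd_triv_left)
    ultimately show ?thesis using mult orbit_ge_3[OF x(1)] x(2) by (metis mult.commute)
  qed
  note count = exceptional_orbits_count
  have "2 * (\<Sum>Z\<in>exceptional_orbits. card Z) = (\<Sum>Z\<in>exceptional_orbits. 2 * card Z)"
    by (simp add: sum_distrib_left)
  also have "\<dots> \<le> ?r * ?N" using Z sum_bounded_above[of exceptional_orbits "\<lambda>Z. 2 * card Z" ?N] by simp
  finally have "?r * ?N + 4 \<le> 4 * ?N" using count by linarith
  then have "?r < 4" using mult_le_mono1[of 4 ?r ?N] by linarith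
  moreover have "?r * 3 \<le> (\<Sum>Z\<in>exceptional_orbits. card Z)"
    using Z sum_bounded_below[of exceptional_orbits 3 card] by simp
  ultimately have "?r = 3"
  proof -
    assume l: "?r < 4" and g: "?r * 3 \<le> (\<Sum>Z\<in>exceptional_orbits. card Z)"
    consider "?r = 0" | "?r = 1" | "?r = 2" | "?r = 3" using l by linarith
    then show "?r = 3"
    proof cases
      case 1 then show ?thesis using count order_ge_3 g by simp
    next
      case 2
      then have "(\<Sum>Z\<in>exceptional_orbits. card Z) + 2 * ?N = ?N + 2" using count by (simp only: mult_1)
      then show ?thesis using order_ge_3 by linarith
    next
      case 3
      then have "(\<Sum>Z\<in>exceptional_orbits. card Z) + 2 * ?N = 2 * ?N + 2" using count by (simp only:)
      then show ?thesis using g 3 by linarith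
    qed
  qed
  then obtain A B C where abc: "exceptional_orbits = {A, B, C}" "A \<noteq> B" "A \<noteq> C" "B \<noteq> C"
    by (auto simp: card_3_iff)
  have sizes: "card A + card B + card C = ?N + 2"
    using count \<open>?r = 3\<close> abc by simp
  have sorted: "(?N, card A', card B', card C') \<in> {(12, 6, 4, 4), (24, 12, 8, 6), (60, 30, 20, 12)}"
    if "A' \<in> exceptional_orbits" "B' \<in> exceptional_orbits" "C' \<in> exceptional_orbits"
      "card A' \<ge> card B'" "card B' \<ge> card C'" "card A' + card B' + card C' = ?N + 2" for A' B' C'
    using that Z by (intro three_orbit_sizes) auto
  have "\<exists>A' B' C'. {A', B', C'} = {A, B, C} \<and> card A' \<ge> card B' \<and> card B' \<ge> card C' \<and>
      A' \<noteq> B' \<and> A' \<noteq> C' \<and> B' \<noteq> C' \<and> card A' + card B' + card C' = ?N + 2"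
  proof -
    \<comment> \<open>The three orbits are given without an order; sort them by size.\<close>
    consider "card A \<ge> card B" "card B \<ge> card C" | "card A \<ge> card C" "card C \<ge> card B"
      | "card B \<ge> card A" "card A \<ge> card C" | "card B \<ge> card C" "card C \<ge> card A"
      | "card C \<ge> card A" "card A \<ge> card B" | "card C \<ge> card B" "card B \<ge> card A" by linarith
    then show ?thesis
    proof cases
      case 1 then show ?thesis using abc(2-4) abc(2-4)[symmetric] sizes
        by (intro exI[of _ A] exI[of _ B] exI[of _ C] conjI) (assumption | simp add: insert_commute)+
    next
      case 2 then show ?thesis using abc(2-4) abc(2-4)[symmetric] sizes
        by (intro exI[of _ A] exI[of _ C] exI[of _ B] conjI) (assumption | simp add: insert_commute)+
    next
      case 3 then show ?thesis using abc(2-4) abc(2-4)[symmetric] sizes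
        by (intro exI[of _ B] exI[of _ A] exI[of _ C] conjI) (assumption | simp add: insert_commute)+
    next
      case 4 then show ?thesis using abc(2-4) abc(2-4)[symmetric] sizes
        by (intro exI[of _ B] exI[of _ C] exI[of _ A] conjI) (assumption | simp add: insert_commute)+
    next
      case 5 then show ?thesis using abc(2-4) abc(2-4)[symmetric] sizes
        by (intro exI[of _ C] exI[of _ A] exI[of _ B] conjI) (assumption | simp add: insert_commute)+
    next
      case 6 then show ?thesis using abc(2-4) abc(2-4)[symmetric] sizes
        by (intro exI[of _ C] exI[of _ B] exI[of _ A] conjI) (assumption | simp add: insert_commute)+
    qed
  qed
  then obtain A' B' C' where perm: "{A', B', C'} = {A, B, C}"
    and ge: "card A' \<ge> card B'" "card B' \<ge> card C'"
    and ne: "A' \<noteq> B'" "A' \<noteq> C'" "B' \<noteq> C'" and sum: "card A' + card B' + card C' = ?N + 2"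
    by (elim exE conjE) (rule that)
  have eq: "exceptional_orbits = {A', B', C'}" unfolding perm by (rule abc(1))
  then have "A' \<in> exceptional_orbits" "B' \<in> exceptional_orbits" "C' \<in> exceptional_orbits" by blast+
  then show thesis
    by (intro that[OF eq ne] sorted[OF _ _ _ ge sum])
qed

lemma card_Union_orbits:
  assumes "Z \<subseteq> orbits G E \<phi>" "finite Z" shows "card (\<Union> Z) = (\<Sum>W\<in>Z. card W)"
proof (rule card_Union_disjoint)
  show "pairwise disjnt Z"
    using disjoint_union assms(1) by (auto simp: pairwise_def disjnt_def subset_iff)
  show "finite W" if "W \<in> Z" for W
    using that assms(1) finite_orbit by (auto simp: orbits_def)
qed

lemma orbit_image:
  assumes "Z \<in> orbits G E \<phi>" "g \<in> carrier G" shows "\<phi> g ` Z = Z"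
proof (rule card_subset_eq)
  obtain x where x: "x \<in> E" "Z = orbit G \<phi> x" using assms(1) by (auto simp: orbits_def)
  show "finite Z" unfolding x(2) by (rule finite_orbit)
  show "\<phi> g ` Z \<subseteq> Z"
  proof (rule image_subsetI)
    fix y assume y: "y \<in> Z"
    then have "y \<in> E" using x orbit_subset by blast
    have "\<phi> g y \<in> orbit G \<phi> y" using assms(2) by (auto simp: orbit_def)
    then show "\<phi> g y \<in> Z" using orbit_eqI[OF x(1)] y x(2) by simp
  qed
  have "inj_on (\<phi> g) Z" by (rule inj_on_subset[OF inj_prop[OF assms(2)]]) (use x orbit_subset in simp)
  then show "card (\<phi> g ` Z) = card Z" by (rule card_image)
qed

lemma Union_orbits_image:
  assumes "Z \<subseteq> orbits G E \<phi>" "g \<in> carrier G" shows "\<phi> g ` \<Union> Z = \<Union> Z"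
proof -
  have "\<phi> g ` \<Union> Z = (\<Union>W\<in>Z. \<phi> g ` W)" by (rule image_Union)
  also have "\<dots> = \<Union> Z" using orbit_image assms by (simp add: subset_iff)
  finally show ?thesis .
qed

lemma infinite_orbits: assumes "infinite E" shows "infinite (orbits G E \<phi>)"
proof
  assume "finite (orbits G E \<phi>)"
  moreover have "finite W" if "W \<in> orbits G E \<phi>" for W
    using that finite_orbit by (auto simp: orbits_def)
  ultimately have "finite (\<Union> (orbits G E \<phi>))" by (rule finite_Union)
  then show False using assms orbits_coverture by simp
qed

text \<open>
  An invariant set is a union of orbits, and all orbits other than the exceptional ones have as many
  points as the group has elements.
\<close>

lemma card_invariant:
  assumes "finite \<alpha>" "\<alpha> \<subseteq> E" and inv: "\<And>g. g \<in> carrier G \<Longrightarrow> \<phi> g ` \<alpha> \<subseteq> \<alpha>"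
  obtains X k where "X \<subseteq> exceptional_orbits" "card \<alpha> = (\<Sum>W\<in>X. card W) + k * order G"
proof -
  define Z where "Z = {W \<in> orbits G E \<phi>. W \<subseteq> \<alpha>}"
  have Z: "Z \<subseteq> orbits G E \<phi>" by (auto simp: Z_def)
  have "finite Z" by (rule finite_subset[of _ "Pow \<alpha>"]) (use assms(1) in \<open>auto simp: Z_def\<close>)
  have "\<Union> Z = \<alpha>"
  proof (intro equalityI subsetI)
    fix x assume "x \<in> \<alpha>"
    then have "x \<in> E" using assms(2) by blast
    have "orbit G \<phi> x \<subseteq> \<alpha>" using inv \<open>x \<in> \<alpha>\<close> by (auto simp: orbit_def)
    then have "orbit G \<phi> x \<in> Z" using \<open>x \<in> E\<close> by (auto simp: Z_def orbits_def)
    then show "x \<in> \<Union> Z" using orbit_refl[OF \<open>x \<in> E\<close>] by blast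
  qed (auto simp: Z_def)
  define X where "X = Z \<inter> exceptional_orbits"
  have "card \<alpha> = (\<Sum>W\<in>Z. card W)" using card_Union_orbits[OF Z \<open>finite Z\<close>] \<open>\<Union> Z = \<alpha>\<close> by simp
  also have "\<dots> = (\<Sum>W\<in>X. card W) + (\<Sum>W\<in>Z - X. card W)"
    using \<open>finite Z\<close> by (subst sum.subset_diff[of X Z]) (auto simp: X_def)
  also have "(\<Sum>W\<in>Z - X. card W) = (\<Sum>W\<in>Z - X. order G)"
    by (rule sum.cong) (use Z in \<open>auto simp: X_def exceptional_orbits_def\<close>)
  also have "\<dots> = card (Z - X) * order G" by simp
  finally show thesis by (intro that[of X]) (auto simp: X_def)
qed

lemma card_generic_orbits:
  assumes "X \<subseteq> exceptional_orbits" "Y \<subseteq> orbits G E \<phi> - exceptional_orbits" "finite Y"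
  shows "card (\<Union> (X \<union> Y)) = (\<Sum>W\<in>X. card W) + card Y * order G"
proof -
  have "finite X" using finite_subset[OF assms(1) finite_exceptional_orbits] .
  have "card (\<Union> (X \<union> Y)) = (\<Sum>W\<in>X \<union> Y. card W)"
    by (rule card_Union_orbits) (use assms \<open>finite X\<close> in \<open>auto simp: exceptional_orbits_def\<close>)
  also have "\<dots> = (\<Sum>W\<in>X. card W) + (\<Sum>W\<in>Y. card W)"
    by (rule sum.union_disjoint) (use assms \<open>finite X\<close> in auto)
  also have "(\<Sum>W\<in>Y. card W) = (\<Sum>W\<in>Y. order G)"
    by (rule sum.cong) (use assms in \<open>auto simp: exceptional_orbits_def\<close>)
  finally show ?thesis by simp
qed

end

section \<open>Moebius transformations of the extended plane\<close>

definition moebius_maps :: "(complex option \<Rightarrow> complex option) set" where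
  "moebius_maps = {moebius a b c d | a b c d. a * d - b * c \<noteq> 0}"

lemma moebius_mapsI: "a * d - b * c \<noteq> 0 \<Longrightarrow> moebius a b c d \<in> moebius_maps"
  by (auto simp: moebius_maps_def)

lemma moebius_comp:
  assumes "a * d - b * c \<noteq> 0" "a' * d' - b' * c' \<noteq> 0"
  shows "moebius a b c d \<circ> moebius a' b' c' d' =
    moebius (a * a' + b * c') (a * b' + b * d') (c * a' + d * c') (c * b' + d * d')"
proof
  fix x
  show "(moebius a b c d \<circ> moebius a' b' c' d') x =
    moebius (a * a' + b * c') (a * b' + b * d') (c * a' + d * c') (c * b' + d * d') x"
  proof (cases x)
    case None
    show ?thesis
    proof (cases "c' = 0")
      case True
      with assms(2) have "a' \<noteq> 0" by auto
      with None True show ?thesis by simp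
    next
      case False
      then have eqs: "c * (a' / c') + d = (c * a' + d * c') / c'" "a * (a' / c') + b = (a * a' + b * c') / c'"
        by (simp_all add: field_simps)
      with None False show ?thesis by (simp only: comp_apply moebius.simps if_False eqs) simp
    qed
  next
    case (Some z)
    have num: "(a * a' + b * c') * z + (a * b' + b * d') = a * (a' * z + b') + b * (c' * z + d')"
      and den: "(c * a' + d * c') * z + (c * b' + d * d') = c * (a' * z + b') + d * (c' * z + d')"
      by (simp_all add: algebra_simps)
    show ?thesis
    proof (cases "c' * z + d' = 0")
      case True
      have "a' * z + b' \<noteq> 0"
      proof
        assume *: "a' * z + b' = 0"
        have "a' * d' - b' * c' = a' * (c' * z + d') - c' * (a' * z + b')" by (simp add: algebra_simps)
        with * True assms(2) show False by simp
      qed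
      with True Some show ?thesis by (simp add: num den)
    next
      case False
      then have eqs: "c * ((a' * z + b') / (c' * z + d')) + d = (c * (a' * z + b') + d * (c' * z + d')) / (c' * z + d')"
        "a * ((a' * z + b') / (c' * z + d')) + b = (a * (a' * z + b') + b * (c' * z + d')) / (c' * z + d')"
        by (simp_all add: field_simps)
      show ?thesis using False Some
        by (simp only: comp_apply moebius.simps if_False eqs num den) simp
    qed
  qed
qed

lemma moebius_scalar: "k \<noteq> 0 \<Longrightarrow> moebius k 0 0 k = id"
proof
  fix x assume "k \<noteq> 0" then show "moebius k 0 0 k x = id x" by (cases x) auto
qed

lemma moebius_maps_comp:
  assumes "f \<in> moebius_maps" "g \<in> moebius_maps" shows "f \<circ> g \<in> moebius_maps"
proof -
  obtain a b c d where f: "f = moebius a b c d" "a * d - b * c \<noteq> 0" using assms by (auto simp: moebius_maps_def)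
  obtain a' b' c' d' where g: "g = moebius a' b' c' d'" "a' * d' - b' * c' \<noteq> 0"
    using assms by (auto simp: moebius_maps_def)
  have "(a * a' + b * c') * (c * b' + d * d') - (a * b' + b * d') * (c * a' + d * c')
      = (a * d - b * c) * (a' * d' - b' * c')" by (simp add: algebra_simps)
  with f g show ?thesis by (simp add: moebius_comp moebius_mapsI)
qed

lemma moebius_maps_id: "id \<in> moebius_maps"
  using moebius_mapsI[of 1 1 0 0] moebius_scalar[of 1] by simp

lemma moebius_maps_inverse:
  assumes "f \<in> moebius_maps"
  obtains g where "g \<in> moebius_maps" "f \<circ> g = id" "g \<circ> f = id"
proof -
  obtain a b c d where f: "f = moebius a b c d" "a * d - b * c \<noteq> 0"
    using assms by (auto simp: moebius_maps_def)
  have det: "d * a - (- b) * (- c) \<noteq> 0" using f(2) by (simp add: algebra_simps)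
  show thesis
  proof (rule that)
    show "moebius d (- b) (- c) a \<in> moebius_maps" by (rule moebius_mapsI[OF det])
    show "f \<circ> moebius d (- b) (- c) a = id"
      using moebius_comp[OF f(2) det] moebius_scalar[OF f(2)] by (simp add: f(1) algebra_simps)
    show "moebius d (- b) (- c) a \<circ> f = id"
      using moebius_comp[OF det f(2)] moebius_scalar[OF f(2)] by (simp add: f(1) algebra_simps)
  qed
qed

lemma moebius_to_infinity: obtains q where "q \<in> moebius_maps" "q x = None"
proof (cases x)
  case None then show thesis using that[OF moebius_maps_id] by simp
next
  case (Some z)
  show thesis using that[OF moebius_mapsI[of 0 "- z" 1 1]] Some by simp
qed

text \<open>
  For \<open>c = 0\<close> the determinant is \<open>a * d\<close>, so \<open>d\<close> can be scaled to 1: the Moebius transformations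
  fixing infinity are the affine maps \<open>z \<mapsto> a * z + b\<close>.
\<close>

lemma moebius_fixing_infinity:
  assumes "f \<in> moebius_maps" "f None = None"
  obtains a b where "a \<noteq> 0" "f = moebius a b 0 1"
proof -
  obtain a b c d where f: "f = moebius a b c d" "a * d - b * c \<noteq> 0"
    using assms(1) by (auto simp: moebius_maps_def)
  with assms(2) have c: "c = 0" by (auto split: if_splits)
  with f(2) have "a \<noteq> 0" "d \<noteq> 0" by auto
  have "f x = moebius (a / d) (b / d) 0 1 x" for x
    using f(1) c \<open>d \<noteq> 0\<close> by (cases x) (auto simp: field_simps)
  then show thesis using \<open>a \<noteq> 0\<close> \<open>d \<noteq> 0\<close> by (intro that[of "a / d" "b / d"]) auto
qed

lemma moebius_has_fixed_point:
  assumes "f \<in> moebius_maps" obtains x where "f x = x"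
proof -
  obtain a b c d where f: "f = moebius a b c d" "a * d - b * c \<noteq> 0"
    using assms by (auto simp: moebius_maps_def)
  show thesis
  proof (cases "c = 0")
    case True then show thesis using that[of None] f by simp
  next
    case False
    \<comment> \<open>A finite fixed point is a root of \<open>c * z\<^sup>2 + (d - a) * z - b\<close>, given by the quadratic formula.\<close>
    define s where "s = csqrt ((d - a)\<^sup>2 + 4 * c * b)"
    define z where "z = ((a - d) + s) / (2 * c)"
    have s: "s * s = (d - a)\<^sup>2 + 4 * c * b" unfolding s_def by (simp flip: power2_eq_square)
    have quad: "c * z * z + (d - a) * z = b"
    proof -
      have "4 * c * (c * z * z + (d - a) * z) = (2 * c * z) * (2 * c * z) + 2 * (d - a) * (2 * c * z)"
        by (simp add: algebra_simps)
      also have "2 * c * z = (a - d) + s" using False by (simp add: z_def)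
      also have "((a - d) + s) * ((a - d) + s) + 2 * (d - a) * ((a - d) + s) = s * s - (d - a)\<^sup>2"
        by (simp add: algebra_simps power2_eq_square)
      finally have "4 * c * (c * z * z + (d - a) * z) = 4 * c * b" using s by simp
      with False show ?thesis by simp
    qed
    have nz: "c * z + d \<noteq> 0"
    proof
      assume 0: "c * z + d = 0"
      have "b = (c * z + d) * z - a * z" using quad by (simp add: algebra_simps)
      with 0 have b: "b = - (a * z)" by simp
      have "a * d - b * c = a * (c * z + d)" unfolding b by (simp add: algebra_simps)
      with 0 f(2) show False by simp
    qed
    have "a * z + b = z * (c * z + d)" unfolding quad[symmetric] by (simp add: algebra_simps)
    with nz have "f (Some z) = Some z" unfolding f(1) by (simp add: field_simps)
    then show thesis by (rule that)
  qed
qed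

lemma funpow_conj: "q' \<circ> q = id \<Longrightarrow> (q \<circ> f \<circ> q') ^^ n \<circ> q = q \<circ> f ^^ n"
  by (induction n) (simp_all add: fun_eq_iff funpow_swap1)

lemma translation_funpow: "(moebius 1 b 0 1 ^^ n) (Some z) = Some (z + of_nat n * b)"
  by (induction n) (simp_all add: algebra_simps)

text \<open>
  The \<open>n\<close>-th iterate is the translation by \<open>n * b\<close>.
\<close>

lemma translation_finite_order:
  assumes "moebius 1 b 0 1 ^^ n = id" "n > 0" shows "b = 0"
proof -
  have "(moebius 1 b 0 1 ^^ n) (Some 0) = Some 0" using assms by simp
  with assms(2) show ?thesis by (simp only: translation_funpow) simp
qed

lemma conj_eq_id:
  assumes "q' \<circ> q = id" "q \<circ> f \<circ> q' = id" shows "f = id"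
proof -
  have "f y = q' ((q \<circ> f \<circ> q') (q y))" for y using assms(1) by (simp add: fun_eq_iff)
  then have "f y = y" for y using assms(1) unfolding assms(2) by (simp add: fun_eq_iff)
  then show ?thesis by (simp add: fun_eq_iff)
qed

text \<open>
  Moving a fixed point to infinity turns a Moebius transformation into an affine map, from whose two
  coefficients fixed points and order can be read off.
\<close>

lemma conjugate_to_affine:
  assumes "f \<in> moebius_maps" "f x = x"
  obtains q q' a b where "q \<circ> q' = id" "q' \<circ> q = id" "a \<noteq> 0" "q \<circ> f \<circ> q' = moebius a b 0 1" "q x = None"
proof -
  obtain q where q: "q \<in> moebius_maps" "q x = None" by (rule moebius_to_infinity)
  obtain q' where q': "q' \<in> moebius_maps" "q \<circ> q' = id" "q' \<circ> q = id"
    by (rule moebius_maps_inverse[OF q(1)])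
  have "q' None = x" using q(2) q'(3) by (metis comp_apply id_apply)
  then have "(q \<circ> f \<circ> q') None = None" using assms(2) q(2) by simp
  moreover have "q \<circ> f \<circ> q' \<in> moebius_maps" using q(1) q'(1) assms(1) by (intro moebius_maps_comp)
  ultimately obtain a b where "a \<noteq> 0" "q \<circ> f \<circ> q' = moebius a b 0 1" by (blast elim: moebius_fixing_infinity)
  with q q' that show thesis by blast
qed

lemma fixed_points_conj:
  assumes "q \<circ> q' = id" "q' \<circ> q = id"
  shows "bij_betw q {x. f x = x} {y. (q \<circ> f \<circ> q') y = y}"
proof -
  have [simp]: "q (q' y) = y" "q' (q x) = x" for x y using assms by (simp_all add: fun_eq_iff)
  have "f (q' y) = q' y" if "q (f (q' y)) = y" for y using arg_cong[OF that, of q'] by simp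
  then show ?thesis by (intro bij_betw_byWitness[where f' = q']) auto
qed

lemma affine_fixed_points:
  assumes "a \<noteq> 1" shows "{y. moebius a b 0 1 y = y} = {None, Some (b / (1 - a))}"
proof -
  have "moebius a b 0 1 y = y \<longleftrightarrow> y = None \<or> y = Some (b / (1 - a))" for y
  proof (cases y)
    case (Some z)
    have "a * z + b = z \<longleftrightarrow> z = b / (1 - a)" using assms by (auto simp: field_simps)
    with Some show ?thesis by simp
  qed simp
  then show ?thesis by auto
qed

text \<open>
  An affine map with \<open>a \<noteq> 1\<close> fixes only infinity and one further point. So after one of the three
  points has been moved to infinity, \<open>a = 1\<close>, and a translation with a finite fixed point is the
  identity.
\<close>

lemma moebius_three_fixed_points:
  assumes "f \<in> moebius_maps" "f x = x" "f y = y" "f z = z" "x \<noteq> y" "x \<noteq> z" "y \<noteq> z"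
  shows "f = id"
proof -
  obtain q q' a b where q: "q \<circ> q' = id" "q' \<circ> q = id" "a \<noteq> 0" "q \<circ> f \<circ> q' = moebius a b 0 1"
    by (rule conjugate_to_affine[OF assms(1,2)])
  note bij = fixed_points_conj[OF q(1,2), of f, unfolded q(4)]
  have "a = 1"
  proof (rule ccontr)
    assume "a \<noteq> 1"
    have "card {x. f x = x} = card {None, Some (b / (1 - a))}"
      using bij_betw_same_card[OF bij] affine_fixed_points[OF \<open>a \<noteq> 1\<close>] by simp
    moreover have "finite {x. f x = x}"
      using bij_betw_finite[OF bij] affine_fixed_points[OF \<open>a \<noteq> 1\<close>] by simp
    moreover have "card {x, y, z} \<le> card {x. f x = x}"
      using assms by (intro card_mono \<open>finite _\<close>) auto
    ultimately show False using assms by simp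
  qed
  moreover have "b = 0"
  proof -
    have "\<exists>w\<in>{x, y}. q w \<noteq> None" using assms(5) q(2) by (metis comp_apply id_apply insertCI)
    then obtain w where "f w = w" "q w \<noteq> None" using assms by auto
    then obtain u where u: "q w = Some u" by auto
    have "moebius a b 0 1 (q w) = q w"
      using q(2) \<open>f w = w\<close> unfolding q(4)[symmetric] by (simp add: fun_eq_iff)
    with \<open>a = 1\<close> u show ?thesis by simp
  qed
  ultimately have "q \<circ> f \<circ> q' = id" using q(4) moebius_scalar[of 1] by simp
  then show ?thesis using q(2) conj_eq_id by blast
qed

text \<open>
  With one fixed point at infinity the map is \<open>z \<mapsto> a * z + b\<close>. For \<open>a = 1\<close> it is a translation,
  whose order is infinite unless it is the identity. For \<open>a \<noteq> 1\<close> the second fixed point is \<open>b / (1 -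
  a)\<close>.
\<close>

lemma moebius_finite_order_fixed_points:
  assumes "f \<in> moebius_maps" "f \<noteq> id" "f ^^ n = id" "n > 0"
  shows "card {x. f x = x} = 2"
proof -
  obtain x where "f x = x" by (rule moebius_has_fixed_point[OF assms(1)])
  obtain q q' a b where q: "q \<circ> q' = id" "q' \<circ> q = id" "a \<noteq> 0" "q \<circ> f \<circ> q' = moebius a b 0 1"
    by (rule conjugate_to_affine[OF assms(1) \<open>f x = x\<close>])
  have "a \<noteq> 1"
  proof
    assume a: "a = 1"
    have "moebius a b 0 1 ^^ n \<circ> q = q" using funpow_conj[OF q(2), of n f] assms(3) q(4) by simp
    then have "moebius a b 0 1 ^^ n \<circ> (q \<circ> q') = q \<circ> q'" by (metis comp_assoc)
    then have "moebius 1 b 0 1 ^^ n = id" using a q(1) by simp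
    then have "b = 0" using translation_finite_order assms(4) by blast
    then have "q \<circ> f \<circ> q' = id" using q(4) a moebius_scalar[of 1] by simp
    then show False using q(2) conj_eq_id assms(2) by blast
  qed
  have "card {x. f x = x} = card {None, Some (b / (1 - a))}"
    unfolding affine_fixed_points[OF \<open>a \<noteq> 1\<close>, of b, symmetric] q(4)[symmetric]
    by (rule bij_betw_same_card[OF fixed_points_conj[OF q(1,2)]])
  then show ?thesis by simp
qed

text \<open>
  After the common fixed point has been moved to infinity, both maps are affine, and the commutator
  of two affine maps is a translation. As it has finite order, it is trivial. The inverses are given
  as extra maps, so that the lemma can be applied to images of group elements.
\<close>

lemma moebius_common_fixed_point_commute:
  assumes "f \<in> moebius_maps" "g \<in> moebius_maps" "f x = x" "g x = x"
    and inv: "f \<circ> f' = id" "f' \<circ> f = id" "g \<circ> g' = id" "g' \<circ> g = id"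
    and fin: "(f \<circ> g \<circ> f' \<circ> g') ^^ n = id" "n > 0"
  shows "f \<circ> g = g \<circ> f"
proof -
  obtain q where q: "q \<in> moebius_maps" "q x = None" by (rule moebius_to_infinity)
  obtain q' where q': "q' \<in> moebius_maps" "q \<circ> q' = id" "q' \<circ> q = id"
    by (rule moebius_maps_inverse[OF q(1)])
  have q'q: "q' (q y) = y" and qq': "q (q' y) = y" for y
    using q'(2,3) by (simp_all add: fun_eq_iff)
  have "q' None = x" using q'q[of x] q(2) by simp
  define F where "F = q \<circ> f \<circ> q'"
  define K where "K = q \<circ> g \<circ> q'"
  define T where "T = q \<circ> (f \<circ> g \<circ> f' \<circ> g') \<circ> q'"
  have "F None = None" "K None = None" using \<open>q' None = x\<close> q(2) assms(3,4) by (simp_all add: F_def K_def)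
  moreover have "F \<in> moebius_maps" "K \<in> moebius_maps"
    unfolding F_def K_def using q(1) q'(1) assms(1,2) by (simp_all only: moebius_maps_comp)
  ultimately have FN: "F None = None" "F \<in> moebius_maps" and KN: "K None = None" "K \<in> moebius_maps" by simp_all
  obtain a b where F: "a \<noteq> 0" "F = moebius a b 0 1" by (rule moebius_fixing_infinity[OF FN(2,1)])
  obtain c e where K: "c \<noteq> 0" "K = moebius c e 0 1" by (rule moebius_fixing_infinity[OF KN(2,1)])
  have TKF: "T \<circ> (K \<circ> F) = F \<circ> K"
    using inv unfolding T_def K_def F_def by (simp add: fun_eq_iff q'q)
  \<comment> \<open>\<open>F \<circ> K\<close> and \<open>K \<circ> F\<close> have the same linear coefficient and differ by the translation by \<open>t\<close>.\<close>
  define t where "t = (a * e + b) - (c * b + e)"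
  have "T y = moebius 1 t 0 1 y" for y
  proof -
    define y' where "y' = moebius (1 / (a * c)) (- (c * b + e) / (a * c)) 0 1 y"
    have y: "y = (K \<circ> F) y'"
      using F K by (cases y) (auto simp: y'_def field_simps)
    show ?thesis
      unfolding y using fun_cong[OF TKF, of y'] F K
      by (cases y') (auto simp: t_def algebra_simps)
  qed
  then have T: "T = moebius 1 t 0 1" by blast
  have "T ^^ n \<circ> q = q" using funpow_conj[OF q'(3), of n "f \<circ> g \<circ> f' \<circ> g'"] fin(1) by (simp add: T_def)
  then have "T ^^ n \<circ> (q \<circ> q') = q \<circ> q'" by (metis comp_assoc)
  then have "T ^^ n = id" using q'(2) by simp
  then have "t = 0" using translation_finite_order fin(2) unfolding T by blast
  then have "T = id" using T moebius_scalar[of 1] by simp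
  then have "F \<circ> K = K \<circ> F" using TKF by simp
  then have "q' (F (K (q y))) = q' (K (F (q y)))" for y by (simp add: fun_eq_iff)
  then show ?thesis by (simp add: F_def K_def fun_eq_iff q'q)
qed

section \<open>Moebius transformations of the sphere\<close>

lemma sphere3: "x \<in> S2 \<longleftrightarrow> (x $ 1)\<^sup>2 + (x $ 2)\<^sup>2 + (x $ 3)\<^sup>2 = 1"
proof -
  have "x \<in> S2 \<longleftrightarrow> norm x = 1" by simp
  also have "\<dots> \<longleftrightarrow> x \<bullet> x = 1" by (simp add: norm_eq_sqrt_inner)
  finally show ?thesis by (simp add: inner_vec_def sum_3 power2_eq_square)
qed

lemma vec3_eqI: "x $ 1 = y $ 1 \<Longrightarrow> x $ 2 = y $ 2 \<Longrightarrow> x $ 3 = y $ 3 \<Longrightarrow> x = (y :: real^3)"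
  by (simp add: vec_eq_iff forall_3)

lemma stereo_inj: "inj_on stereo S2"
proof (rule inj_onI)
  fix x y assume x: "x \<in> S2" and y: "y \<in> S2" and eq: "stereo x = stereo y"
  show "x = y"
  proof (cases "x $ 3 = 1")
    case True
    with eq have "y $ 3 = 1" by (auto simp: stereo_def split: if_splits)
    have "z $ 1 = 0 \<and> z $ 2 = 0" if "z \<in> S2" "z $ 3 = 1" for z
      using that(1) unfolding sphere3 that(2) by (simp add: sum_power2_eq_zero_iff)
    from this[OF x True] this[OF y \<open>y $ 3 = 1\<close>] True \<open>y $ 3 = 1\<close>
    show ?thesis by (intro vec3_eqI) simp_all
  next
    case False
    with eq have y3: "y $ 3 \<noteq> 1" by (auto simp: stereo_def split: if_splits)
    define u v where "u = x $ 1 / (1 - x $ 3)" and "v = x $ 2 / (1 - x $ 3)"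
    have uv: "u = y $ 1 / (1 - y $ 3)" "v = y $ 2 / (1 - y $ 3)"
      using eq False y3 by (auto simp: stereo_def u_def v_def)
    \<comment> \<open>The line from the north pole through the point \<open>u + i * v\<close> of the plane meets the sphere in one further point.\<close>
    have key: "z $ 3 = (u\<^sup>2 + v\<^sup>2 - 1) / (u\<^sup>2 + v\<^sup>2 + 1)"
      if "z \<in> S2" "z $ 3 \<noteq> 1" "z $ 1 = u * (1 - z $ 3)" "z $ 2 = v * (1 - z $ 3)" for z
    proof -
      define t where "t = z $ 3"
      have "(u * (1 - t))\<^sup>2 + (v * (1 - t))\<^sup>2 + t\<^sup>2 = 1"
        using that(1) unfolding sphere3 that(3,4) t_def .
      moreover have "((u\<^sup>2 + v\<^sup>2) * (1 - t)) * (1 - t) = (u * (1 - t))\<^sup>2 + (v * (1 - t))\<^sup>2"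
        by (simp add: power_mult_distrib power2_eq_square[of "1 - t"] distrib_right mult.assoc)
      moreover have "(1 + t) * (1 - t) = 1 - t\<^sup>2" by (simp add: power2_eq_square algebra_simps)
      ultimately have "((u\<^sup>2 + v\<^sup>2) * (1 - t)) * (1 - t) = (1 + t) * (1 - t)" by linarith
      then have "(u\<^sup>2 + v\<^sup>2) * (1 - t) = 1 + t" using that(2) by (simp add: t_def)
      moreover have "(u\<^sup>2 + v\<^sup>2) * (1 - t) = (u\<^sup>2 + v\<^sup>2) - (u\<^sup>2 + v\<^sup>2) * t"
        by (simp only: right_diff_distrib mult_1_right)
      moreover have "t * (u\<^sup>2 + v\<^sup>2 + 1) = (u\<^sup>2 + v\<^sup>2) * t + t"
        by (simp add: algebra_simps)
      ultimately have "t * (u\<^sup>2 + v\<^sup>2 + 1) = u\<^sup>2 + v\<^sup>2 - 1" by linarith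
      moreover have "u\<^sup>2 + v\<^sup>2 + 1 \<noteq> 0" using sum_power2_ge_zero[of u v] by linarith
      ultimately show ?thesis by (simp add: t_def eq_divide_eq)
    qed
    have x12: "x $ 1 = u * (1 - x $ 3)" "x $ 2 = v * (1 - x $ 3)" using False by (simp_all add: u_def v_def)
    have y12: "y $ 1 = u * (1 - y $ 3)" "y $ 2 = v * (1 - y $ 3)" using y3 by (simp_all add: uv)
    have 3: "x $ 3 = y $ 3"
      by (simp only: key[OF x False x12] key[OF y y3 y12])
    then show ?thesis by (intro vec3_eqI) (simp_all only: x12 y12)
  qed
qed

lemma stereo_surj: "stereo ` S2 = UNIV"
proof -
  have "w \<in> stereo ` S2" for w
  proof (cases w)
    case None
    have "vector [0, 0, 1] \<in> S2" by (simp only: sphere3 vector_3) simp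
    moreover have "w = stereo (vector [0, 0, 1])" using None by (simp add: stereo_def)
    ultimately show ?thesis by (rule rev_image_eqI)
  next
    case (Some z)
    \<comment> \<open>\<open>x\<close> below is the inverse stereographic projection of \<open>z\<close>; its height is \<open>(\<bar>z\<bar>\<^sup>2 - 1) / (\<bar>z\<bar>\<^sup>2 + 1)\<close>.\<close>
    define r where "r = (Re z)\<^sup>2 + (Im z)\<^sup>2 + 1"
    have r: "r > 0" by (simp add: r_def add_nonneg_pos)
    define x :: "real^3" where "x = vector [2 * Re z / r, 2 * Im z / r, (r - 2) / r]"
    have "(2 * Re z)\<^sup>2 + (2 * Im z)\<^sup>2 + (r - 2)\<^sup>2 = r\<^sup>2"
      unfolding r_def by (simp add: power2_eq_square algebra_simps)
    then have "x \<in> S2" using r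
      by (simp only: sphere3 x_def vector_3 power_divide flip: add_divide_distrib) simp
    moreover have "1 - x $ 3 = 2 / r" using r by (simp add: x_def field_simps)
    then have "w = stereo x" using r Some by (auto simp: stereo_def x_def complex_eq_iff)
    ultimately show ?thesis by (intro rev_image_eqI)
  qed
  then show ?thesis by blast
qed

text \<open>
  The group structure has the same shape as \<^const>\<open>moebius_stabilizer\<close>, so that a stabilizer is such a
  group by definition.
\<close>

abbreviation sphere_group :: "(real^3 \<Rightarrow> real^3) set \<Rightarrow> (real^3 \<Rightarrow> real^3) monoid" where
  "sphere_group H \<equiv> (BijGroup S2)\<lparr>carrier := H\<rparr>"

text \<open>
  The map of the extended plane that corresponds to a map of the sphere. It is an injective
  homomorphism on \<^term>\<open>Bij S2\<close>, so facts about Moebius transformations of the extended plane carry over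
  to the sphere.
\<close>

definition conj_stereo :: "(real^3 \<Rightarrow> real^3) \<Rightarrow> complex option \<Rightarrow> complex option" where
  "conj_stereo f = stereo \<circ> f \<circ> inv_into S2 stereo"

lemma inv_stereo: "inv_into S2 stereo w \<in> S2" "stereo (inv_into S2 stereo w) = w"
  using stereo_surj by (metis UNIV_I inv_into_into, metis UNIV_I f_inv_into_f)

lemma inv_stereo_stereo: "x \<in> S2 \<Longrightarrow> inv_into S2 stereo (stereo x) = x"
  using stereo_inj by (rule inv_into_f_f)

lemma stereo_eq_iff: "x \<in> S2 \<Longrightarrow> y \<in> S2 \<Longrightarrow> stereo x = stereo y \<longleftrightarrow> x = y"
  using stereo_inj by (auto dest: inj_onD)

lemma Bij_S2_closed: "f \<in> Bij S2 \<Longrightarrow> x \<in> S2 \<Longrightarrow> f x \<in> S2"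
  using Bij_imp_funcset by blast

lemma conj_stereo_stereo: "x \<in> S2 \<Longrightarrow> conj_stereo f (stereo x) = stereo (f x)"
  by (simp only: conj_stereo_def comp_apply inv_stereo_stereo)

lemma conj_stereo_fixed:
  "f \<in> Bij S2 \<Longrightarrow> x \<in> S2 \<Longrightarrow> conj_stereo f (stereo x) = stereo x \<longleftrightarrow> f x = x"
  by (simp only: conj_stereo_stereo stereo_eq_iff Bij_S2_closed)

lemma conj_stereo_inj:
  assumes "f \<in> Bij S2" "g \<in> Bij S2" "conj_stereo f = conj_stereo g" shows "f = g"
proof (rule extensionalityI[where A = S2])
  fix x assume x: "x \<in> S2"
  have "stereo (f x) = stereo (g x)"
    using conj_stereo_stereo[OF x, of f] conj_stereo_stereo[OF x, of g] assms(3) by simp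
  then show "f x = g x" using stereo_eq_iff Bij_S2_closed assms(1,2) x by blast
qed (use assms in \<open>auto simp: Bij_def\<close>)

lemma moebius_S2_iff: "f \<in> moebius_S2 \<longleftrightarrow> f \<in> Bij S2 \<and> conj_stereo f \<in> moebius_maps"
proof -
  have "(\<forall>x\<in>S2. stereo (f x) = m (stereo x)) \<longleftrightarrow> conj_stereo f = m" for m
  proof
    assume L: "\<forall>x\<in>S2. stereo (f x) = m (stereo x)"
    show "conj_stereo f = m"
    proof
      fix w show "conj_stereo f w = m w"
        using L inv_stereo[of w] by (simp add: conj_stereo_def del: mem_sphere_0)
    qed
  qed (use conj_stereo_stereo in metis)
  then show ?thesis unfolding moebius_S2_def moebius_maps_def by auto
qed

lemma BijGroup_mult: "f \<in> Bij X \<Longrightarrow> g \<in> Bij X \<Longrightarrow> f \<otimes>\<^bsub>BijGroup X\<^esub> g = compose X f g"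
  by (simp add: BijGroup_def)

lemma conj_stereo_compose:
  assumes "f \<in> Bij S2" "g \<in> Bij S2"
  shows "conj_stereo (f \<otimes>\<^bsub>BijGroup S2\<^esub> g) = conj_stereo f \<circ> conj_stereo g"
proof
  fix w
  have "g (inv_into S2 stereo w) \<in> S2" using assms(2) inv_stereo(1) by (rule Bij_S2_closed)
  then show "conj_stereo (f \<otimes>\<^bsub>BijGroup S2\<^esub> g) w = (conj_stereo f \<circ> conj_stereo g) w"
    using inv_stereo(1)[of w] inv_stereo_stereo
    by (simp add: conj_stereo_def BijGroup_mult[OF assms] compose_def del: mem_sphere_0)
qed

lemma conj_stereo_one: "conj_stereo (\<one>\<^bsub>BijGroup S2\<^esub>) = id"
proof
  fix w show "conj_stereo (\<one>\<^bsub>BijGroup S2\<^esub>) w = id w"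
    using inv_stereo[of w] by (simp add: conj_stereo_def BijGroup_def del: mem_sphere_0)
qed

lemma carrier_BijGroup: "carrier (BijGroup X) = Bij X"
  by (simp add: BijGroup_def)

lemma conj_stereo_inverse:
  assumes "f \<in> Bij S2"
  shows "conj_stereo f \<circ> conj_stereo (inv\<^bsub>BijGroup S2\<^esub> f) = id"
    "conj_stereo (inv\<^bsub>BijGroup S2\<^esub> f) \<circ> conj_stereo f = id"
proof -
  interpret group "BijGroup S2" by (rule group_BijGroup)
  have f: "f \<in> carrier (BijGroup S2)" using assms by (simp add: carrier_BijGroup)
  then have i: "inv\<^bsub>BijGroup S2\<^esub> f \<in> Bij S2" using inv_closed by (simp add: carrier_BijGroup)
  show "conj_stereo f \<circ> conj_stereo (inv\<^bsub>BijGroup S2\<^esub> f) = id"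
    using conj_stereo_compose[OF assms i] r_inv[OF f] conj_stereo_one by simp
  show "conj_stereo (inv\<^bsub>BijGroup S2\<^esub> f) \<circ> conj_stereo f = id"
    using conj_stereo_compose[OF i assms] l_inv[OF f] conj_stereo_one by simp
qed

lemma moebius_S2_subgroup: "subgroup moebius_S2 (BijGroup S2)"
proof -
  interpret group "BijGroup S2" by (rule group_BijGroup)
  show ?thesis
  proof (rule subgroupI)
    show "moebius_S2 \<subseteq> carrier (BijGroup S2)" by (auto simp: moebius_S2_def carrier_BijGroup)
    have "\<one>\<^bsub>BijGroup S2\<^esub> \<in> moebius_S2"
      using one_closed conj_stereo_one moebius_maps_id by (simp add: moebius_S2_iff carrier_BijGroup)
    then show "moebius_S2 \<noteq> {}" by blast
    show "f \<otimes>\<^bsub>BijGroup S2\<^esub> g \<in> moebius_S2" if "f \<in> moebius_S2" "g \<in> moebius_S2" for f g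
      using that m_closed[of f g] moebius_maps_comp
      by (simp add: moebius_S2_iff carrier_BijGroup conj_stereo_compose)
    show "inv\<^bsub>BijGroup S2\<^esub> f \<in> moebius_S2" if f: "f \<in> moebius_S2" for f
    proof -
      have B: "f \<in> Bij S2" and m: "conj_stereo f \<in> moebius_maps" using f by (simp_all add: moebius_S2_iff)
      obtain m' where m': "m' \<in> moebius_maps" "conj_stereo f \<circ> m' = id" "m' \<circ> conj_stereo f = id"
        by (rule moebius_maps_inverse[OF m])
      have "conj_stereo (inv\<^bsub>BijGroup S2\<^esub> f) = (m' \<circ> conj_stereo f) \<circ> conj_stereo (inv\<^bsub>BijGroup S2\<^esub> f)"
        using m'(3) by simp
      also have "\<dots> = m'" using conj_stereo_inverse(1)[OF B] by (simp add: comp_assoc)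
      finally show ?thesis using m'(1) inv_closed[of f] B by (simp add: moebius_S2_iff carrier_BijGroup)
    qed
  qed
qed

lemma BijGroup_action: "group_action (BijGroup E) E (\<lambda>f. f)"
proof -
  have "(\<lambda>f. f) \<in> hom (BijGroup E) (BijGroup E)" by (simp add: hom_def)
  then show ?thesis
    unfolding group_action_def group_hom_def group_hom_axioms_def by (simp add: group_BijGroup)
qed

lemma sphere_group_action:
  "subgroup H (BijGroup S2) \<Longrightarrow> group_action (sphere_group H) S2 (\<lambda>f. f)"
  by (rule group_action.induced_action[OF BijGroup_action])

lemma sphere_group_group: "subgroup H (BijGroup S2) \<Longrightarrow> group (sphere_group H)"
  by (rule group.subgroup_imp_group[OF group_BijGroup])

lemma conj_stereo_pow:
  assumes "subgroup H (BijGroup S2)" "f \<in> H"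
  shows "conj_stereo (f [^]\<^bsub>sphere_group H\<^esub> (n::nat)) = conj_stereo f ^^ n"
proof -
  interpret G: group "sphere_group H" by (rule sphere_group_group[OF assms(1)])
  have sub: "H \<subseteq> Bij S2" using subgroup.subset[OF assms(1)] by (simp add: carrier_BijGroup)
  show ?thesis
  proof (induction n)
    case 0 show ?case using conj_stereo_one by (simp add: G.nat_pow_0)
  next
    case (Suc n)
    have "f [^]\<^bsub>sphere_group H\<^esub> n \<in> H" using G.nat_pow_closed[of f n] assms(2) by simp
    then have "conj_stereo (f [^]\<^bsub>sphere_group H\<^esub> Suc n) = conj_stereo (f [^]\<^bsub>sphere_group H\<^esub> n) \<circ> conj_stereo f"
      using conj_stereo_compose sub assms(2) by (simp add: G.nat_pow_Suc subset_iff)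
    then show ?case by (simp add: Suc.IH funpow_Suc_right del: funpow.simps)
  qed
qed

lemma finite_moebius_group_order:
  assumes "subgroup H (BijGroup S2)" "finite H" "f \<in> H"
  obtains n where "n > 0" "conj_stereo f ^^ n = id"
proof -
  interpret G: group "sphere_group H" by (rule sphere_group_group[OF assms(1)])
  have "order (sphere_group H) > 0" using assms(2,3) by (auto simp: order_def card_gt_0_iff)
  moreover have "f [^]\<^bsub>sphere_group H\<^esub> order (sphere_group H) = \<one>\<^bsub>BijGroup S2\<^esub>"
    using G.pow_order_eq_1[of f] assms(2,3) by simp
  then have "conj_stereo f ^^ order (sphere_group H) = id"
    using conj_stereo_pow[OF assms(1,3)] conj_stereo_one by metis
  ultimately show thesis by (rule that)
qed

text \<open>
  An element of a finite group has finite order, so this follows from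
  \<open>moebius_finite_order_fixed_points\<close> by stereographic projection.
\<close>

lemma moebius_S2_two_fixed_points:
  assumes "subgroup H (BijGroup S2)" "finite H" "H \<subseteq> moebius_S2" "f \<in> H" "f \<noteq> \<one>\<^bsub>BijGroup S2\<^esub>"
  shows "card {x \<in> S2. f x = x} = 2"
proof -
  have f: "f \<in> Bij S2" "conj_stereo f \<in> moebius_maps" using assms(3,4) by (auto simp: moebius_S2_iff)
  obtain n where n: "n > 0" "conj_stereo f ^^ n = id" by (rule finite_moebius_group_order[OF assms(1,2,4)])
  have "\<one>\<^bsub>BijGroup S2\<^esub> \<in> Bij S2" using subgroup.one_closed[OF assms(1)] assms(3) by (auto simp: moebius_S2_iff)
  then have "conj_stereo f \<noteq> id" using conj_stereo_inj[OF f(1)] conj_stereo_one assms(5) by metis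
  then have 2: "card {w. conj_stereo f w = w} = 2"
    by (rule moebius_finite_order_fixed_points[OF f(2) _ n(2,1)])
  \<comment> \<open>Stereographic projection matches the fixed points on the sphere with those in the extended plane.\<close>
  have "bij_betw stereo {x \<in> S2. f x = x} {w. conj_stereo f w = w}"
    unfolding bij_betw_def
  proof (intro conjI equalityI subsetI)
    show "inj_on stereo {x \<in> S2. f x = x}" by (rule inj_on_subset[OF stereo_inj]) auto
  next
    fix w assume "w \<in> stereo ` {x \<in> S2. f x = x}"
    then obtain x where "x \<in> S2" "f x = x" "w = stereo x" by blast
    then show "w \<in> {w. conj_stereo f w = w}" using conj_stereo_stereo[of x f] by simp
  next
    fix w assume w: "w \<in> {w. conj_stereo f w = w}"
    let ?x = "inv_into S2 stereo w"
    have "f ?x = ?x" using w conj_stereo_fixed[OF f(1) inv_stereo(1), of w] by (simp add: inv_stereo(2))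
    then have "?x \<in> {x \<in> S2. f x = x}" using inv_stereo(1) by blast
    then show "w \<in> stereo ` {x \<in> S2. f x = x}"
      by (rule rev_image_eqI) (rule inv_stereo(2)[symmetric])
  qed
  from bij_betw_same_card[OF this] 2 show ?thesis by simp
qed

text \<open>
  The commutator belongs to the finite group, so it has finite order and
  \<open>moebius_common_fixed_point_commute\<close> applies.
\<close>

lemma moebius_S2_point_stabilizer_commute:
  assumes H: "subgroup H (BijGroup S2)" "finite H" "H \<subseteq> moebius_S2"
    and "f \<in> H" "g \<in> H" "x \<in> S2" "f x = x" "g x = x"
  shows "f \<otimes>\<^bsub>BijGroup S2\<^esub> g = g \<otimes>\<^bsub>BijGroup S2\<^esub> f"
proof -
  interpret B: group "BijGroup S2" by (rule group_BijGroup)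
  let ?i = "\<lambda>h. inv\<^bsub>BijGroup S2\<^esub> h"
  let ?m = "\<lambda>h k. h \<otimes>\<^bsub>BijGroup S2\<^esub> k"
  have sub: "H \<subseteq> Bij S2" using subgroup.subset[OF H(1)] by (simp add: carrier_BijGroup)
  note cl = subgroup.m_closed[OF H(1)] subgroup.m_inv_closed[OF H(1)]
  have fi: "?i f \<in> H" and gi: "?i g \<in> H" using assms(4,5) cl(2) by auto
  have c: "?m (?m (?m f g) (?i f)) (?i g) \<in> H"
    by (intro cl(1) assms(4,5) fi gi)
  obtain n where n: "n > 0" "conj_stereo (?m (?m (?m f g) (?i f)) (?i g)) ^^ n = id"
    by (rule finite_moebius_group_order[OF H(1,2) c])
  have Bs: "f \<in> Bij S2" "g \<in> Bij S2" "?i f \<in> Bij S2" "?i g \<in> Bij S2" "?m f g \<in> Bij S2"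
    "?m g f \<in> Bij S2" "?m (?m f g) (?i f) \<in> Bij S2"
    by (intro subsetD[OF sub] cl(1) assms(4,5) fi gi)+
  have "(conj_stereo f \<circ> conj_stereo g \<circ> conj_stereo (?i f) \<circ> conj_stereo (?i g)) ^^ n = id"
    using n(2) by (simp only: conj_stereo_compose Bs)
  moreover have "conj_stereo f \<in> moebius_maps" "conj_stereo g \<in> moebius_maps"
    using subsetD[OF assms(3,4)] subsetD[OF assms(3,5)] by (simp_all add: moebius_S2_iff)
  moreover have "conj_stereo f (stereo x) = stereo x" "conj_stereo g (stereo x) = stereo x"
    by (simp_all only: conj_stereo_stereo assms(6-8))
  ultimately have "conj_stereo f \<circ> conj_stereo g = conj_stereo g \<circ> conj_stereo f"
    by (intro moebius_common_fixed_point_commute[OF _ _ _ _ conj_stereo_inverse[OF Bs(1)]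
          conj_stereo_inverse[OF Bs(2)] _ n(1)])
  then have "conj_stereo (?m f g) = conj_stereo (?m g f)"
    by (simp only: conj_stereo_compose Bs)
  then show ?thesis by (rule conj_stereo_inj[OF Bs(5,6)])
qed

text \<open>
  A permutation of at most two points has a trivial square. In the proof, a point moved by the
  square would have three different images.
\<close>

lemma small_orbit_imp_square_fixes:
  assumes "group_action G E \<phi>" "finite (carrier G)" "x \<in> E" "card (orbit G \<phi> x) \<le> 2" "g \<in> carrier G"
  shows "\<phi> (g \<otimes>\<^bsub>G\<^esub> g) x = x"
proof (rule ccontr)
  interpret group_action G E \<phi> by (rule assms(1))
  let ?y = "\<phi> g x" and ?z = "\<phi> g (\<phi> g x)"
  have y: "?y \<in> E" using element_image[OF assms(5,3)] by blast
  assume "\<phi> (g \<otimes>\<^bsub>G\<^esub> g) x \<noteq> x"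
  then have "?z \<noteq> x" using composition_rule[OF assms(3,5,5)] by simp
  then have "?y \<noteq> x" by auto
  then have "?z \<noteq> ?y"
    using inj_prop[OF assms(5)] y assms(3) by (auto dest: inj_onD)
  have "group G" using group_hom group_hom.axioms(1) by blast
  then have "g \<otimes>\<^bsub>G\<^esub> g \<in> carrier G" using assms(5) by (simp add: group.is_monoid monoid.m_closed)
  then have "?z \<in> orbit G \<phi> x" using composition_rule[OF assms(3,5,5)] unfolding orbit_def by (intro CollectI exI[of _ "g \<otimes>\<^bsub>G\<^esub> g"]) simp
  moreover have "?y \<in> orbit G \<phi> x" using assms(5) unfolding orbit_def by blast
  ultimately have "{x, ?y, ?z} \<subseteq> orbit G \<phi> x" using orbit_refl[OF assms(3)] by simp
  moreover have "finite (orbit G \<phi> x)" unfolding orbit_def using assms(2) by (simp add: setcompr_eq_image)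
  ultimately have "card {x, ?y, ?z} \<le> 2" using assms(4) card_mono[of "orbit G \<phi> x" "{x, ?y, ?z}"] by linarith
  with \<open>?z \<noteq> x\<close> \<open>?y \<noteq> x\<close> \<open>?z \<noteq> ?y\<close> show False by simp
qed

text \<open>
  In an orbit of at most two points, each point is fixed by all squares. Elements of a finite
  Moebius group with a common fixed point commute, so such an orbit cannot exist if two squares do
  not commute.
\<close>

theorem finite_moebius_group_action:
  assumes H: "subgroup H (BijGroup S2)" "finite H" "H \<subseteq> moebius_S2"
    and ab: "a \<in> H" "b \<in> H"
    and noncomm: "(a \<otimes>\<^bsub>BijGroup S2\<^esub> a) \<otimes>\<^bsub>BijGroup S2\<^esub> (b \<otimes>\<^bsub>BijGroup S2\<^esub> b)
      \<noteq> (b \<otimes>\<^bsub>BijGroup S2\<^esub> b) \<otimes>\<^bsub>BijGroup S2\<^esub> (a \<otimes>\<^bsub>BijGroup S2\<^esub> a)"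
  shows "two_fixed_points_action (sphere_group H) S2 (\<lambda>f. f)"
proof -
  interpret group_action "sphere_group H" S2 "\<lambda>f. f" by (rule sphere_group_action[OF H(1)])
  show ?thesis
  proof
    show "finite (carrier (sphere_group H))" using H(2) by simp
    show "card (invariants S2 (\<lambda>f. f) g) = 2" if "g \<in> carrier (sphere_group H)" "g \<noteq> \<one>\<^bsub>sphere_group H\<^esub>" for g
      using moebius_S2_two_fixed_points[OF H] that by (simp add: invariants_def)
    show "3 \<le> card (orbit (sphere_group H) (\<lambda>f. f) x)" if x: "x \<in> S2" for x
    proof (rule ccontr)
      assume "\<not> 3 \<le> card (orbit (sphere_group H) (\<lambda>f. f) x)"
      then have small: "card (orbit (sphere_group H) (\<lambda>f. f) x) \<le> 2" by simp
      have "(h \<otimes>\<^bsub>BijGroup S2\<^esub> h) x = x" if "h \<in> H" for h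
        using small_orbit_imp_square_fixes[OF group_action_axioms _ x small, of h] H(2) that by simp
      then show False
        using moebius_S2_point_stabilizer_commute[OF H subgroup.m_closed[OF H(1) ab(1,1)]
            subgroup.m_closed[OF H(1) ab(2,2)] x] noncomm ab by simp
    qed
    show "S2 \<noteq> ({} :: (real^3) set)" by simp
  qed
qed

section \<open>Setwise stabilizers\<close>

lemma infinite_S2: "infinite (S2 :: (real^3) set)"
proof
  assume "finite (S2 :: (real^3) set)"
  then have "finite (stereo ` S2)" by (rule finite_imageI)
  moreover have "infinite (range (Some :: complex \<Rightarrow> complex option))"
    by (simp add: finite_image_iff infinite_UNIV_char_0)
  ultimately show False using stereo_surj finite_subset by (metis subset_UNIV)
qed

definition moebius_fixing :: "(real^3) set \<Rightarrow> (real^3 \<Rightarrow> real^3) set" where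
  "moebius_fixing \<alpha> = {f \<in> moebius_S2. f ` \<alpha> = \<alpha>}"

lemma moebius_stabilizer_eq: "moebius_stabilizer \<alpha> = sphere_group (moebius_fixing \<alpha>)"
  by (simp add: moebius_stabilizer_def moebius_fixing_def)

lemma compose_image: "\<alpha> \<subseteq> E \<Longrightarrow> compose E f g ` \<alpha> = f ` (g ` \<alpha>)"
  unfolding compose_def image_image by (intro image_cong refl) (simp add: subset_iff)

lemma moebius_fixing_subgroup:
  assumes "\<alpha> \<subseteq> S2" shows "subgroup (moebius_fixing \<alpha>) (BijGroup S2)"
proof -
  interpret B: group "BijGroup S2" by (rule group_BijGroup)
  note M = moebius_S2_subgroup
  have sub: "moebius_S2 \<subseteq> Bij S2" by (auto simp: moebius_S2_def)
  have one: "(\<lambda>x\<in>S2. x) ` \<alpha> = \<alpha>"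
    using image_cong[OF refl, of \<alpha> "\<lambda>x\<in>S2. x" "\<lambda>x. x"] assms by (simp add: subset_iff del: mem_sphere_0)
  show ?thesis
  proof (rule B.subgroupI)
    show "moebius_fixing \<alpha> \<subseteq> carrier (BijGroup S2)"
      using sub by (auto simp: moebius_fixing_def carrier_BijGroup)
    have "\<one>\<^bsub>BijGroup S2\<^esub> \<in> moebius_fixing \<alpha>"
      using subgroup.one_closed[OF M] one by (simp add: moebius_fixing_def BijGroup_def)
    then show "moebius_fixing \<alpha> \<noteq> {}" by blast
  next
    fix f g assume "f \<in> moebius_fixing \<alpha>" "g \<in> moebius_fixing \<alpha>"
    then have f: "f \<in> moebius_S2" "f ` \<alpha> = \<alpha>" and g: "g \<in> moebius_S2" "g ` \<alpha> = \<alpha>"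
      by (simp_all add: moebius_fixing_def)
    have "f \<otimes>\<^bsub>BijGroup S2\<^esub> g = compose S2 f g"
      by (intro BijGroup_mult subsetD[OF sub] f(1) g(1))
    then have "(f \<otimes>\<^bsub>BijGroup S2\<^esub> g) ` \<alpha> = \<alpha>" using compose_image[OF assms, of f g] f(2) g(2) by simp
    then show "f \<otimes>\<^bsub>BijGroup S2\<^esub> g \<in> moebius_fixing \<alpha>"
      using subgroup.m_closed[OF M f(1) g(1)] by (simp add: moebius_fixing_def)
  next
    fix f assume "f \<in> moebius_fixing \<alpha>"
    then have f: "f \<in> moebius_S2" "f ` \<alpha> = \<alpha>" by (simp_all add: moebius_fixing_def)
    let ?g = "inv\<^bsub>BijGroup S2\<^esub> f"
    have g: "?g \<in> moebius_S2" by (rule subgroup.m_inv_closed[OF M f(1)])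
    have "compose S2 ?g f = ?g \<otimes>\<^bsub>BijGroup S2\<^esub> f"
      by (intro BijGroup_mult[symmetric] subsetD[OF sub] f(1) g)
    also have "\<dots> = (\<lambda>x\<in>S2. x)"
      using B.l_inv[of f] subsetD[OF sub f(1)] by (simp add: carrier_BijGroup) (simp add: BijGroup_def)
    finally have "?g ` (f ` \<alpha>) = \<alpha>" using compose_image[OF assms, of ?g f] one by simp
    then show "?g \<in> moebius_fixing \<alpha>" using g f(2) by (simp add: moebius_fixing_def)
  qed
qed

text \<open>
  The quotient of the two maps fixes three points, so it is the identity.
\<close>

lemma moebius_S2_eqI:
  assumes "f \<in> moebius_S2" "g \<in> moebius_S2" "\<alpha> \<subseteq> S2" "card \<alpha> \<ge> 3" "\<And>x. x \<in> \<alpha> \<Longrightarrow> f x = g x"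
  shows "f = g"
proof -
  have f: "f \<in> Bij S2" "conj_stereo f \<in> moebius_maps" and g: "g \<in> Bij S2" "conj_stereo g \<in> moebius_maps"
    using assms(1,2) by (simp_all add: moebius_S2_iff)
  obtain g' where g': "g' \<in> moebius_maps" "conj_stereo g \<circ> g' = id" "g' \<circ> conj_stereo g = id"
    by (rule moebius_maps_inverse[OF g(2)])
  obtain T where "T \<subseteq> \<alpha>" "card T = 3" by (rule obtain_subset_with_card_n[OF assms(4)])
  then obtain x y z where xyz: "{x, y, z} \<subseteq> \<alpha>" "x \<noteq> y" "x \<noteq> z" "y \<noteq> z" by (auto simp: card_3_iff)
  have fixed: "(g' \<circ> conj_stereo f) (stereo w) = stereo w" if "w \<in> {x, y, z}" for w
  proof -
    have "w \<in> S2" "f w = g w" using that xyz assms(3,5) by auto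
    then have "conj_stereo f (stereo w) = conj_stereo g (stereo w)"
      using conj_stereo_stereo[of w f] conj_stereo_stereo[of w g] by simp
    then show ?thesis using g'(3) by (simp add: fun_eq_iff)
  qed
  have "g' \<circ> conj_stereo f = id"
  proof (rule moebius_three_fixed_points)
    show "g' \<circ> conj_stereo f \<in> moebius_maps" by (rule moebius_maps_comp[OF g'(1) f(2)])
    have S: "x \<in> S2" "y \<in> S2" "z \<in> S2" using xyz(1) assms(3) by auto
    show "stereo x \<noteq> stereo y" "stereo x \<noteq> stereo z" "stereo y \<noteq> stereo z"
      using xyz S by (simp_all only: stereo_eq_iff not_False_eq_True)
  qed (simp_all only: fixed insert_iff simp_thms)
  then have "conj_stereo g \<circ> (g' \<circ> conj_stereo f) = conj_stereo g" by simp
  then have "(conj_stereo g \<circ> g') \<circ> conj_stereo f = conj_stereo g" by (simp only: comp_assoc)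
  then have "conj_stereo f = conj_stereo g" using g'(2) by simp
  then show ?thesis by (rule conj_stereo_inj[OF f(1) g(1)])
qed

text \<open>
  An element of the stabilizer is determined by the permutation that it induces on the at least
  three points of \<open>\<alpha>\<close>.
\<close>

lemma finite_moebius_fixing:
  assumes "\<alpha> \<subseteq> S2" "finite \<alpha>" "card \<alpha> \<ge> 3" shows "finite (moebius_fixing \<alpha>)"
proof (rule finite_imageD)
  show "inj_on (\<lambda>f. restrict f \<alpha>) (moebius_fixing \<alpha>)"
  proof (rule inj_onI)
    fix f g assume "f \<in> moebius_fixing \<alpha>" "g \<in> moebius_fixing \<alpha>" and eq: "restrict f \<alpha> = restrict g \<alpha>"
    then have "f \<in> moebius_S2" "g \<in> moebius_S2" by (simp_all add: moebius_fixing_def)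
    then show "f = g"
      by (rule moebius_S2_eqI[OF _ _ assms(1,3)]) (metis eq restrict_apply')
  qed
  have "(\<lambda>f. restrict f \<alpha>) ` moebius_fixing \<alpha> \<subseteq> (\<Pi>\<^sub>E x\<in>\<alpha>. \<alpha>)"
    by (auto simp: moebius_fixing_def)
  then show "finite ((\<lambda>f. restrict f \<alpha>) ` moebius_fixing \<alpha>)"
    using finite_PiE[OF assms(2), of "\<lambda>_. \<alpha>"] assms(2) finite_subset by blast
qed

text \<open>
  A property of the abstract group that rules out orbits with one or two points for any finite
  Moebius group with this structure. It holds for \<open>S\<^sub>4\<close> and \<open>A\<^sub>5\<close> and fails for cyclic and dihedral
  groups, whose squares all lie in one cyclic subgroup.
\<close>

definition noncommuting_squares :: "('a, 'b) monoid_scheme \<Rightarrow> bool" where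
  "noncommuting_squares G \<longleftrightarrow> (\<exists>a\<in>carrier G. \<exists>b\<in>carrier G.
     (a \<otimes>\<^bsub>G\<^esub> a) \<otimes>\<^bsub>G\<^esub> (b \<otimes>\<^bsub>G\<^esub> b) \<noteq> (b \<otimes>\<^bsub>G\<^esub> b) \<otimes>\<^bsub>G\<^esub> (a \<otimes>\<^bsub>G\<^esub> a))"

lemma noncommuting_squares_iso:
  assumes "group G" "G \<cong> K" "noncommuting_squares K" shows "noncommuting_squares G"
proof -
  obtain h where h: "h \<in> hom G K" "bij_betw h (carrier G) (carrier K)"
    using assms(2) by (auto simp: is_iso_def iso_def)
  interpret group G by (rule assms(1))
  obtain a b where ab: "a \<in> carrier G" "b \<in> carrier G"
    "(h a \<otimes>\<^bsub>K\<^esub> h a) \<otimes>\<^bsub>K\<^esub> (h b \<otimes>\<^bsub>K\<^esub> h b) \<noteq> (h b \<otimes>\<^bsub>K\<^esub> h b) \<otimes>\<^bsub>K\<^esub> (h a \<otimes>\<^bsub>K\<^esub> h a)"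
  proof -
    obtain c d where cd: "c \<in> carrier K" "d \<in> carrier K"
      "(c \<otimes>\<^bsub>K\<^esub> c) \<otimes>\<^bsub>K\<^esub> (d \<otimes>\<^bsub>K\<^esub> d) \<noteq> (d \<otimes>\<^bsub>K\<^esub> d) \<otimes>\<^bsub>K\<^esub> (c \<otimes>\<^bsub>K\<^esub> c)"
      using assms(3) unfolding noncommuting_squares_def by blast
    obtain a b where "a \<in> carrier G" "b \<in> carrier G" "c = h a" "d = h b"
    proof -
      have "c \<in> h ` carrier G" "d \<in> h ` carrier G" using cd(1,2) h(2) by (simp_all add: bij_betw_def)
      then show thesis using that by blast
    qed
    with cd(3) that show thesis by blast
  qed
  have "h ((a \<otimes>\<^bsub>G\<^esub> a) \<otimes>\<^bsub>G\<^esub> (b \<otimes>\<^bsub>G\<^esub> b)) \<noteq> h ((b \<otimes>\<^bsub>G\<^esub> b) \<otimes>\<^bsub>G\<^esub> (a \<otimes>\<^bsub>G\<^esub> a))"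
    using ab by (simp add: hom_mult[OF h(1)])
  then show ?thesis using ab(1,2) unfolding noncommuting_squares_def by metis
qed

text \<open>
  The square of a 3-cycle is its inverse, so any two noncommuting 3-cycles will do; they are even
  permutations.
\<close>

lemma noncommuting_three_cycles:
  fixes n :: nat assumes "n \<ge> 4"
  obtains p q where "p permutes {1..n}" "evenperm p" "q permutes {1..n}" "evenperm q"
    "(p \<circ> p) \<circ> (q \<circ> q) \<noteq> (q \<circ> q) \<circ> (p \<circ> p)"
proof -
  define p :: "nat \<Rightarrow> nat" where "p = Transposition.transpose 1 2 \<circ> Transposition.transpose 2 3"
  define q :: "nat \<Rightarrow> nat" where "q = Transposition.transpose 1 2 \<circ> Transposition.transpose 2 4"
  have "((p \<circ> p) \<circ> (q \<circ> q)) 1 \<noteq> ((q \<circ> q) \<circ> (p \<circ> p)) 1"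
    by (simp add: p_def q_def transpose_def)
  then have "(p \<circ> p) \<circ> (q \<circ> q) \<noteq> (q \<circ> q) \<circ> (p \<circ> p)" by metis
  moreover have "p permutes {1..n}" "q permutes {1..n}"
    unfolding p_def q_def using assms by (auto intro!: permutes_compose permutes_swap_id)
  moreover have "evenperm p" "evenperm q"
    unfolding p_def q_def by (simp_all add: evenperm_comp permutation_swap_id evenperm_swap)
  ultimately show thesis by (intro that)
qed

lemma noncommuting_squares_sym_group: "noncommuting_squares (sym_group 4)"
proof (rule noncommuting_three_cycles[of 4])
  fix p q :: "nat \<Rightarrow> nat"
  assume "p permutes {1..4}" "q permutes {1..4}" "(p \<circ> p) \<circ> (q \<circ> q) \<noteq> (q \<circ> q) \<circ> (p \<circ> p)"
  then show ?thesis
    unfolding noncommuting_squares_def sym_group_mult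
    by (intro bexI[of _ p] bexI[of _ q]) (simp_all only: sym_group_carrier not_False_eq_True)
qed simp

lemma noncommuting_squares_alt_group: "noncommuting_squares (alt_group 5)"
proof (rule noncommuting_three_cycles[of 5])
  fix p q :: "nat \<Rightarrow> nat"
  assume "p permutes {1..5}" "evenperm p" "q permutes {1..5}" "evenperm q"
    "(p \<circ> p) \<circ> (q \<circ> q) \<noteq> (q \<circ> q) \<circ> (p \<circ> p)"
  then show ?thesis
    unfolding noncommuting_squares_def alt_group_mult
    by (intro bexI[of _ p] bexI[of _ q]) (simp_all only: alt_group_carrier simp_thms)
qed simp

lemma order_sym_group_4: "order (sym_group 4) = 24"
  unfolding order_def sym_group_card_carrier by (simp add: fact_numeral)

lemma order_alt_group_5: "order (alt_group 5) = 60"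
  using alt_group_card_carrier[of 5] by (simp add: order_def fact_numeral)

section \<open>Rotations are Moebius transformations\<close>

text \<open>
  The rotation by half a turn about the axis through the unit vector \<open>u\<close>. Every rotation is the
  product of a half-turn and a rotation about the vertical axis (see \<open>rotation_moebius\<close>), and for
  these two kinds the Moebius matrix is explicit.
\<close>

definition half_turn :: "real^3 \<Rightarrow> real^3 \<Rightarrow> real^3" where
  "half_turn u x = (2 * (u \<bullet> x)) *\<^sub>R u - x"

lemma inner3: "(x :: real^3) \<bullet> y = x $ 1 * y $ 1 + x $ 2 * y $ 2 + x $ 3 * y $ 3"
  by (simp add: inner_vec_def sum_3)

lemma orthogonal_half_turn: "norm u = 1 \<Longrightarrow> orthogonal_transformation (half_turn u)"
proof -
  assume "norm u = 1"
  then have u: "u \<bullet> u = 1" by (simp add: norm_eq_sqrt_inner)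
  have "linear (half_turn u)"
    unfolding half_turn_def by (rule linearI) (simp_all add: inner_add_right algebra_simps)
  moreover have "half_turn u v \<bullet> half_turn u w = v \<bullet> w" for v w
    using u by (simp add: half_turn_def inner_diff_left inner_diff_right inner_commute algebra_simps)
  ultimately show ?thesis by (simp add: orthogonal_transformation_def)
qed

lemma det_half_turn: "norm u = 1 \<Longrightarrow> det (matrix (half_turn u)) = 1"
proof -
  assume "norm u = 1"
  then have u: "(u $ 1)\<^sup>2 + (u $ 2)\<^sup>2 + (u $ 3)\<^sup>2 = 1" using sphere3[of u] by simp
  have [simp]: "axis 1 (1::real) $ (2::3) = 0" "axis 1 (1::real) $ (3::3) = 0" "axis 2 (1::real) $ (1::3) = 0"
    "axis 2 (1::real) $ (3::3) = 0" "axis 3 (1::real) $ (1::3) = 0" "axis 3 (1::real) $ (2::3) = 0"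
    by (simp_all add: axis_def)
  have "det (matrix (half_turn u)) = 2 * ((u $ 1)\<^sup>2 + (u $ 2)\<^sup>2 + (u $ 3)\<^sup>2) - 1"
    by (simp add: det_3 matrix_def half_turn_def inner_axis) (simp add: power2_eq_square algebra_simps)
  with u show ?thesis by simp
qed

lemma half_turn_half_turn: "norm u = 1 \<Longrightarrow> half_turn u (half_turn u x) = x"
proof -
  assume "norm u = 1"
  then have "u \<bullet> u = 1" by (simp add: norm_eq_sqrt_inner)
  then show ?thesis by (simp add: half_turn_def inner_diff_right algebra_simps)
qed

lemma orthogonal_S2: "orthogonal_transformation f \<Longrightarrow> f ` S2 = S2"
proof -
  assume f: "orthogonal_transformation f"
  have "y \<in> f ` S2" if "y \<in> S2" for y
  proof -
    obtain x where "y = f x" using orthogonal_transformation_surj[OF f] by (auto elim: surjE)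
    with that show ?thesis using orthogonal_transformation_norm[OF f] by simp
  qed
  then show ?thesis using orthogonal_transformation_norm[OF f] by (auto simp del: mem_sphere_0 simp: sphere_def)
qed

lemma restrict_orthogonal_Bij:
  assumes "orthogonal_transformation f" shows "restrict f S2 \<in> Bij S2"
proof -
  have "inj_on f S2" using orthogonal_transformation_inj[OF assms] by (rule inj_on_subset) simp
  then have "bij_betw f S2 S2" using orthogonal_S2[OF assms] by (simp add: bij_betw_def)
  moreover have "bij_betw (restrict f S2) S2 S2 \<longleftrightarrow> bij_betw f S2 S2" by (rule bij_betw_cong) simp
  ultimately show ?thesis by (simp add: Bij_def)
qed

text \<open>
  The pair \<open>[p : q]\<close> consists of homogeneous coordinates of the stereographic projection of \<open>x\<close>.
  Away from the north pole the first equation says \<open>p / q = (x\<^sub>1 + i * x\<^sub>2) / (1 - x\<^sub>3)\<close>. At the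
  north pole it becomes trivial, and the second equation reads \<open>2 * q = 0\<close>. With this description
  the point at infinity needs no separate treatment.
\<close>

definition homogeneous :: "real^3 \<Rightarrow> complex \<Rightarrow> complex \<Rightarrow> bool" where
  "homogeneous x p q \<longleftrightarrow> (p, q) \<noteq> (0, 0) \<and>
     Complex (x $ 1) (x $ 2) * q = (1 - of_real (x $ 3)) * p \<and>
     Complex (x $ 1) (- (x $ 2)) * p = (1 + of_real (x $ 3)) * q"

lemma homogeneous_stereo:
  assumes "homogeneous x p q" shows "stereo x = (if q = 0 then None else Some (p / q))"
proof (cases "x $ 3 = 1")
  case True
  then have "Complex (x $ 1) (x $ 2) * q = 0" "Complex (x $ 1) (- (x $ 2)) * p = 2 * q"
    using assms by (simp_all add: homogeneous_def)
  then have "q = 0"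
  proof (cases "Complex (x $ 1) (x $ 2) = 0")
    case True
    then have "Complex (x $ 1) (- (x $ 2)) = 0" by (simp add: complex_eq_iff)
    with \<open>Complex (x $ 1) (- (x $ 2)) * p = 2 * q\<close> show ?thesis by simp
  qed simp
  with True show ?thesis by (simp add: stereo_def)
next
  case False
  let ?w = "Complex (x $ 1) (x $ 2)" and ?t = "1 - complex_of_real (x $ 3)"
  have t: "?t \<noteq> 0" using False by (simp add: complex_eq_iff)
  have e: "?w * q = ?t * p" using assms by (simp add: homogeneous_def)
  then have "q \<noteq> 0" using t assms by (auto simp: homogeneous_def)
  have "Complex (x $ 1 / (1 - x $ 3)) (x $ 2 / (1 - x $ 3)) = ?w / ?t"
  proof -
    have "Complex (x $ 1 / r) (x $ 2 / r) = ?w / of_real r" for r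
      by (simp add: complex_eq_iff)
    from this[of "1 - x $ 3"] show ?thesis by simp
  qed
  also have "\<dots> = p / q" using e t \<open>q \<noteq> 0\<close> by (simp add: frac_eq_eq mult.commute)
  finally show ?thesis using False \<open>q \<noteq> 0\<close> by (simp add: stereo_def)
qed

lemma homogeneous_exists:
  assumes "x \<in> S2" obtains p q where "homogeneous x p q"
proof -
  have s: "(x $ 1)\<^sup>2 + (x $ 2)\<^sup>2 = (1 - x $ 3) * (1 + x $ 3)"
    using assms unfolding sphere3 by (simp add: algebra_simps power2_eq_square)
  let ?w = "Complex (x $ 1) (x $ 2)"
  have m: "Complex (x $ 1) (- (x $ 2)) * ?w = (1 - of_real (x $ 3)) * (1 + of_real (x $ 3))"
    using s by (simp add: complex_eq_iff power2_eq_square algebra_simps)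
  show thesis
  proof (cases "x $ 3 = 1")
    case True
    have "homogeneous x (1 + of_real (x $ 3)) (Complex (x $ 1) (- (x $ 2)))"
      using m True by (simp add: homogeneous_def mult.commute)
    then show thesis by (rule that)
  next
    case False
    have "homogeneous x ?w (1 - of_real (x $ 3))"
      using m False by (simp add: homogeneous_def mult.commute complex_eq_iff)
    then show thesis by (rule that)
  qed
qed

lemma moebius_homogeneous:
  assumes "homogeneous x p q"
  shows "moebius a b c d (stereo x)
    = (if c * p + d * q = 0 then None else Some ((a * p + b * q) / (c * p + d * q)))"
proof (cases "q = 0")
  case True
  then have "p \<noteq> 0" using assms by (simp add: homogeneous_def)
  with True show ?thesis by (simp add: homogeneous_stereo[OF assms])
next
  case False
  have "c * (p / q) + d = (c * p + d * q) / q" "a * (p / q) + b = (a * p + b * q) / q"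
    using False by (simp_all add: field_simps)
  with False show ?thesis by (simp add: homogeneous_stereo[OF assms])
qed

text \<open>
  A Moebius transformation acts linearly on homogeneous coordinates, so a map of the sphere is a
  Moebius transformation if it satisfies two polynomial identities.
\<close>

lemma moebius_S2_homogeneousI:
  assumes f: "orthogonal_transformation f" and det: "a * d - b * c \<noteq> 0"
    and h: "\<And>x p q. x \<in> S2 \<Longrightarrow> homogeneous x p q \<Longrightarrow>
      Complex (f x $ 1) (f x $ 2) * (c * p + d * q) = (1 - of_real (f x $ 3)) * (a * p + b * q) \<and>
      Complex (f x $ 1) (- (f x $ 2)) * (a * p + b * q) = (1 + of_real (f x $ 3)) * (c * p + d * q)"
  shows "restrict f S2 \<in> moebius_S2"
  unfolding moebius_S2_def
proof (intro CollectI conjI exI ballI)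
  show "restrict f S2 \<in> Bij S2" by (rule restrict_orthogonal_Bij[OF f])
  show "a * d - b * c \<noteq> 0" by (rule det)
  fix x assume x: "x \<in> S2"
  obtain p q where pq: "homogeneous x p q" by (rule homogeneous_exists[OF x])
  have "(a * p + b * q, c * p + d * q) \<noteq> (0, 0)"
  proof
    assume "(a * p + b * q, c * p + d * q) = (0, 0)"
    then have 0: "a * p + b * q = 0" "c * p + d * q = 0" by simp_all
    have "(a * d - b * c) * p = d * (a * p + b * q) - b * (c * p + d * q)"
      "(a * d - b * c) * q = a * (c * p + d * q) - c * (a * p + b * q)"
      by (simp_all add: algebra_simps)
    then have "p = 0" "q = 0" using 0 det by auto
    with pq show False by (simp add: homogeneous_def)
  qed
  then have "homogeneous (f x) (a * p + b * q) (c * p + d * q)"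
    using h[OF x pq] by (simp add: homogeneous_def)
  from homogeneous_stereo[OF this]
  have "stereo (f x) = moebius a b c d (stereo x)" by (simp only: moebius_homogeneous[OF pq])
  with x show "stereo (restrict f S2 x) = moebius a b c d (stereo x)" by (simp only: restrict_apply')
qed

text \<open>
  The algebraic core of \<open>half_turn_moebius\<close>: \<open>\<omega> = u\<^sub>1 + i * u\<^sub>2\<close> and \<open>\<omega>'\<close> is its conjugate, \<open>\<tau> =
  u\<^sub>3\<close>; likewise \<open>w\<close>, \<open>w'\<close> and \<open>t\<close> for \<open>x\<close>; and \<open>d\<close> is twice the inner product of \<open>u\<close> and \<open>x\<close>. In
  both equations the difference of the two sides is a linear combination of the assumptions, with
  the coefficients shown in the proof.
\<close>

lemma half_turn_identity:
  fixes \<omega> \<omega>' \<tau> w w' t p q :: complex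
  assumes "\<omega> * \<omega>' + \<tau> * \<tau> = 1" "w * q = (1 - t) * p" "w' * p = (1 + t) * q"
    and d: "d = \<omega> * w' + \<omega>' * w + 2 * \<tau> * t"
  shows "(d * \<omega> - w) * (\<omega>' * p + - \<tau> * q) = (1 - (d * \<tau> - t)) * (\<tau> * p + \<omega> * q)"
    and "(d * \<omega>' - w') * (\<tau> * p + \<omega> * q) = (1 + (d * \<tau> - t)) * (\<omega>' * p + - \<tau> * q)"
proof -
  have 0: "\<omega> * \<omega>' + \<tau> * \<tau> - 1 = 0" "w * q - (1 - t) * p = 0" "w' * p - (1 + t) * q = 0"
    using assms by simp_all
  have "(d * \<omega> - w) * (\<omega>' * p + - \<tau> * q) - (1 - (d * \<tau> - t)) * (\<tau> * p + \<omega> * q)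
    = d * (\<omega> * \<omega>' + \<tau> * \<tau> - 1) * p + \<omega> * (w' * p - (1 + t) * q) + \<tau> * (w * q - (1 - t) * p)"
    unfolding d by (simp add: algebra_simps)
  then show "(d * \<omega> - w) * (\<omega>' * p + - \<tau> * q) = (1 - (d * \<tau> - t)) * (\<tau> * p + \<omega> * q)"
    by (simp only: 0) simp
  have "(d * \<omega>' - w') * (\<tau> * p + \<omega> * q) - (1 + (d * \<tau> - t)) * (\<omega>' * p + - \<tau> * q)
    = d * (\<omega> * \<omega>' + \<tau> * \<tau> - 1) * q + \<omega>' * (w * q - (1 - t) * p) - \<tau> * (w' * p - (1 + t) * q)"
    unfolding d by (simp add: algebra_simps)
  then show "(d * \<omega>' - w') * (\<tau> * p + \<omega> * q) = (1 + (d * \<tau> - t)) * (\<omega>' * p + - \<tau> * q)"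
    by (simp only: 0) simp
qed

text \<open>
  The half-turn about \<open>u\<close> has the matrix with rows \<open>(u\<^sub>3, u\<^sub>1 + i * u\<^sub>2)\<close> and \<open>(u\<^sub>1 - i * u\<^sub>2, -
  u\<^sub>3)\<close>, which is a traceless matrix of determinant \<open>-1\<close>.
\<close>

lemma half_turn_moebius:
  assumes "norm u = 1" shows "restrict (half_turn u) S2 \<in> moebius_S2"
proof (rule moebius_S2_homogeneousI)
  let ?a = "complex_of_real (u $ 3)" and ?b = "Complex (u $ 1) (u $ 2)" and ?c = "Complex (u $ 1) (- (u $ 2))"
  have u: "(u $ 1)\<^sup>2 + (u $ 2)\<^sup>2 + (u $ 3)\<^sup>2 = 1" using assms sphere3[of u] by simp
  have "?a * - ?a - ?b * ?c = - of_real ((u $ 1)\<^sup>2 + (u $ 2)\<^sup>2 + (u $ 3)\<^sup>2)"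
    by (simp add: complex_eq_iff power2_eq_square)
  then show "?a * - ?a - ?b * ?c \<noteq> 0" using u by simp
  fix x :: "real^3" and p q assume x: "x \<in> S2" and pq: "homogeneous x p q"
  have s: "(x $ 1)\<^sup>2 + (x $ 2)\<^sup>2 + (x $ 3)\<^sup>2 = 1" using x sphere3 by blast
  show "Complex (half_turn u x $ 1) (half_turn u x $ 2) * (?c * p + - ?a * q)
      = (1 - of_real (half_turn u x $ 3)) * (?a * p + ?b * q) \<and>
    Complex (half_turn u x $ 1) (- (half_turn u x $ 2)) * (?a * p + ?b * q)
      = (1 + of_real (half_turn u x $ 3)) * (?c * p + - ?a * q)"
  proof -
    let ?w = "Complex (x $ 1) (x $ 2)" and ?w' = "Complex (x $ 1) (- (x $ 2))" and ?t = "complex_of_real (x $ 3)"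
    let ?d = "complex_of_real (2 * (u \<bullet> x))"
    have "?b * ?c + ?a * ?a = 1" using u by (simp add: complex_eq_iff power2_eq_square)
    moreover have "?w * q = (1 - ?t) * p" "?w' * p = (1 + ?t) * q" using pq by (simp_all add: homogeneous_def)
    moreover have "?d = ?b * ?w' + ?c * ?w + 2 * ?a * ?t" by (simp add: complex_eq_iff inner3 algebra_simps)
    moreover have "Complex (half_turn u x $ 1) (half_turn u x $ 2) = ?d * ?b - ?w"
      "Complex (half_turn u x $ 1) (- (half_turn u x $ 2)) = ?d * ?c - ?w'"
      "complex_of_real (half_turn u x $ 3) = ?d * ?a - ?t"
      by (simp_all add: half_turn_def complex_eq_iff)
    ultimately show ?thesis using half_turn_identity[of ?b ?c ?a ?w q ?t p ?w' ?d] by (simp only: simp_thms)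
  qed
qed (rule orthogonal_half_turn[OF assms])

text \<open>
  In the plane this is multiplication by the unit complex number \<open>a + i * b\<close>.
\<close>

lemma z_rotation_moebius:
  assumes f: "orthogonal_transformation f" and ab: "a\<^sup>2 + b\<^sup>2 = 1"
    and fx: "\<And>x. f x = vector [a * x $ 1 - b * x $ 2, b * x $ 1 + a * x $ 2, x $ 3]"
  shows "restrict f S2 \<in> moebius_S2"
proof (rule moebius_S2_homogeneousI[OF f])
  show "Complex a b * 1 - 0 * 0 \<noteq> 0" using ab by (auto simp: complex_eq_iff)
  fix x :: "real^3" and p q assume x: "x \<in> S2" and pq: "homogeneous x p q"
  let ?m = "Complex a b" and ?m' = "Complex a (- b)" and ?w = "Complex (x $ 1) (x $ 2)" and ?w' = "Complex (x $ 1) (- (x $ 2))"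
  have e: "?w * q = (1 - of_real (x $ 3)) * p" "?w' * p = (1 + of_real (x $ 3)) * q"
    using pq by (simp_all add: homogeneous_def)
  have m: "?m' * ?m = 1" using ab by (simp add: complex_eq_iff power2_eq_square)
  have c: "Complex (f x $ 1) (f x $ 2) = ?m * ?w" "Complex (f x $ 1) (- (f x $ 2)) = ?m' * ?w'" "f x $ 3 = x $ 3"
    by (simp_all add: fx complex_eq_iff)
  have "?m * ?w * q = (1 - of_real (x $ 3)) * (?m * p)" using e(1) by (simp only: mult.assoc) (simp add: algebra_simps)
  moreover have "?m' * ?w' * (?m * p) = (?m' * ?m) * (?w' * p)" by (simp only: ac_simps)
  then have "?m' * ?w' * (?m * p) = (1 + of_real (x $ 3)) * q" by (simp only: m e(2) mult_1)
  ultimately show "Complex (f x $ 1) (f x $ 2) * (0 * p + 1 * q) = (1 - of_real (f x $ 3)) * (?m * p + 0 * q) \<and>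
    Complex (f x $ 1) (- (f x $ 2)) * (?m * p + 0 * q) = (1 + of_real (f x $ 3)) * (0 * p + 1 * q)"
    unfolding c by simp
qed

definition rotation :: "(real^3 \<Rightarrow> real^3) \<Rightarrow> bool" where
  "rotation f \<longleftrightarrow> orthogonal_transformation f \<and> det (matrix f) = 1"

lemma rotations_iff: "f \<in> rotations P \<longleftrightarrow> rotation f \<and> f ` P = P"
  by (simp add: rotations_def rotation_def)

lemma det_matrix_comp:
  fixes f g :: "real^'n \<Rightarrow> real^'n"
  shows "linear f \<Longrightarrow> linear g \<Longrightarrow> det (matrix (f \<circ> g)) = det (matrix f) * det (matrix g)"
  by (simp add: matrix_compose det_mul)

lemma orthogonal_transformation_comp:
  "orthogonal_transformation f \<Longrightarrow> orthogonal_transformation g \<Longrightarrow> orthogonal_transformation (f \<circ> g)"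
  by (rule orthogonal_transformation_compose)

lemma rotation_comp: "rotation f \<Longrightarrow> rotation g \<Longrightarrow> rotation (f \<circ> g)"
  unfolding rotation_def
  by (simp add: orthogonal_transformation_comp det_matrix_comp orthogonal_transformation_linear)

lemma orthogonal_inv_comp:
  assumes "orthogonal_transformation (f :: real^'n \<Rightarrow> real^'n)"
  shows "Hilbert_Choice.inv f \<circ> f = id" "f \<circ> Hilbert_Choice.inv f = id"
  using inv_o_cancel[OF orthogonal_transformation_inj[OF assms]]
    orthogonal_transformation_surj[OF assms] by (auto simp: surj_iff)

lemma det_inv_orthogonal:
  assumes f: "orthogonal_transformation (f :: real^'n \<Rightarrow> real^'n)"
  shows "det (matrix (Hilbert_Choice.inv f)) * det (matrix f) = 1"
  using det_matrix_comp[of "Hilbert_Choice.inv f" f] orthogonal_inv_comp(1)[OF f] matrix_id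
    orthogonal_transformation_linear[OF f] orthogonal_transformation_linear[OF orthogonal_transformation_inv[OF f]]
  by simp

lemma rotation_inv: "rotation f \<Longrightarrow> rotation (Hilbert_Choice.inv f)"
  unfolding rotation_def using det_inv_orthogonal[of f] orthogonal_transformation_inv[of f] by simp

lemma rotation_half_turn: "norm u = 1 \<Longrightarrow> rotation (half_turn u)"
  by (simp add: rotation_def orthogonal_half_turn det_half_turn)

text \<open>
  The axis bisects the angle between the north pole and \<open>p\<close>. For the south pole it may be any
  horizontal vector.
\<close>

lemma half_turn_of_north_pole:
  assumes "p \<in> S2" obtains u where "norm u = 1" "half_turn u (axis 3 1) = p"
proof (cases "p = - axis 3 1")
  case True
  have "half_turn (axis 1 1) (axis 3 1) = p"
    unfolding True by (rule vec3_eqI) (simp_all add: half_turn_def inner3 axis_def)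
  then show thesis by (intro that[of "axis 1 1"]) simp_all
next
  case False
  let ?e = "axis 3 1 :: real^3"
  define n where "n = norm (p + ?e)"
  have "p + ?e \<noteq> 0" using False by (metis add_eq_0_iff2)
  then have n: "n > 0" by (simp add: n_def)
  have "p \<bullet> p = 1" "?e \<bullet> ?e = 1" using assms by (simp_all add: norm_eq_sqrt_inner inner_axis)
  then have n2: "n * n = 2 * (p \<bullet> ?e) + 2"
    unfolding n_def by (simp add: power2_norm_eq_inner inner_add_left inner_add_right inner_commute flip: power2_eq_square)
  define u where "u = (p + ?e) /\<^sub>R n"
  have "norm u = 1" using n by (simp add: u_def n_def)
  moreover have "half_turn u ?e = p"
  proof -
    have "(2 * (u \<bullet> ?e)) *\<^sub>R u = ((2 * (p \<bullet> ?e) + 2) / (n * n)) *\<^sub>R (p + ?e)"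
      using \<open>?e \<bullet> ?e = 1\<close> n by (simp add: u_def inner_add_left field_simps)
    also have "\<dots> = p + ?e" unfolding n2[symmetric] using n by simp
    finally show ?thesis by (simp add: half_turn_def)
  qed
  ultimately show thesis by (rule that)
qed

lemma compose_restrict:
  assumes "g ` E \<subseteq> E" shows "compose E (restrict f E) (restrict g E) = restrict (f \<circ> g) E"
  using assms by (auto simp: compose_def restrict_def fun_eq_iff)

lemma linear_vec3:
  assumes "linear (g :: real^3 \<Rightarrow> real^3)"
  shows "g x = x $ 1 *\<^sub>R g (axis 1 1) + x $ 2 *\<^sub>R g (axis 2 1) + x $ 3 *\<^sub>R g (axis 3 1)"
proof -
  have "x = x $ 1 *\<^sub>R axis 1 1 + x $ 2 *\<^sub>R axis 2 1 + x $ 3 *\<^sub>R axis 3 1"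
    by (rule vec3_eqI) (simp_all add: axis_def)
  then have "g x = g (x $ 1 *\<^sub>R axis 1 1 + x $ 2 *\<^sub>R axis 2 1 + x $ 3 *\<^sub>R axis 3 1)" by simp
  also have "\<dots> = x $ 1 *\<^sub>R g (axis 1 1) + x $ 2 *\<^sub>R g (axis 2 1) + x $ 3 *\<^sub>R g (axis 3 1)"
    by (simp only: linear_add[OF assms] linear_cmul[OF assms])
  finally show ?thesis .
qed

text \<open>
  The images \<open>A\<close> and \<open>B\<close> of the first two basis vectors are horizontal unit vectors, and by the
  determinant \<open>B\<close> is \<open>A\<close> turned by a right angle.
\<close>

lemma rotation_fixing_north_pole_moebius:
  assumes "rotation g" "g (axis 3 1) = axis 3 1" shows "restrict g S2 \<in> moebius_S2"
proof -
  have g: "orthogonal_transformation g" and det: "det (matrix g) = 1" using assms(1) by (simp_all add: rotation_def)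
  have dot: "g v \<bullet> g w = v \<bullet> w" for v w using g by (simp add: orthogonal_transformation_def)
  define A B where "A = g (axis 1 1)" and "B = g (axis 2 1)"
  have A3: "A $ 3 = 0" and B3: "B $ 3 = 0"
    using dot[of "axis 1 1" "axis 3 1"] dot[of "axis 2 1" "axis 3 1"] assms(2)
    by (simp_all add: A_def B_def inner3 axis_def)
  have A2: "(A $ 1)\<^sup>2 + (A $ 2)\<^sup>2 = 1" and B2: "(B $ 1)\<^sup>2 + (B $ 2)\<^sup>2 = 1"
    using dot[of "axis 1 1" "axis 1 1"] dot[of "axis 2 1" "axis 2 1"] A3 B3
    by (simp_all add: A_def B_def inner3 axis_def power2_eq_square)
  have "A $ 1 * B $ 2 - B $ 1 * A $ 2 = 1"
    using det assms(2) A3 B3 by (simp add: det_3 matrix_def A_def B_def axis_def)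
  \<comment> \<open>The left-hand side is \<open>\<bar>A\<bar>\<^sup>2 + \<bar>B\<bar>\<^sup>2\<close> minus twice the determinant.\<close>
  then have "(A $ 1 - B $ 2)\<^sup>2 + (A $ 2 + B $ 1)\<^sup>2 = 0"
    using A2 B2 by (simp add: power2_eq_square algebra_simps)
  then have BA: "B $ 2 = A $ 1" "B $ 1 = - (A $ 2)" by (simp_all add: sum_power2_eq_zero_iff)
  show ?thesis
  proof (rule z_rotation_moebius[OF g A2])
    fix x
    have "g x = x $ 1 *\<^sub>R A + x $ 2 *\<^sub>R B + x $ 3 *\<^sub>R axis 3 1"
      unfolding A_def B_def using linear_vec3[OF orthogonal_transformation_linear[OF g], of x] assms(2) by simp
    then show "g x = vector [A $ 1 * x $ 1 - A $ 2 * x $ 2, A $ 2 * x $ 1 + A $ 1 * x $ 2, x $ 3]"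
      by (intro vec3_eqI) (simp_all add: A3 B3 BA axis_def)
  qed
qed

text \<open>
  Composing with the half-turn that carries the image of the north pole back to the north pole
  leaves a rotation about the vertical axis.
\<close>

theorem rotation_moebius:
  assumes "rotation f" shows "restrict f S2 \<in> moebius_S2"
proof -
  have f: "orthogonal_transformation f" using assms by (simp add: rotation_def)
  have "f (axis 3 1) \<in> S2" using orthogonal_transformation_norm[OF f] by simp
  then obtain u where u: "norm u = 1" "half_turn u (axis 3 1) = f (axis 3 1)" by (rule half_turn_of_north_pole)
  define g where "g = half_turn u \<circ> f"
  have "rotation g" unfolding g_def by (intro rotation_comp rotation_half_turn u(1) assms)
  moreover have "g (axis 3 1) = axis 3 1" using half_turn_half_turn[OF u(1), of "axis 3 1"] u(2) by (simp add: g_def)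
  ultimately have gm: "restrict g S2 \<in> moebius_S2" by (rule rotation_fixing_north_pole_moebius)
  have g: "orthogonal_transformation g" using \<open>rotation g\<close> by (simp add: rotation_def)
  have "f = half_turn u \<circ> g" using half_turn_half_turn[OF u(1)] by (simp add: g_def fun_eq_iff)
  then have "restrict f S2 = compose S2 (restrict (half_turn u) S2) (restrict g S2)"
    using compose_restrict[of g S2 "half_turn u"] orthogonal_S2[OF g] by simp
  also have "\<dots> = restrict (half_turn u) S2 \<otimes>\<^bsub>BijGroup S2\<^esub> restrict g S2"
    by (intro BijGroup_mult[symmetric] restrict_orthogonal_Bij orthogonal_half_turn u(1) g)
  also have "\<dots> \<in> moebius_S2"
    by (intro subgroup.m_closed[OF moebius_S2_subgroup] half_turn_moebius u(1) gm)
  finally show ?thesis .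
qed

text \<open>
  The half-turns already carry the north pole to every point. Consequently, the empty set does not
  have a finite stabilizer.
\<close>

lemma infinite_moebius_S2: "infinite moebius_S2"
proof
  assume "finite moebius_S2"
  have "p \<in> (\<lambda>f. f (axis 3 1)) ` moebius_S2" if p: "p \<in> S2" for p
  proof -
    obtain u where u: "norm u = 1" "half_turn u (axis 3 1) = p" by (rule half_turn_of_north_pole[OF p])
    have "p = restrict (half_turn u) S2 (axis 3 1)" using u(2) by (simp add: restrict_apply)
    then show ?thesis by (rule rev_image_eqI[OF half_turn_moebius[OF u(1)]])
  qed
  then have "S2 \<subseteq> (\<lambda>f. f (axis 3 1)) ` moebius_S2" by blast
  moreover have "finite ((\<lambda>f. f (axis 3 1)) ` moebius_S2)" by (rule finite_imageI[OF \<open>finite moebius_S2\<close>])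
  ultimately have "finite (S2 :: (real^3) set)" by (rule finite_subset)
  then show False using infinite_S2 by blast
qed

text \<open>
  The rotation group as a set of maps that are extensional on the sphere, which is how the maps in
  \<^const>\<open>moebius_S2\<close> are represented.
\<close>

definition sphere_rotations :: "(real^3) set \<Rightarrow> (real^3 \<Rightarrow> real^3) set" where
  "sphere_rotations P = (\<lambda>f. restrict f S2) ` rotations P"

lemma rotations_comp: "f \<in> rotations P \<Longrightarrow> g \<in> rotations P \<Longrightarrow> f \<circ> g \<in> rotations P"
  unfolding rotations_iff using rotation_comp[of f g] image_comp[of f g P] by simp

lemma rotations_id: "id \<in> rotations P"
  by (simp add: rotations_iff rotation_def) (simp add: id_def)

lemma rotations_inv: assumes "f \<in> rotations P" shows "Hilbert_Choice.inv f \<in> rotations P"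
proof -
  have "rotation f" "f ` P = P" using assms by (simp_all add: rotations_iff)
  have "Hilbert_Choice.inv f ` (f ` P) = (Hilbert_Choice.inv f \<circ> f) ` P" by (rule image_comp)
  also have "\<dots> = P" using orthogonal_inv_comp(1)[of f] \<open>rotation f\<close> by (simp add: rotation_def)
  finally show ?thesis using rotation_inv \<open>rotation f\<close> \<open>f ` P = P\<close> by (simp add: rotations_iff)
qed

lemma rotation_orthogonal: "rotation f \<Longrightarrow> orthogonal_transformation f"
  by (simp add: rotation_def)

lemma restrict_rotation_mult:
  assumes "rotation f" "rotation g"
  shows "restrict f S2 \<otimes>\<^bsub>BijGroup S2\<^esub> restrict g S2 = restrict (f \<circ> g) S2"
proof -
  have "restrict f S2 \<otimes>\<^bsub>BijGroup S2\<^esub> restrict g S2 = compose S2 (restrict f S2) (restrict g S2)"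
    by (intro BijGroup_mult restrict_orthogonal_Bij rotation_orthogonal assms)
  also have "\<dots> = restrict (f \<circ> g) S2"
    by (rule compose_restrict) (simp only: orthogonal_S2[OF rotation_orthogonal[OF assms(2)]] order_refl)
  finally show ?thesis .
qed

lemma sphere_rotations_subset: "sphere_rotations P \<subseteq> moebius_S2"
  using rotation_moebius by (auto simp: sphere_rotations_def rotations_iff)

lemma sphere_rotations_subgroup: "subgroup (sphere_rotations P) (BijGroup S2)"
proof -
  interpret B: group "BijGroup S2" by (rule group_BijGroup)
  have rot: "rotation f" if "f \<in> rotations P" for f using that by (simp add: rotations_iff)
  have sub: "sphere_rotations P \<subseteq> carrier (BijGroup S2)"
    using sphere_rotations_subset by (auto simp: moebius_S2_def carrier_BijGroup)
  show ?thesis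
  proof (rule B.subgroupI[OF sub])
    show "sphere_rotations P \<noteq> {}" using rotations_id by (auto simp: sphere_rotations_def)
  next
    fix a b assume "a \<in> sphere_rotations P" "b \<in> sphere_rotations P"
    then obtain f g where "f \<in> rotations P" "g \<in> rotations P" "a = restrict f S2" "b = restrict g S2"
      by (auto simp: sphere_rotations_def)
    then show "a \<otimes>\<^bsub>BijGroup S2\<^esub> b \<in> sphere_rotations P"
      using restrict_rotation_mult[OF rot rot] rotations_comp by (simp add: sphere_rotations_def)
  next
    fix a assume a: "a \<in> sphere_rotations P"
    then obtain f where f: "f \<in> rotations P" "a = restrict f S2" by (auto simp: sphere_rotations_def)
    let ?b = "restrict (Hilbert_Choice.inv f) S2"
    have b: "?b \<in> sphere_rotations P" using rotations_inv[OF f(1)] by (simp add: sphere_rotations_def)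
    have "?b \<otimes>\<^bsub>BijGroup S2\<^esub> a = restrict id S2"
      using restrict_rotation_mult[OF rot rot, OF rotations_inv[OF f(1)] f(1)]
        orthogonal_inv_comp(1)[OF rotation_orthogonal[OF rot[OF f(1)]]] f(2) by simp
    also have "\<dots> = \<one>\<^bsub>BijGroup S2\<^esub>" by (simp add: BijGroup_def restrict_def id_def)
    finally have "inv\<^bsub>BijGroup S2\<^esub> a = ?b" using a b sub by (intro B.inv_equality) auto
    then show "inv\<^bsub>BijGroup S2\<^esub> a \<in> sphere_rotations P" using b by simp
  qed
qed

lemma rot_orbit_eq:
  assumes "X \<in> S2" shows "rot_orbit P X = orbit (sphere_group (sphere_rotations P)) (\<lambda>f. f) X"
  unfolding rot_orbit_def orbit_def sphere_rotations_def setcompr_eq_image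
  using assms by (simp add: image_image del: mem_sphere_0)

lemma rot_orbits_eq: "rot_orbits P = orbits (sphere_group (sphere_rotations P)) S2 (\<lambda>f. f)"
proof -
  have "rot_orbits P = orbit (sphere_group (sphere_rotations P)) (\<lambda>f. f) ` S2"
    unfolding rot_orbits_def by (intro image_cong refl rot_orbit_eq)
  then show ?thesis unfolding orbits_def by blast
qed

section \<open>Maximality of the rotation groups\<close>

lemma order_sphere_group: "order (sphere_group H) = card H"
  by (simp add: order_def)

lemma noncommuting_squaresE:
  assumes "noncommuting_squares (sphere_group H)"
  obtains a b where "a \<in> H" "b \<in> H" "(a \<otimes>\<^bsub>BijGroup S2\<^esub> a) \<otimes>\<^bsub>BijGroup S2\<^esub> (b \<otimes>\<^bsub>BijGroup S2\<^esub> b)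
      \<noteq> (b \<otimes>\<^bsub>BijGroup S2\<^esub> b) \<otimes>\<^bsub>BijGroup S2\<^esub> (a \<otimes>\<^bsub>BijGroup S2\<^esub> a)"
  using assms unfolding noncommuting_squares_def by (elim bexE) simp

lemma moebius_group_two_fixed_points_action:
  assumes H: "subgroup H (BijGroup S2)" "finite H" "H \<subseteq> moebius_S2" and "noncommuting_squares (sphere_group H)"
  shows "two_fixed_points_action (sphere_group H) S2 (\<lambda>f. f)"
proof -
  obtain a b where "a \<in> H" "b \<in> H" "(a \<otimes>\<^bsub>BijGroup S2\<^esub> a) \<otimes>\<^bsub>BijGroup S2\<^esub> (b \<otimes>\<^bsub>BijGroup S2\<^esub> b)
      \<noteq> (b \<otimes>\<^bsub>BijGroup S2\<^esub> b) \<otimes>\<^bsub>BijGroup S2\<^esub> (a \<otimes>\<^bsub>BijGroup S2\<^esub> a)"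
    by (rule noncommuting_squaresE[OF assms(4)])
  then show ?thesis by (rule finite_moebius_group_action[OF H])
qed

lemma noncommuting_squares_mono:
  assumes "noncommuting_squares (sphere_group R)" "R \<subseteq> H" shows "noncommuting_squares (sphere_group H)"
proof -
  obtain a b where ab: "a \<in> R" "b \<in> R" "(a \<otimes>\<^bsub>BijGroup S2\<^esub> a) \<otimes>\<^bsub>BijGroup S2\<^esub> (b \<otimes>\<^bsub>BijGroup S2\<^esub> b)
      \<noteq> (b \<otimes>\<^bsub>BijGroup S2\<^esub> b) \<otimes>\<^bsub>BijGroup S2\<^esub> (a \<otimes>\<^bsub>BijGroup S2\<^esub> a)"
    by (rule noncommuting_squaresE[OF assms(1)])
  then show ?thesis
    unfolding noncommuting_squares_def using subsetD[OF assms(2) ab(1)] subsetD[OF assms(2) ab(2)]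
    by (intro bexI[of _ a] bexI[of _ b]) simp_all
qed

lemma card_finite_moebius_group:
  assumes "subgroup H (BijGroup S2)" "finite H" "H \<subseteq> moebius_S2" "noncommuting_squares (sphere_group H)"
  shows "card H \<in> {12, 24, 60}"
proof -
  interpret two_fixed_points_action "sphere_group H" S2 "\<lambda>f. f" by (rule moebius_group_two_fixed_points_action[OF assms])
  obtain A B C :: "(real^3) set" where
    "(order (sphere_group H), card A, card B, card C) \<in> {(12, 6, 4, 4), (24, 12, 8, 6), (60, 30, 20, 12)}"
    by (rule exceptional_orbits_classification)
  then show ?thesis unfolding order_sphere_group by auto
qed

lemma card_dvd_of_subset:
  assumes "subgroup R (BijGroup S2)" "subgroup H (BijGroup S2)" "R \<subseteq> H"
  shows "card R dvd card H"
proof -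
  interpret B: group "BijGroup S2" by (rule group_BijGroup)
  have "subgroup R (sphere_group H)" using B.subgroup_incl[OF assms] by simp
  then have "card (rcosets\<^bsub>sphere_group H\<^esub> R) * card R = card H"
    using group.lagrange[OF sphere_group_group[OF assms(2)], of R] by (simp add: order_sphere_group)
  then have "card H = card R * card (rcosets\<^bsub>sphere_group H\<^esub> R)" by (simp add: mult.commute)
  then show ?thesis by (rule dvdI)
qed

text \<open>
  The stabilizer of \<open>\<alpha>\<close> is finite, because \<open>\<alpha>\<close> contains an orbit of \<open>R\<close> and hence three points. It
  inherits two noncommuting squares from \<open>R\<close>, so its order is 12, 24 or 60. The only multiple of
  \<open>card R\<close> among these numbers is \<open>card R\<close> itself.
\<close>

theorem moebius_fixing_eq:
  assumes R: "subgroup R (BijGroup S2)" "finite R" "R \<subseteq> moebius_S2" "noncommuting_squares (sphere_group R)"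
    and card_R: "card R \<in> {24, 60}"
    and \<alpha>: "\<alpha> \<subseteq> S2" "finite \<alpha>" "\<alpha> \<noteq> {}" and inv: "\<And>f. f \<in> R \<Longrightarrow> f ` \<alpha> = \<alpha>"
  shows "moebius_fixing \<alpha> = R"
proof -
  interpret R: two_fixed_points_action "sphere_group R" S2 "\<lambda>f. f" by (rule moebius_group_two_fixed_points_action[OF R])
  obtain x where x: "x \<in> \<alpha>" "x \<in> S2" using \<alpha> by blast
  have "orbit (sphere_group R) (\<lambda>f. f) x \<subseteq> \<alpha>" using inv x(1) by (auto simp: orbit_def)
  then have "card \<alpha> \<ge> 3" using R.orbit_ge_3[OF x(2)] card_mono[OF \<alpha>(2)] by (meson le_trans)
  define H where "H = moebius_fixing \<alpha>"
  have H: "subgroup H (BijGroup S2)" "finite H" "H \<subseteq> moebius_S2"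
    unfolding H_def using moebius_fixing_subgroup[OF \<alpha>(1)] finite_moebius_fixing[OF \<alpha>(1,2) \<open>card \<alpha> \<ge> 3\<close>]
    by (auto simp: moebius_fixing_def)
  have "R \<subseteq> H" using R(3) inv by (auto simp: H_def moebius_fixing_def)
  then have "card H \<in> {12, 24, 60}"
    by (intro card_finite_moebius_group H noncommuting_squares_mono[OF R(4)])
  moreover have "card R dvd card H" by (rule card_dvd_of_subset[OF R(1) H(1) \<open>R \<subseteq> H\<close>])
  ultimately have "card R = card H" using card_R by (auto simp: dvd_eq_mod_eq_0)
  then have "R = H" by (rule card_subset_eq[OF H(2) \<open>R \<subseteq> H\<close>])
  then show ?thesis by (simp add: H_def)
qed

text \<open>
  For the dodecahedron \<open>K\<close> is \<open>A\<^sub>5\<close>, for the cube it is \<open>S\<^sub>4\<close>. By \<open>moebius_fixing_eq\<close> such a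
  rotation group is the full stabilizer of every nonempty finite union of its orbits.
\<close>

locale maximal_rotation_group =
  fixes P :: "(real^3) set" and K :: "'k monoid"
  assumes iso: "sphere_group (sphere_rotations P) \<cong> K"
    and squares: "noncommuting_squares K"
    and card_K: "order K \<in> {24, 60}"
begin

abbreviation "R \<equiv> sphere_group (sphere_rotations P)"

lemma card_R: "card (sphere_rotations P) = order K"
  using iso_same_card[OF iso] by (simp add: order_def)

lemma finite_R: "finite (sphere_rotations P)"
  using card_R card_K by (intro card_ge_0_finite) auto

lemma squares_R: "noncommuting_squares R"
  by (rule noncommuting_squares_iso[OF sphere_group_group[OF sphere_rotations_subgroup] iso squares])

sublocale two_fixed_points_action R S2 "\<lambda>f. f"
  by (rule moebius_group_two_fixed_points_action[OF sphere_rotations_subgroup finite_R sphere_rotations_subset squares_R])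

lemma order_R: "order R = order K"
  by (simp add: order_sphere_group card_R)

lemma moebius_stabilizer_Union:
  assumes "Z \<subseteq> rot_orbits P" "finite Z" "Z \<noteq> {}"
  shows "\<Union> Z \<subseteq> S2" "finite (\<Union> Z)" "moebius_stabilizer (\<Union> Z) \<cong> K"
proof -
  have Z: "Z \<subseteq> orbits R S2 (\<lambda>f. f)" using assms(1) by (simp add: rot_orbits_eq)
  have Z_orbit: "\<exists>x\<in>S2. W = orbit R (\<lambda>f. f) x" if "W \<in> Z" for W
    using subsetD[OF Z that] unfolding orbits_def by blast
  show sub: "\<Union> Z \<subseteq> S2"
  proof (rule Union_least)
    fix W assume "W \<in> Z"
    then obtain x where "x \<in> S2" "W = orbit R (\<lambda>f. f) x" using Z_orbit by blast
    then show "W \<subseteq> S2" using orbit_subset by blast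
  qed
  have "finite W" if "W \<in> Z" for W
    using Z_orbit[OF that] finite_orbit by auto
  then show fin: "finite (\<Union> Z)" by (intro finite_Union assms(2))
  obtain W where "W \<in> Z" using assms(3) by blast
  moreover obtain x where "x \<in> S2" "W = orbit R (\<lambda>f. f) x" using Z_orbit[OF calculation] by blast
  ultimately have "\<Union> Z \<noteq> {}" using orbit_refl[of x] by blast
  have "moebius_fixing (\<Union> Z) = sphere_rotations P"
  proof (rule moebius_fixing_eq[OF sphere_rotations_subgroup finite_R sphere_rotations_subset squares_R _ sub fin \<open>\<Union> Z \<noteq> {}\<close>])
    show "card (sphere_rotations P) \<in> {24, 60}" using card_K by (simp only: card_R)
    show "f ` \<Union> Z = \<Union> Z" if "f \<in> sphere_rotations P" for f
      using Union_orbits_image[OF Z, of f] that by simp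
  qed
  then show "moebius_stabilizer (\<Union> Z) \<cong> K" using iso by (simp add: moebius_stabilizer_eq)
qed

lemma obtain_orbits:
  assumes "finite Z0" obtains Y where "Y \<subseteq> rot_orbits P - Z0" "finite Y" "card Y = k"
proof -
  have "infinite (rot_orbits P - Z0)"
    using infinite_orbits[OF infinite_S2] assms by (simp add: rot_orbits_eq)
  then show thesis using infinite_arbitrarily_large[of "rot_orbits P - Z0" k] that by blast
qed

end

text \<open>
  The set is invariant under its own stabilizer, whose order and orbit sizes are known from its
  isomorphism type. It is not empty, as the empty set is stabilized by all of the infinitely many
  Moebius transformations.
\<close>

lemma card_of_stabilized_set:
  fixes K :: "'k monoid"
  assumes "\<alpha> \<subseteq> S2" "finite \<alpha>" "moebius_stabilizer \<alpha> \<cong> K" "noncommuting_squares K" "finite (carrier K)"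
  shows "\<alpha> \<noteq> {}" and "\<exists>a b c k x. (order K, a, b, c) \<in> {(12, 6, 4, 4), (24, 12, 8, 6), (60, 30, 20, 12)}
    \<and> x \<in> {0, a, b, c, a + b, a + c, b + c, a + b + c} \<and> card \<alpha> = x + k * order K"
proof -
  define H where "H = moebius_fixing \<alpha>"
  have iso: "sphere_group H \<cong> K" using assms(3) by (simp add: moebius_stabilizer_eq H_def)
  have sub: "subgroup H (BijGroup S2)" unfolding H_def by (rule moebius_fixing_subgroup[OF assms(1)])
  obtain h where "bij_betw h H (carrier K)" using iso by (auto simp: is_iso_def iso_def)
  then have fin: "finite H" using assms(5) bij_betw_finite by blast
  show ne: "\<alpha> \<noteq> {}"
  proof
    assume "\<alpha> = {}"
    then have "H = moebius_S2" by (simp add: H_def moebius_fixing_def)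
    with fin infinite_moebius_S2 show False by simp
  qed
  have HM: "H \<subseteq> moebius_S2" by (auto simp: H_def moebius_fixing_def)
  interpret two_fixed_points_action "sphere_group H" S2 "\<lambda>f. f"
    by (rule moebius_group_two_fixed_points_action[OF sub fin HM noncommuting_squares_iso[OF sphere_group_group[OF sub] iso assms(4)]])
  have order: "order (sphere_group H) = order K" using iso_same_card[OF iso] by (simp add: order_def)
  obtain X k where X: "X \<subseteq> exceptional_orbits" "card \<alpha> = (\<Sum>W\<in>X. card W) + k * order (sphere_group H)"
    by (rule card_invariant[OF assms(2,1)]) (simp add: H_def moebius_fixing_def)
  obtain A B C where ABC: "exceptional_orbits = {A, B, C}" "A \<noteq> B" "A \<noteq> C" "B \<noteq> C"
    "(order (sphere_group H), card A, card B, card C) \<in> {(12, 6, 4, 4), (24, 12, 8, 6), (60, 30, 20, 12)}"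
    by (rule exceptional_orbits_classification)
  have "X \<in> Pow {A, B, C}" using X(1) ABC(1) by blast
  then have "(\<Sum>W\<in>X. card W) \<in> {0, card A, card B, card C, card A + card B, card A + card C, card B + card C,
      card A + card B + card C}"
  proof -
    have "Pow {A, B, C} = {{A, B, C}, {A, B}, {A, C}, {A}, {B, C}, {B}, {C}, {}}" by (simp add: Pow_insert)
    then have "X \<in> {{A, B, C}, {A, B}, {A, C}, {A}, {B, C}, {B}, {C}, {}}" using \<open>X \<in> Pow {A, B, C}\<close> by simp
    then show ?thesis using ABC(2-4) by (elim insertE emptyE) simp_all
  qed
  with ABC(5) X(2) show "\<exists>a b c k x. (order K, a, b, c) \<in> {(12, 6, 4, 4), (24, 12, 8, 6), (60, 30, 20, 12)}
    \<and> x \<in> {0, a, b, c, a + b, a + c, b + c, a + b + c} \<and> card \<alpha> = x + k * order K"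
    unfolding order by (intro exI conjI)
qed

context maximal_rotation_group
begin

text \<open>
  That no other cardinalities occur is \<open>card_of_stabilized_set\<close>. Conversely, \<open>x + order K * k\<close> is the size
  of the union of some exceptional orbits of the rotation group and \<open>k\<close> other orbits, and the group
  is the full stabilizer of that union.
\<close>

lemma stabilizer_cards:
  obtains a b c where "(order K, a, b, c) \<in> {(24, 12, 8, 6), (60, 30, 20, 12)}"
    "{card \<alpha> | \<alpha>. \<alpha> \<subseteq> S2 \<and> finite \<alpha> \<and> moebius_stabilizer \<alpha> \<cong> K}
      = {x + order K * k | x k :: nat. x \<in> {0, a, b, c, a + b, a + c, b + c, a + b + c} \<and> x\<^sup>2 + k\<^sup>2 \<noteq> 0}"
proof -
  let ?N = "order K"
  obtain A B C where ABC: "exceptional_orbits = {A, B, C}" "A \<noteq> B" "A \<noteq> C" "B \<noteq> C"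
    "(order R, card A, card B, card C) \<in> {(12, 6, 4, 4), (24, 12, 8, 6), (60, 30, 20, 12)}"
    by (rule exceptional_orbits_classification)
  define a b c where "a = card A" and "b = card B" and "c = card C"
  have abc: "(?N, a, b, c) \<in> {(24, 12, 8, 6), (60, 30, 20, 12)}"
    using ABC(5) card_K unfolding order_R a_def b_def c_def by auto
  let ?S = "{0, a, b, c, a + b, a + c, b + c, a + b + c}"
  show thesis
  proof (rule that[OF abc], intro equalityI subsetI)
    fix n assume "n \<in> {card \<alpha> | \<alpha>. \<alpha> \<subseteq> S2 \<and> finite \<alpha> \<and> moebius_stabilizer \<alpha> \<cong> K}"
    then obtain \<alpha> where \<alpha>: "\<alpha> \<subseteq> S2" "finite \<alpha>" "moebius_stabilizer \<alpha> \<cong> K" and n: "n = card \<alpha>" by blast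
    have "finite (carrier K)" using card_K by (intro card_ge_0_finite) (auto simp: order_def)
    note sc = card_of_stabilized_set[OF \<alpha> squares this]
    obtain a' b' c' k x where e: "(?N, a', b', c') \<in> {(12, 6, 4, 4), (24, 12, 8, 6), (60, 30, 20, 12)}"
      "x \<in> {0, a', b', c', a' + b', a' + c', b' + c', a' + b' + c'}" "card \<alpha> = x + k * ?N"
      using sc(2) by blast
    have "a' = a" "b' = b" "c' = c" using e(1) abc by auto
    then have "x \<in> ?S" using e(2) by simp
    moreover have "x\<^sup>2 + k\<^sup>2 \<noteq> 0" using sc(1) e(3) \<alpha>(2) by (auto simp: sum_power2_eq_zero_iff)
    ultimately show "n \<in> {x + ?N * k | x k :: nat. x \<in> ?S \<and> x\<^sup>2 + k\<^sup>2 \<noteq> 0}"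
      using e(3) n by (auto simp: mult.commute)
  next
    fix n assume "n \<in> {x + ?N * k | x k :: nat. x \<in> ?S \<and> x\<^sup>2 + k\<^sup>2 \<noteq> 0}"
    then obtain x k where n: "n = x + ?N * k" "x \<in> ?S" "x\<^sup>2 + k\<^sup>2 \<noteq> 0" by blast
    have "\<exists>X. X \<subseteq> {A, B, C} \<and> (\<Sum>W\<in>X. card W) = x"
    proof -
      have sums: "(\<Sum>W\<in>{}. card W) = 0" "(\<Sum>W\<in>{A}. card W) = a" "(\<Sum>W\<in>{B}. card W) = b" "(\<Sum>W\<in>{C}. card W) = c"
        "(\<Sum>W\<in>{A, B}. card W) = a + b" "(\<Sum>W\<in>{A, C}. card W) = a + c" "(\<Sum>W\<in>{B, C}. card W) = b + c"
        "(\<Sum>W\<in>{A, B, C}. card W) = a + b + c"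
        using ABC(2-4) by (simp_all add: a_def b_def c_def)
      consider "x = 0" | "x = a" | "x = b" | "x = c" | "x = a + b" | "x = a + c" | "x = b + c" | "x = a + b + c"
        using n(2) by blast
      then show ?thesis
      proof cases
        case 1 with sums(1) show ?thesis by (intro exI[of _ "{}"]) simp
      next
        case 2 with sums(2) show ?thesis by (intro exI[of _ "{A}"]) simp
      next
        case 3 with sums(3) show ?thesis by (intro exI[of _ "{B}"]) simp
      next
        case 4 with sums(4) show ?thesis by (intro exI[of _ "{C}"]) simp
      next
        case 5 with sums(5) show ?thesis by (intro exI[of _ "{A, B}"]) simp
      next
        case 6 with sums(6) show ?thesis by (intro exI[of _ "{A, C}"]) simp
      next
        case 7 with sums(7) show ?thesis by (intro exI[of _ "{B, C}"]) simp
      next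
        case 8 with sums(8) show ?thesis by (intro exI[of _ "{A, B, C}"]) simp
      qed
    qed
    then obtain X where X: "X \<subseteq> exceptional_orbits" "(\<Sum>W\<in>X. card W) = x" using ABC(1) by blast
    obtain Y where Y: "Y \<subseteq> rot_orbits P - exceptional_orbits" "finite Y" "card Y = k"
      by (rule obtain_orbits[OF finite_exceptional_orbits])
    have ZP: "X \<union> Y \<subseteq> rot_orbits P" "finite (X \<union> Y)"
      using X(1) Y finite_subset[OF X(1) finite_exceptional_orbits] by (auto simp: exceptional_orbits_def rot_orbits_eq)
    have ne: "X \<union> Y \<noteq> {}"
    proof
      assume "X \<union> Y = {}"
      then have "x = 0" "k = 0" using X(2) Y(3) by auto
      then show False using n(3) by simp
    qed
    have "card (\<Union> (X \<union> Y)) = n"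
      using card_generic_orbits[OF X(1) _ Y(2)] Y(1,3) X(2) n(1) by (simp add: rot_orbits_eq order_R mult.commute)
    then show "n \<in> {card \<alpha> | \<alpha>. \<alpha> \<subseteq> S2 \<and> finite \<alpha> \<and> moebius_stabilizer \<alpha> \<cong> K}"
      using moebius_stabilizer_Union[OF ZP ne] by blast
  qed
qed

end

section \<open>Subgroups of symmetric groups\<close>

text \<open>
  \<^term>\<open>sym_group n\<close> permutes the numbers \<open>{1..n}\<close>, so the action is transported along a numbering of
  \<open>X\<close>.
\<close>

lemma faithful_action_embeds_in_sym_group:
  assumes "group G" and X: "finite X" "card X = n"
    and closed: "\<And>g x. g \<in> carrier G \<Longrightarrow> x \<in> X \<Longrightarrow> act g x \<in> X"
    and mult: "\<And>g k x. g \<in> carrier G \<Longrightarrow> k \<in> carrier G \<Longrightarrow> x \<in> X \<Longrightarrow> act (g \<otimes>\<^bsub>G\<^esub> k) x = act g (act k x)"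
    and one: "\<And>x. x \<in> X \<Longrightarrow> act \<one>\<^bsub>G\<^esub> x = x"
    and faithful: "\<And>g. g \<in> carrier G \<Longrightarrow> (\<And>x. x \<in> X \<Longrightarrow> act g x = x) \<Longrightarrow> g = \<one>\<^bsub>G\<^esub>"
  obtains h where "h \<in> hom G (sym_group n)" "inj_on h (carrier G)"
proof -
  interpret G: group G by (rule assms(1))
  obtain b where b: "bij_betw b {1..n} X" using ex_bij_betw_nat_finite_1[OF X(1)] X(2) by blast
  define b' where "b' = inv_into {1..n} b"
  have bX: "b i \<in> X" "b' (b i) = i" if "i \<in> {1..n}" for i
    using that b unfolding b'_def by (simp_all add: bij_betw_apply bij_betw_inv_into_left)
  have b'X: "b' x \<in> {1..n}" "b (b' x) = x" if "x \<in> X" for x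
    using bij_betw_apply[OF bij_betw_inv_into[OF b] that] that b unfolding b'_def
    by (simp_all add: bij_betw_inv_into_right)
  define h where "h g = (\<lambda>i. if i \<in> {1..n} then b' (act g (b i)) else i)" for g
  have h_in: "h g i \<in> {1..n}" if "g \<in> carrier G" "i \<in> {1..n}" for g i
    using b'X(1)[OF closed[OF that(1) bX(1)[OF that(2)]]] that(2) by (simp add: h_def)
  have h_mult: "h (g \<otimes>\<^bsub>G\<^esub> k) = h g \<circ> h k" if g: "g \<in> carrier G" and k: "k \<in> carrier G" for g k
  proof
    fix i show "h (g \<otimes>\<^bsub>G\<^esub> k) i = (h g \<circ> h k) i"
    proof (cases "i \<in> {1..n}")
      case True
      have 1: "h k i \<in> {1..n}" by (rule h_in[OF k True])
      have 2: "b (h k i) = act k (b i)"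
        using b'X(2)[OF closed[OF k bX(1)[OF True]]] True by (simp add: h_def)
      have "(h g \<circ> h k) i = b' (act g (b (h k i)))" using 1 by (simp add: h_def[of g])
      also have "\<dots> = b' (act (g \<otimes>\<^bsub>G\<^esub> k) (b i))" by (simp only: 2 mult[OF g k bX(1)[OF True]])
      finally show ?thesis using True by (simp add: h_def[of "g \<otimes>\<^bsub>G\<^esub> k"])
    qed (auto simp: h_def)
  qed
  have h_one: "h \<one>\<^bsub>G\<^esub> = id"
    by (rule ext) (simp add: h_def one bX)
  have perm: "h g permutes {1..n}" if g: "g \<in> carrier G" for g
  proof (rule bij_imp_permutes)
    have inv: "h g (h (inv\<^bsub>G\<^esub> g) i) = i" "h (inv\<^bsub>G\<^esub> g) (h g i) = i" for i
      using fun_cong[OF h_mult[OF g G.inv_closed[OF g]], of i] fun_cong[OF h_mult[OF G.inv_closed[OF g] g], of i]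
        h_one g by simp_all
    show "bij_betw (h g) {1..n} {1..n}"
      by (rule bij_betw_byWitness[where f' = "h (inv\<^bsub>G\<^esub> g)"])
        (use h_in[OF g] h_in[OF G.inv_closed[OF g]] inv in auto)
    show "h g i = i" if "i \<notin> {1..n}" for i unfolding h_def using that by (rule if_not_P)
  qed
  show thesis
  proof
    show "h \<in> hom G (sym_group n)"
      using perm h_mult by (intro homI) (simp_all only: sym_group_carrier sym_group_mult)
    show "inj_on h (carrier G)"
    proof (rule inj_onI)
      fix g k assume g: "g \<in> carrier G" and k: "k \<in> carrier G" and eq: "h g = h k"
      have "h (inv\<^bsub>G\<^esub> k \<otimes>\<^bsub>G\<^esub> g) = id"
        using h_mult[OF G.inv_closed[OF k] g] h_mult[OF G.inv_closed[OF k] k] eq h_one k by simp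
      then have id: "h (inv\<^bsub>G\<^esub> k \<otimes>\<^bsub>G\<^esub> g) i = i" for i by simp
      have "act (inv\<^bsub>G\<^esub> k \<otimes>\<^bsub>G\<^esub> g) x = x" if x: "x \<in> X" for x
      proof -
        have kg: "inv\<^bsub>G\<^esub> k \<otimes>\<^bsub>G\<^esub> g \<in> carrier G" using g k by simp
        have "b' (act (inv\<^bsub>G\<^esub> k \<otimes>\<^bsub>G\<^esub> g) x) = b' x"
          using id[of "b' x"] b'X[OF x] by (simp add: h_def)
        from arg_cong[OF this, of b] show ?thesis using b'X(2)[OF closed[OF kg x]] b'X(2)[OF x] by simp
      qed
      then have "inv\<^bsub>G\<^esub> k \<otimes>\<^bsub>G\<^esub> g = \<one>\<^bsub>G\<^esub>" using g k by (intro faithful) simp_all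
      then have "k \<otimes>\<^bsub>G\<^esub> (inv\<^bsub>G\<^esub> k \<otimes>\<^bsub>G\<^esub> g) = k" using k by simp
      then show "g = k" using g k by (simp add: G.m_assoc[symmetric])
    qed
  qed
qed

text \<open>
  If \<open>x\<close> is not in \<open>B\<close>, then \<open>B\<close> and \<open>x * B\<close> cover the whole group, and \<open>x * x\<close> lies in \<open>x * B\<close> only
  if \<open>x\<close> lies in \<open>B\<close>.
\<close>

lemma index_two_subgroup_square:
  assumes "group S" "finite (carrier S)" "subgroup B S" "2 * card B = card (carrier S)" "x \<in> carrier S"
  shows "x \<otimes>\<^bsub>S\<^esub> x \<in> B"
proof (rule ccontr)
  interpret S: group S by (rule assms(1))
  assume xx: "x \<otimes>\<^bsub>S\<^esub> x \<notin> B"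
  have B: "B \<subseteq> carrier S" by (rule subgroup.subset[OF assms(3)])
  have fin: "finite B" by (rule finite_subset[OF B assms(2)])
  let ?xB = "(\<lambda>y. x \<otimes>\<^bsub>S\<^esub> y) ` B"
  have xB: "?xB \<subseteq> carrier S" using B assms(5) by auto
  have "x \<notin> B" using xx subgroup.m_closed[OF assms(3)] by blast
  have inv: "x = z \<otimes>\<^bsub>S\<^esub> inv\<^bsub>S\<^esub> y" if "y \<in> carrier S" "z = x \<otimes>\<^bsub>S\<^esub> y" for y z
    using that assms(5) by (simp add: S.m_assoc)
  have "B \<inter> ?xB = {}"
  proof (rule ccontr)
    assume "B \<inter> ?xB \<noteq> {}"
    then obtain y where y: "y \<in> B" "x \<otimes>\<^bsub>S\<^esub> y \<in> B" by blast
    have "x = (x \<otimes>\<^bsub>S\<^esub> y) \<otimes>\<^bsub>S\<^esub> inv\<^bsub>S\<^esub> y" using inv y(1) B by blast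
    also have "\<dots> \<in> B" by (intro subgroup.m_closed[OF assms(3)] subgroup.m_inv_closed[OF assms(3)] y)
    finally show False using \<open>x \<notin> B\<close> by blast
  qed
  moreover have "card ?xB = card B"
    by (rule card_image) (use B assms(5) in \<open>auto simp: inj_on_def subset_iff\<close>)
  ultimately have "card (B \<union> ?xB) = card (carrier S)"
    using card_Un_disjoint[OF fin finite_imageI[OF fin], of "\<lambda>y. x \<otimes>\<^bsub>S\<^esub> y"] assms(4) by simp
  then have "B \<union> ?xB = carrier S" by (intro card_subset_eq assms(2)) (use B xB in auto)
  then have "x \<otimes>\<^bsub>S\<^esub> x \<in> ?xB" using xx assms(5) S.m_closed by blast
  then obtain y where "y \<in> B" "x \<otimes>\<^bsub>S\<^esub> x = x \<otimes>\<^bsub>S\<^esub> y" by blast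
  then have "x = y" using S.Units_l_cancel[of x x y] assms(5) subsetD[OF B] by simp
  then show False using \<open>x \<notin> B\<close> \<open>y \<in> B\<close> by simp
qed

text \<open>
  A 3-cycle is the square of its own square, so it lies in every subgroup of index two. The 3-cycles
  generate the alternating group, which has the same order as \<open>B\<close>.
\<close>

lemma index_two_subgroup_sym_group:
  assumes "subgroup B (sym_group n)" "2 * card B = fact n" "n \<ge> 2"
  shows "B = carrier (alt_group n)"
proof -
  have fin: "finite (carrier (sym_group n))"
    using sym_group_card_carrier[of n] by (intro card_ge_0_finite) simp
  have Bfin: "finite B" by (rule finite_subset[OF subgroup.subset[OF assms(1)] fin])
  have three: "three_cycles n \<subseteq> B"
  proof
    fix p assume "p \<in> three_cycles n"
    then obtain cs where cs: "p = cycle_of_list cs" "cycle cs" "length cs = 3" "set cs \<subseteq> {1..n}" by auto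
    have p: "p \<in> carrier (sym_group n)"
      using permutes_subset[OF cycle_permutes cs(4)] cs(1) by (simp add: sym_group_carrier)
    then have pp: "p \<circ> p \<in> carrier (sym_group n)"
      by (simp add: sym_group_carrier permutes_compose)
    have "p ^^ 3 = id" using cycle_is_id_root[OF cs(2)] unfolding cs(1,3) .
    then have "p \<circ> p \<circ> p = id" by (simp add: numeral_3_eq_3 comp_assoc)
    then have "(p \<circ> p) \<circ> (p \<circ> p) = p" by (simp only: comp_assoc[symmetric] id_comp)
    then have "p = (p \<circ> p) \<circ> (p \<circ> p)" by (rule sym)
    also have "\<dots> \<in> B"
      using index_two_subgroup_square[OF sym_group_is_group fin assms(1) _ pp] assms(2)
      by (simp only: sym_group_mult sym_group_card_carrier simp_thms)
    finally show "p \<in> B" .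
  qed
  interpret S: group "sym_group n" by (rule sym_group_is_group)
  have sub: "carrier (alt_group n) \<subseteq> B"
  proof
    fix p assume "p \<in> carrier (alt_group n)"
    then have "p \<in> generate (alt_group n) (three_cycles n)" by (simp only: alt_group_carrier_as_three_cycles)
    then show "p \<in> B"
    proof induction
      case one then show ?case using subgroup.one_closed[OF assms(1)] by (simp add: alt_group_def)
    next
      case (incl h) then show ?case using three by blast
    next
      case (inv h)
      then have hc: "h \<in> carrier (alt_group n)" using three_cycles_incl by blast
      have hB: "h \<in> B" using inv three by blast
      have "inv\<^bsub>alt_group n\<^esub> h = inv\<^bsub>sym_group n\<^esub> h"
        using alt_group_inv_equality[OF hc] sym_group_inv_equality[OF subsetD[OF subgroup.subset[OF assms(1)] hB]] by simp
      then show ?case using subgroup.m_inv_closed[OF assms(1) hB] by simp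
    next
      case (eng h1 h2) then show ?case
        using subgroup.m_closed[OF assms(1), of h1 h2] by (simp only: alt_group_mult sym_group_mult)
    qed
  qed
  moreover have "card (carrier (alt_group n)) = card B"
    using alt_group_card_carrier[OF assms(3)] assms(2) by simp
  ultimately show ?thesis using card_subset_eq[OF Bfin sub] by simp
qed

lemma embedding_iso_sym_group:
  assumes "group G" "h \<in> hom G (sym_group n)" "inj_on h (carrier G)" "order G = fact n"
  shows "G \<cong> sym_group n"
proof -
  have fin: "finite (carrier (sym_group n))"
    using sym_group_card_carrier[of n] by (intro card_ge_0_finite) simp
  have "h ` carrier G = carrier (sym_group n)"
    using hom_in_carrier[OF assms(2)] card_image[OF assms(3)] assms(4) sym_group_card_carrier[of n]
    by (intro card_subset_eq[OF fin]) (auto simp: order_def)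
  then have "h \<in> iso G (sym_group n)" using assms(2,3) by (simp add: iso_def bij_betw_def)
  then show ?thesis by (auto simp: is_iso_def)
qed

lemma embedding_iso_alt_group:
  assumes "group G" "h \<in> hom G (sym_group n)" "inj_on h (carrier G)" "2 * order G = fact n" "n \<ge> 2"
  shows "G \<cong> alt_group n"
proof -
  have "group_hom G (sym_group n) h"
    using assms(1,2) sym_group_is_group by (simp add: group_hom_def group_hom_axioms_def)
  then have "subgroup (h ` carrier G) (sym_group n)" by (rule group_hom.img_is_subgroup)
  then have img: "h ` carrier G = carrier (alt_group n)"
    using card_image[OF assms(3)] assms(4,5) by (intro index_two_subgroup_sym_group) (simp_all add: order_def)
  have "h \<in> hom G (alt_group n)"
    using assms(2) img by (auto simp: hom_def alt_group_mult sym_group_mult)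
  then have "h \<in> iso G (alt_group n)" using assms(3) img by (simp add: iso_def bij_betw_def)
  then show ?thesis by (auto simp: is_iso_def)
qed

section \<open>Orbit sizes and blocks\<close>

lemma image_action:
  "group_action (BijGroup E) (Pow E) (\<lambda>f. \<lambda>W\<in>Pow E. f ` W)"
proof -
  have Bij: "(\<lambda>W\<in>Pow E. f ` W) \<in> Bij (Pow E)" if "f \<in> Bij E" for f
  proof -
    have "bij_betw f E E" using that by (simp add: Bij_def)
    then have "bij_betw ((`) f) (Pow E) (Pow E)" by (rule bij_betw_Pow)
    moreover have "bij_betw (\<lambda>W\<in>Pow E. f ` W) (Pow E) (Pow E) \<longleftrightarrow> bij_betw ((`) f) (Pow E) (Pow E)"
      by (rule bij_betw_cong) simp
    ultimately show ?thesis by (simp add: Bij_def)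
  qed
  have "(\<lambda>f. \<lambda>W\<in>Pow E. f ` W) \<in> hom (BijGroup E) (BijGroup (Pow E))"
  proof (rule homI)
    fix f g assume "f \<in> carrier (BijGroup E)" "g \<in> carrier (BijGroup E)"
    then have f: "f \<in> Bij E" and g: "g \<in> Bij E" by (simp_all add: carrier_BijGroup)
    have gW: "g ` W \<in> Pow E" if "W \<in> Pow E" for W
      using that Bij_imp_funcset[OF g] by auto
    have "(\<lambda>W\<in>Pow E. (f \<otimes>\<^bsub>BijGroup E\<^esub> g) ` W) = compose (Pow E) (\<lambda>W\<in>Pow E. f ` W) (\<lambda>W\<in>Pow E. g ` W)"
    proof (rule ext)
      fix W show "(\<lambda>W\<in>Pow E. (f \<otimes>\<^bsub>BijGroup E\<^esub> g) ` W) W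
        = compose (Pow E) (\<lambda>W\<in>Pow E. f ` W) (\<lambda>W\<in>Pow E. g ` W) W"
      proof (cases "W \<in> Pow E")
        case True
        have "(f \<otimes>\<^bsub>BijGroup E\<^esub> g) ` W = f ` (g ` W)"
          unfolding BijGroup_mult[OF f g] by (rule compose_image) (use True in simp)
        then show ?thesis using True gW[OF True] by (simp only: compose_def restrict_apply' )
      qed (simp add: compose_def)
    qed
    then show "(\<lambda>W\<in>Pow E. (f \<otimes>\<^bsub>BijGroup E\<^esub> g) ` W)
        = (\<lambda>W\<in>Pow E. f ` W) \<otimes>\<^bsub>BijGroup (Pow E)\<^esub> (\<lambda>W\<in>Pow E. g ` W)"
      by (simp only: BijGroup_mult Bij f g)
  qed (simp add: carrier_BijGroup Bij)
  then show ?thesis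
    unfolding group_action_def group_hom_def group_hom_axioms_def by (simp add: group_BijGroup)
qed

lemma sphere_group_image_action:
  "subgroup H (BijGroup S2) \<Longrightarrow> group_action (sphere_group H) (Pow S2) (\<lambda>f. \<lambda>W\<in>Pow S2. f ` W)"
  by (rule group_action.induced_action[OF image_action])

context two_fixed_points_action
begin

lemma orbit_card_cases:
  assumes "x \<in> E"
  shows "(order G, card (orbit G \<phi> x)) \<in> {(12, 12), (12, 6), (12, 4), (24, 24), (24, 12), (24, 8), (24, 6),
    (60, 60), (60, 30), (60, 20), (60, 12)}"
proof -
  obtain A B C where ABC: "exceptional_orbits = {A, B, C}"
    "(order G, card A, card B, card C) \<in> {(12, 6, 4, 4), (24, 12, 8, 6), (60, 30, 20, 12)}"
    by (rule exceptional_orbits_classification)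
  have "orbit G \<phi> x \<in> orbits G E \<phi>" using assms by (auto simp: orbits_def)
  then have "card (orbit G \<phi> x) = order G \<or> orbit G \<phi> x \<in> exceptional_orbits"
    unfolding exceptional_orbits_def by blast
  then have "card (orbit G \<phi> x) = order G \<or> card (orbit G \<phi> x) = card A
      \<or> card (orbit G \<phi> x) = card B \<or> card (orbit G \<phi> x) = card C"
    unfolding ABC(1) by (elim disjE insertE emptyE) simp_all
  with ABC(2) show ?thesis by (elim disjE insertE emptyE) simp_all
qed

text \<open>
  If \<open>K\<close> contains a nontrivial element with a fixed point \<open>x\<close>, then every point of the orbit of \<open>x\<close>
  is fixed by a conjugate of that element, which lies in \<open>K\<close> again. Each nontrivial element fixes
  only two points, so the orbit has at most \<open>2 * (card K - 1)\<close> points.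
\<close>

lemma small_normal_subgroup_trivial:
  assumes K: "subgroup K G" and normal: "\<And>g k. g \<in> carrier G \<Longrightarrow> k \<in> K \<Longrightarrow> g \<otimes> k \<otimes> inv g \<in> K"
    and small: "\<And>x. x \<in> E \<Longrightarrow> 2 * card K \<le> card (orbit G \<phi> x) + 1"
  shows "K = {\<one>}"
proof (rule ccontr)
  interpret G: group G by (rule group_G)
  assume "K \<noteq> {\<one>}"
  then obtain k where k: "k \<in> K" "k \<noteq> \<one>" using subgroup.one_closed[OF K] by blast
  have KG: "K \<subseteq> carrier G" by (rule subgroup.subset[OF K])
  have finK: "finite K" by (rule finite_subset[OF KG finite_group])
  have "invariants E \<phi> k \<noteq> {}" using two_fixed[of k] k KG by auto
  then obtain x where x: "x \<in> E" "\<phi> k x = x" by (auto simp: invariants_def)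
  have "orbit G \<phi> x \<subseteq> (\<Union>h\<in>K - {\<one>}. invariants E \<phi> h)"
  proof
    fix y assume y: "y \<in> orbit G \<phi> x"
    then obtain g where g: "g \<in> carrier G" "y = \<phi> g x" by (auto simp: orbit_def)
    have "y \<in> E" using y orbit_subset[OF x(1)] by blast
    have kG: "k \<in> carrier G" using k KG by blast
    let ?h = "g \<otimes> k \<otimes> inv g"
    have "\<phi> (inv g) y = x"
      using composition_rule[OF x(1) G.inv_closed[OF g(1)] g(1)] fun_cong[OF id_eq_one, of x] x(1)
      unfolding g(2) G.l_inv[OF g(1)] by simp
    then have "\<phi> ?h y = y"
      using composition_rule[OF \<open>y \<in> E\<close> G.m_closed[OF g(1) kG] G.inv_closed[OF g(1)]]
        composition_rule[OF x(1) g(1) kG] x(2) g(2) by simp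
    moreover have "?h \<noteq> \<one>"
    proof
      assume "?h = \<one>"
      moreover have "?h \<otimes> g = g \<otimes> k" using g(1) kG by (simp add: G.m_assoc)
      ultimately have "g \<otimes> k = g" using g(1) by simp
      then show False using k(2) G.l_cancel_one[OF g(1) kG] by simp
    qed
    ultimately show "y \<in> (\<Union>h\<in>K - {\<one>}. invariants E \<phi> h)"
      using normal[OF g(1) k(1)] \<open>y \<in> E\<close> by (auto simp: invariants_def)
  qed
  moreover have "finite (invariants E \<phi> h)" if "h \<in> K - {\<one>}" for h
    using two_fixed[of h] that KG by (intro card_ge_0_finite) auto
  ultimately have "card (orbit G \<phi> x) \<le> card (\<Union>h\<in>K - {\<one>}. invariants E \<phi> h)"
    using finK by (intro card_mono finite_UN_I) auto
  also have "\<dots> \<le> (\<Sum>h\<in>K - {\<one>}. card (invariants E \<phi> h))" using finK by (intro card_UN_le) simp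
  also have "\<dots> = (\<Sum>h\<in>K - {\<one>}. 2)" by (rule sum.cong) (use two_fixed KG in auto)
  also have "\<dots> = 2 * (card K - 1)" using subgroup.one_closed[OF K] by simp
  finally have le: "card (orbit G \<phi> x) \<le> 2 * (card K - 1)" .
  have "card K \<ge> 1" using finK k(1) by (simp add: card_gt_0_iff Suc_le_eq) blast
  with le small[OF x(1)] show False by linarith
qed

end

text \<open>
  The stabilizer \<open>T\<close> of the block \<open>W\<close> is transitive on \<open>W\<close> and contains the stabilizer of \<open>x\<close>, so
  the number of translates of \<open>W\<close> is the size of the orbit of \<open>x\<close> divided by the size of \<open>W\<close>, that
  is \<open>n\<close>. The kernel \<open>K\<close> of the action on the translates is contained in \<open>T\<close>, and properly so,
  because \<open>a\<close> moves the translate \<open>b ` W\<close>. Thus \<open>K\<close> has at most \<open>card H / (2 * n)\<close> elements, which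
  by the numerical condition \<open>small\<close> is too few for a nontrivial normal subgroup
  (\<open>small_normal_subgroup_trivial\<close>).
\<close>

theorem block_action_embedding:
  assumes H: "subgroup H (BijGroup S2)" and act: "two_fixed_points_action (sphere_group H) S2 (\<lambda>f. f)"
    and W: "W \<subseteq> S2" "finite W" "x \<in> W"
    and trans: "\<And>y. y \<in> W \<Longrightarrow> \<exists>g\<in>H. g ` W = W \<and> g x = y"
    and stab: "\<And>g. g \<in> H \<Longrightarrow> g x = x \<Longrightarrow> g ` W = W"
    and n: "card (orbit (sphere_group H) (\<lambda>f. f) x) = n * card W"
    and moved: "a \<in> H" "b \<in> H" "a ` W = W" "a ` (b ` W) \<noteq> b ` W"
    and small: "\<And>y. y \<in> S2 \<Longrightarrow> card H \<le> n * (card (orbit (sphere_group H) (\<lambda>f. f) y) + 1)"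
  obtains h where "h \<in> hom (sphere_group H) (sym_group n)" "inj_on h H"
proof -
  let ?G = "sphere_group H"
  interpret two_fixed_points_action ?G S2 "\<lambda>f. f" by (rule act)
  interpret G: group ?G by (rule sphere_group_group[OF H])
  interpret I: group_action ?G "Pow S2" "\<lambda>f. \<lambda>W\<in>Pow S2. f ` W" by (rule sphere_group_image_action[OF H])
  define T where "T = {g \<in> H. g ` W = W}"
  define X where "X = (\<lambda>g. g ` W) ` H"
  have x: "x \<in> S2" using W by blast
  have finH: "finite H" using finite_group by simp
  have T_stab: "stabilizer ?G (\<lambda>f. \<lambda>W\<in>Pow S2. f ` W) W = T"
    using W(1) by (simp add: stabilizer_def T_def)
  have X_orbit: "orbit ?G (\<lambda>f. \<lambda>W\<in>Pow S2. f ` W) W = X"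
    using W(1) by (auto simp: orbit_def X_def)
  have T_sub: "subgroup T ?G" using I.stabilizer_subgroup[of W] W(1) T_stab by simp
  have XT: "card X * card T = card H"
    using I.orbit_stabilizer_theorem[of W] W(1) T_stab X_orbit by (simp add: order_def)
  \<comment> \<open>\<open>T\<close> acts transitively on \<open>W\<close> with the same stabilizer of \<open>x\<close> as the whole group.\<close>
  have cardT: "card T = card W * card (stabilizer ?G (\<lambda>f. f) x)"
  proof -
    have "group_action (?G\<lparr>carrier := T\<rparr>) S2 (\<lambda>f. f)" by (rule induced_action[OF T_sub])
    then interpret TA: group_action "sphere_group T" S2 "\<lambda>f. f" by simp
    have "orbit (sphere_group T) (\<lambda>f. f) x = W"
      using trans W(3) by (auto simp: orbit_def T_def)
    moreover have "stabilizer (sphere_group T) (\<lambda>f. f) x = stabilizer ?G (\<lambda>f. f) x"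
      using stab by (auto simp: stabilizer_def T_def)
    ultimately show ?thesis using TA.orbit_stabilizer_theorem[OF x] by (simp add: order_def)
  qed
  have pos: "card H > 0" using finH moved(1) by (auto simp: card_gt_0_iff)
  then have Tpos: "card T > 0" using XT by (cases "card T") auto
  have "card X * card T = n * card T"
    using orbit_stabilizer_theorem[OF x] n cardT XT by (simp add: order_def)
  then have cardX: "card X = n" using Tpos by simp
  have finX: "finite X" using finH by (simp add: X_def)
  define K where "K = {g \<in> H. \<forall>V\<in>X. g ` V = V}"
  have XS: "V \<in> Pow S2" if V: "V \<in> X" for V
  proof -
    obtain g where "g \<in> H" "V = g ` W" using V unfolding X_def by (rule imageE)
    then show ?thesis using I.element_image[of g W V] W(1) by simp
  qed
  have K_sub: "subgroup K ?G"
  proof -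
    have "K = (\<Inter>V\<in>X. stabilizer ?G (\<lambda>f. \<lambda>W\<in>Pow S2. f ` W) V)"
    proof -
      have "X \<noteq> {}" using moved(1) by (auto simp: X_def)
      then have "K = (\<Inter>V\<in>X. {g \<in> H. g ` V = V})" unfolding K_def by blast
      moreover have "stabilizer ?G (\<lambda>f. \<lambda>W\<in>Pow S2. f ` W) V = {g \<in> H. g ` V = V}" if "V \<in> X" for V
        using XS[OF that] by (simp add: stabilizer_def)
      ultimately show ?thesis by simp
    qed
    moreover have "subgroup (\<Inter>V\<in>X. stabilizer ?G (\<lambda>f. \<lambda>W\<in>Pow S2. f ` W) V) ?G"
      using I.stabilizer_subgroup XS moved(1) by (intro G.subgroups_Inter) (auto simp: X_def)
    ultimately show ?thesis by simp
  qed
  have act_mult: "(f \<otimes>\<^bsub>?G\<^esub> g) ` V = f ` (g ` V)" if "f \<in> H" "g \<in> H" "V \<in> Pow S2" for f g V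
    using I.composition_rule[of V f g] I.element_image[of g V] that by simp
  have act_one: "\<one>\<^bsub>?G\<^esub> ` V = V" if "V \<in> Pow S2" for V
    using fun_cong[OF I.id_eq_one, of V] that by simp
  have X_closed: "g ` V \<in> X" if g: "g \<in> H" and "V \<in> X" for g V
  proof -
    obtain k where k: "k \<in> H" "V = k ` W" using \<open>V \<in> X\<close> by (auto simp: X_def)
    have "g ` V = (g \<otimes>\<^bsub>?G\<^esub> k) ` W" using act_mult[OF g k(1)] W(1) k(2) by simp
    moreover have "g \<otimes>\<^bsub>?G\<^esub> k \<in> H" using G.m_closed g k(1) by simp
    ultimately show ?thesis by (auto simp: X_def)
  qed
  have K_normal: "g \<otimes>\<^bsub>?G\<^esub> k \<otimes>\<^bsub>?G\<^esub> inv\<^bsub>?G\<^esub> g \<in> K" if g: "g \<in> carrier ?G" and k: "k \<in> K" for g k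
  proof -
    have gH: "g \<in> H" "inv\<^bsub>?G\<^esub> g \<in> H" and kH: "k \<in> H" using g k G.inv_closed[OF g] by (simp_all add: K_def)
    have gk: "g \<otimes>\<^bsub>?G\<^esub> k \<in> H" using G.m_closed gH kH by simp
    have "(g \<otimes>\<^bsub>?G\<^esub> k \<otimes>\<^bsub>?G\<^esub> inv\<^bsub>?G\<^esub> g) ` V = V" if V: "V \<in> X" for V
    proof -
      let ?V = "(inv\<^bsub>?G\<^esub> g) ` V"
      have V': "?V \<in> X" by (rule X_closed[OF gH(2) V])
      have "(g \<otimes>\<^bsub>?G\<^esub> k \<otimes>\<^bsub>?G\<^esub> inv\<^bsub>?G\<^esub> g) ` V = g ` (k ` ?V)"
        using act_mult[OF gk gH(2) XS[OF V]] act_mult[OF gH(1) kH XS[OF V']] by simp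
      also have "k ` ?V = ?V" using k V' by (simp add: K_def)
      also have "g ` ?V = (g \<otimes>\<^bsub>?G\<^esub> inv\<^bsub>?G\<^esub> g) ` V" by (rule act_mult[OF gH XS[OF V], symmetric])
      also have "\<dots> = V" using G.r_inv[OF g] act_one[OF XS[OF V]] by simp
      finally show ?thesis .
    qed
    moreover have "g \<otimes>\<^bsub>?G\<^esub> k \<otimes>\<^bsub>?G\<^esub> inv\<^bsub>?G\<^esub> g \<in> H" using G.m_closed[of _ "inv\<^bsub>?G\<^esub> g"] gk gH(2) by simp
    ultimately show ?thesis by (simp add: K_def)
  qed
  have "W \<in> X"
    using act_one[of W] W(1) G.one_closed by (auto simp: X_def image_iff)
  then have KT: "K \<subseteq> T" by (auto simp: K_def T_def)
  moreover have "a \<in> T - K"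
  proof -
    have "b ` W \<in> X" using moved(2) by (simp add: X_def)
    then have "a \<notin> K" using moved(4) unfolding K_def by blast
    then show ?thesis using moved(1,3) by (simp add: T_def)
  qed
  ultimately have "K \<subset> T" by blast
  have finT: "finite T" using finH by (simp add: T_def)
  have "2 * card K \<le> card T"
  proof -
    have "card K < card T" by (rule psubset_card_mono[OF finT \<open>K \<subset> T\<close>])
    moreover have "card K dvd card T"
    proof -
      have "subgroup T (BijGroup S2)" "subgroup K (BijGroup S2)"
        using group.incl_subgroup[OF group_BijGroup H] T_sub K_sub by simp_all
      then show ?thesis using card_dvd_of_subset KT by blast
    qed
    then obtain m where m: "card T = card K * m" by (rule dvdE)
    ultimately have "m \<noteq> 0" "m \<noteq> 1" by auto
    then have "card K * 2 \<le> card K * m" by (intro mult_left_mono) auto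
    with m show ?thesis by simp
  qed
  have npos: "n > 0" using XT cardX pos by (cases n) auto
  have "K = {\<one>\<^bsub>?G\<^esub>}"
  proof (rule small_normal_subgroup_trivial[OF K_sub K_normal])
    fix y assume y: "y \<in> S2"
    have "n * card T = card H" using XT cardX by simp
    then have "n * card T \<le> n * (card (orbit ?G (\<lambda>f. f) y) + 1)" using small[OF y] by simp
    then have "card T \<le> card (orbit ?G (\<lambda>f. f) y) + 1" by (rule mult_left_le_imp_le[OF _ npos])
    then show "2 * card K \<le> card (orbit ?G (\<lambda>f. f) y) + 1" using \<open>2 * card K \<le> card T\<close> by simp
  qed
  then have faithful: "g = \<one>\<^bsub>?G\<^esub>" if "g \<in> carrier ?G" "\<And>V. V \<in> X \<Longrightarrow> g ` V = V" for g
    using that by (auto simp: K_def)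
  show thesis
  proof (rule faithful_action_embeds_in_sym_group[OF G.is_group finX cardX, of "\<lambda>g V. g ` V"])
    show "g ` V \<in> X" if "g \<in> carrier ?G" "V \<in> X" for g V
      using X_closed that by simp
    show "(f \<otimes>\<^bsub>?G\<^esub> g) ` V = f ` (g ` V)" if "f \<in> carrier ?G" "g \<in> carrier ?G" "V \<in> X" for f g V
      using act_mult[OF _ _ XS[OF that(3)], of f g] that(1,2) by simp
    show "\<one>\<^bsub>?G\<^esub> ` V = V" if "V \<in> X" for V by (rule act_one[OF XS[OF that]])
    show "g = \<one>\<^bsub>?G\<^esub>" if "g \<in> carrier ?G" "\<And>V. V \<in> X \<Longrightarrow> g ` V = V" for g by (rule faithful[OF that])
  next
    fix h assume "h \<in> hom ?G (sym_group n)" "inj_on h (carrier ?G)"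
    then show thesis by (intro that) simp_all
  qed
qed

section \<open>Vertices, edges and faces of inscribed polytopes\<close>

lemma edge_of_linear_image:
  "linear f \<Longrightarrow> inj f \<Longrightarrow> (f ` e) edge_of (f ` S) \<longleftrightarrow> e edge_of (S :: 'a::euclidean_space set)"
  by (simp add: edge_of_def face_of_linear_image)

lemma facet_of_linear_image:
  "linear f \<Longrightarrow> inj f \<Longrightarrow> (f ` e) facet_of (f ` S) \<longleftrightarrow> e facet_of (S :: 'a::euclidean_space set)"
  by (simp add: facet_of_def face_of_linear_image)

lemma vertex_set_linear_image:
  assumes "linear f" "inj f" shows "vertex_set (f ` P) = f ` vertex_set P"
proof (intro equalityI subsetI)
  fix y assume y: "y \<in> vertex_set (f ` P)"
  then have "y \<in> f ` P" by (simp add: vertex_set_def extreme_point_of_def)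
  then obtain x where x: "y = f x" by blast
  have "(f ` {x}) face_of (f ` P)" using y x by (simp add: vertex_set_def face_of_singleton)
  then have "x extreme_point_of P" using face_of_linear_image[OF assms] face_of_singleton by metis
  then show "y \<in> f ` vertex_set P" using x by (simp add: vertex_set_def)
next
  fix y assume "y \<in> f ` vertex_set P"
  then obtain x where x: "y = f x" "{x} face_of P" by (auto simp: vertex_set_def face_of_singleton)
  then have "(f ` {x}) face_of (f ` P)" using face_of_linear_image[OF assms] by blast
  then show "y \<in> vertex_set (f ` P)" using x by (simp add: vertex_set_def face_of_singleton)
qed

lemma sgn_orthogonal:
  "orthogonal_transformation f \<Longrightarrow> sgn (f x) = f (sgn x)"
  by (simp add: sgn_div_norm orthogonal_transformation_norm orthogonal_transformation_scaleR)

lemma centroid_linear_image: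
  assumes "linear f" "inj f" shows "centroid (f ` A) = f (centroid A)"
proof -
  have inj: "inj_on f A" using assms(2) by (rule inj_on_subset) simp
  have "(\<Sum>v\<in>f ` A. v) = f (\<Sum>v\<in>A. v)"
    using sum.reindex[OF inj, of "\<lambda>v. v"] linear_sum[OF assms(1), of "\<lambda>v. v" A] by simp
  then show ?thesis using card_image[OF inj] linear_cmul[OF assms(1)] by (simp add: centroid_def)
qed

lemma face_points_orthogonal_image:
  assumes f: "orthogonal_transformation f" shows "face_points (f ` P) = f ` face_points P"
proof -
  have lin: "linear f" and inj: "inj f"
    using f by (simp_all add: orthogonal_transformation_linear orthogonal_transformation_inj)
  have point: "sgn (centroid (vertex_set (f ` A))) = f (sgn (centroid (vertex_set A)))" for A
    by (simp add: vertex_set_linear_image[OF lin inj] centroid_linear_image[OF lin inj] sgn_orthogonal[OF f])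
  show ?thesis
  proof (intro equalityI subsetI)
    fix y assume "y \<in> face_points (f ` P)"
    then obtain B where B: "y = sgn (centroid (vertex_set B))" "B facet_of (f ` P)" by (auto simp: face_points_def)
    have "B \<subseteq> f ` P" using B(2) by (rule facet_of_imp_subset)
    then obtain A where A: "B = f ` A" by (auto simp: subset_image_iff)
    then have "A facet_of P" using B(2) facet_of_linear_image[OF lin inj] by blast
    then have "sgn (centroid (vertex_set A)) \<in> face_points P" by (auto simp: face_points_def)
    then show "y \<in> f ` face_points P" unfolding B(1) A point by (rule imageI)
  next
    fix y assume "y \<in> f ` face_points P"
    then obtain A where A: "y = f (sgn (centroid (vertex_set A)))" "A facet_of P" by (auto simp: face_points_def)
    have "(f ` A) facet_of (f ` P)" using A(2) facet_of_linear_image[OF lin inj] by blast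
    then show "y \<in> face_points (f ` P)" unfolding A(1) point[symmetric] face_points_def by blast
  qed
qed

lemma edge_points_orthogonal_image:
  assumes f: "orthogonal_transformation f" shows "edge_points (f ` P) = f ` edge_points P"
proof -
  have lin: "linear f" and inj: "inj f"
    using f by (simp_all add: orthogonal_transformation_linear orthogonal_transformation_inj)
  have seg: "closed_segment (f a) (f b) = f ` closed_segment a b" for a b
    by (rule closed_segment_linear_image[OF lin])
  have edge: "closed_segment (f a) (f b) edge_of (f ` P) \<longleftrightarrow> closed_segment a b edge_of P" for a b
    unfolding seg by (rule edge_of_linear_image[OF lin inj])
  have point: "sgn (midpoint (f a) (f b)) = f (sgn (midpoint a b))" for a b
  proof -
    have "midpoint (f a) (f b) = f (midpoint a b)"
      by (simp add: midpoint_def linear_add[OF lin] linear_cmul[OF lin])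
    then show ?thesis by (simp add: sgn_orthogonal[OF f])
  qed
  have range: "\<exists>a. x = f a" for x using orthogonal_transformation_surj[OF f] by (auto simp: surj_def)
  show ?thesis
  proof (intro equalityI subsetI)
    fix y assume "y \<in> edge_points (f ` P)"
    then obtain a' b' where y: "y = sgn (midpoint a' b')" "closed_segment a' b' edge_of (f ` P)"
      by (auto simp: edge_points_def)
    obtain a where a: "a' = f a" using range[of a'] by blast
    obtain b where b: "b' = f b" using range[of b'] by blast
    note ab = a b
    have "closed_segment a b edge_of P" using y(2) edge ab by simp
    then have "sgn (midpoint a b) \<in> edge_points P" unfolding edge_points_def by blast
    then show "y \<in> f ` edge_points P" unfolding y(1) ab point by (rule imageI)
  next
    fix y assume "y \<in> f ` edge_points P"
    then obtain a b where y: "y = f (sgn (midpoint a b))" "closed_segment a b edge_of P"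
      by (auto simp: edge_points_def)
    then have "closed_segment (f a) (f b) edge_of (f ` P)" using edge by blast
    then have "sgn (midpoint (f a) (f b)) \<in> edge_points (f ` P)" unfolding edge_points_def by blast
    then show "y \<in> edge_points (f ` P)" unfolding y(1) point .
  qed
qed

text \<open>
  The tangent plane of the sphere at \<open>v\<close> meets the ball, and hence the polytope, only in \<open>v\<close>.
\<close>

lemma extreme_point_of_inscribed:
  fixes V :: "'a::euclidean_space set"
  assumes "V \<subseteq> sphere 0 1" shows "v extreme_point_of (convex hull V) \<longleftrightarrow> v \<in> V"
proof
  assume v: "v \<in> V"
  let ?P = "convex hull V"
  have sub: "?P \<subseteq> cball 0 1" by (rule hull_minimal) (use assms in auto)
  have nv: "norm v = 1" using assms v by auto
  have le: "v \<bullet> x \<le> 1" if "x \<in> ?P" for x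
    using norm_cauchy_schwarz[of v x] nv subsetD[OF sub that] by simp
  have "?P \<inter> {x. v \<bullet> x = 1} = {v}"
  proof (intro equalityI subsetI)
    fix x assume x: "x \<in> ?P \<inter> {x. v \<bullet> x = 1}"
    then have "norm x \<le> 1" using sub by auto
    then have "x \<bullet> x \<le> 1" by (simp add: dot_square_norm power_le_one)
    moreover have "v \<bullet> v = 1" using nv by (simp add: dot_square_norm)
    ultimately have "(x - v) \<bullet> (x - v) \<le> 0"
      using x by (simp add: inner_diff_left inner_diff_right inner_commute)
    then show "x \<in> {v}" by (simp add: inner_gt_zero_iff flip: not_less)
  next
    fix x assume "x \<in> {v}"
    then show "x \<in> ?P \<inter> {x. v \<bullet> x = 1}" using hull_subset[of V convex] v nv by (auto simp: dot_square_norm)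
  qed
  then have "{v} face_of ?P"
    using face_of_Int_supporting_hyperplane_le[OF convex_convex_hull le] by metis
  then show "v extreme_point_of ?P" by (simp add: face_of_singleton)
qed (rule extreme_point_of_convex_hull)

lemma vertex_set_inscribed: "V \<subseteq> S2 \<Longrightarrow> vertex_set (convex hull V) = V"
  using extreme_point_of_inscribed[of V] by (auto simp: vertex_set_def)

text \<open>
  A vertex \<open>v\<close> with exactly three edges, leading to the vertices \<open>n i\<close>. The \<open>l i\<close> form the basis
  dual to the edge vectors \<open>n i - v\<close>, and by \<open>cone\<close> the polytope lies in the cone with apex \<open>v\<close>
  spanned by the edge vectors. All faces through \<open>v\<close> can be determined from these data.
\<close>

locale simple_vertex =
  fixes V :: "(real^3) set" and v :: "real^3" and n l :: "nat \<Rightarrow> real^3"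
  assumes finite_V: "finite V" and V_S2: "V \<subseteq> S2" and v_V: "v \<in> V"
    and n_V: "\<And>i. i < 3 \<Longrightarrow> n i \<in> V"
    and dual: "\<And>i j. i < 3 \<Longrightarrow> j < 3 \<Longrightarrow> l i \<bullet> (n j - v) = (if i = j then 1 else 0)"
    and basis: "\<And>x. x = (\<Sum>i<3. (l i \<bullet> x) *\<^sub>R (n i - v))"
    and cone: "\<And>i w. i < 3 \<Longrightarrow> w \<in> V \<Longrightarrow> l i \<bullet> (w - v) \<ge> 0"
begin

abbreviation "P \<equiv> convex hull V"

lemma V_P: "V \<subseteq> P" by (rule hull_subset)

lemma extreme_iff: "w extreme_point_of P \<longleftrightarrow> w \<in> V"
  by (rule extreme_point_of_inscribed[OF V_S2])

lemma n_neq: "i < 3 \<Longrightarrow> n i \<noteq> v"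
  using dual[of i i] by auto

lemma faces_exposed:
  assumes "A face_of P" "v \<in> A"
  obtains c where "\<And>x. x \<in> P \<Longrightarrow> c \<bullet> (x - v) \<le> 0" "\<And>x. x \<in> P \<Longrightarrow> x \<in> A \<longleftrightarrow> c \<bullet> (x - v) = 0"
proof -
  have "A exposed_face_of P"
    using exposed_face_of_polyhedron[OF polyhedron_convex_hull[OF finite_V]] assms(1) by blast
  then obtain c d where c: "P \<subseteq> {x. c \<bullet> x \<le> d}" "A = P \<inter> {x. c \<bullet> x = d}"
    by (auto simp: exposed_face_of_def)
  have d: "c \<bullet> v = d" using c(2) assms(2) by blast
  show thesis
    by (rule that[of c]) (use c d in \<open>auto simp: inner_diff_right\<close>)
qed

text \<open>
  Expanding \<open>w - v\<close> in the edge vectors writes \<open>c \<bullet> (w - v)\<close> as a sum of nonpositive terms. So a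
  vertex lies on the face exposed by \<open>c\<close> iff it uses only edge vectors that lie on that face.
\<close>

lemma vertices_of_face:
  assumes c: "\<And>x. x \<in> P \<Longrightarrow> c \<bullet> (x - v) \<le> 0" and w: "w \<in> V"
  shows "c \<bullet> (w - v) = 0 \<longleftrightarrow> (\<forall>i<3. l i \<bullet> (w - v) = 0 \<or> c \<bullet> (n i - v) = 0)"
proof -
  have "c \<bullet> (w - v) = (\<Sum>i<3. (l i \<bullet> (w - v)) * (c \<bullet> (n i - v)))"
    by (subst basis[of "w - v"]) (simp add: inner_sum_right)
  moreover have "(l i \<bullet> (w - v)) * (c \<bullet> (n i - v)) \<le> 0" if "i < 3" for i
    using cone[OF that w] c[of "n i"] n_V[OF that] V_P by (intro mult_nonneg_nonpos) auto
  then have "(\<Sum>i<3. - ((l i \<bullet> (w - v)) * (c \<bullet> (n i - v)))) = 0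
      \<longleftrightarrow> (\<forall>i\<in>{..<3}. - ((l i \<bullet> (w - v)) * (c \<bullet> (n i - v))) = 0)"
    by (intro sum_nonneg_eq_0_iff) auto
  ultimately show ?thesis by (simp add: sum_negf Ball_def)
qed

text \<open>
  A line meets the sphere in at most two points.
\<close>

lemma ray_vertices:
  assumes "w \<in> V" "i < 3" "w = v + t *\<^sub>R (n i - v)" shows "w = v \<or> w = n i"
proof -
  have eq1: "v \<bullet> v = 1" "n i \<bullet> n i = 1" "w \<bullet> w = 1"
    using V_S2 v_V n_V[OF assms(2)] assms(1) by (auto simp: dot_square_norm)
  have "(n i - v) \<bullet> (n i - v) \<noteq> 0" using n_neq[OF assms(2)] by simp
  then have ne: "v \<bullet> n i \<noteq> 1" using eq1 by (simp add: inner_diff_left inner_diff_right inner_commute)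
  have "w \<bullet> w = 1 + 2 * (t * (v \<bullet> n i - 1)) + t * t * (2 - 2 * (v \<bullet> n i))"
    unfolding assms(3) using eq1(1,2)
    by (simp add: inner_add_left inner_add_right inner_diff_left inner_diff_right inner_commute algebra_simps)
  then have "2 * t * (t - 1) * (1 - v \<bullet> n i) = 0" using eq1(3) by (simp add: algebra_simps)
  then have "t = 0 \<or> t = 1" using ne by auto
  then show ?thesis using assms(3) by auto
qed

lemma edge_at_vertex:
  assumes "closed_segment v b edge_of P" obtains i where "i < 3" "b = n i"
proof -
  let ?e = "closed_segment v b"
  have face: "?e face_of P" and dim: "aff_dim ?e = 1" using assms by (simp_all add: edge_of_def)
  have "v \<noteq> b" using dim by auto
  have "b \<in> V" using extreme_point_of_face[OF face, of b] by (simp add: extreme_point_of_segment extreme_iff)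
  obtain c where c: "\<And>x. x \<in> P \<Longrightarrow> c \<bullet> (x - v) \<le> 0" "\<And>x. x \<in> P \<Longrightarrow> x \<in> ?e \<longleftrightarrow> c \<bullet> (x - v) = 0"
    by (rule faces_exposed[OF face]) auto
  have "c \<bullet> (b - v) = 0" using c(2)[of b] \<open>b \<in> V\<close> V_P by auto
  then have J: "\<And>i. i < 3 \<Longrightarrow> l i \<bullet> (b - v) = 0 \<or> c \<bullet> (n i - v) = 0"
    using vertices_of_face[OF c(1) \<open>b \<in> V\<close>] by blast
  have "\<exists>i<3. l i \<bullet> (b - v) \<noteq> 0"
  proof (rule ccontr)
    assume "\<not> (\<exists>i<3. l i \<bullet> (b - v) \<noteq> 0)"
    then have "b - v = 0" by (subst basis) simp
    with \<open>v \<noteq> b\<close> show False by simp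
  qed
  then obtain i where i: "i < 3" "c \<bullet> (n i - v) = 0" using J by blast
  have "n i \<in> ?e" using c(2)[of "n i"] i n_V V_P by blast
  moreover have "n i extreme_point_of P" using n_V[OF i(1)] by (simp add: extreme_iff)
  ultimately have "n i extreme_point_of ?e" using extreme_point_of_face[OF face] by blast
  then have "n i = b" using n_neq[OF i(1)] by (simp add: extreme_point_of_segment)
  with i(1) that show thesis by blast
qed

lemma face_eq_convex_hull: assumes "A face_of P" shows "A = convex hull (V \<inter> A)"
proof -
  have "compact P" using finite_V by (rule finite_imp_compact_convex_hull)
  then have "compact A" by (rule face_of_imp_compact[OF convex_convex_hull _ assms])
  then have "A = convex hull {x. x extreme_point_of A}"
    by (rule Krein_Milman_Minkowski[OF _ face_of_imp_convex[OF assms]])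
  also have "{x. x extreme_point_of A} = V \<inter> A"
    using extreme_point_of_face[OF assms] extreme_iff by auto
  finally show ?thesis .
qed

lemma vertex_set_face: "A face_of P \<Longrightarrow> vertex_set A = V \<inter> A"
  using extreme_point_of_face extreme_iff by (auto simp: vertex_set_def)

lemma cone_hull: assumes "x \<in> P" "i < 3" shows "l i \<bullet> (x - v) \<ge> 0"
proof -
  have "convex {x. l i \<bullet> x \<ge> l i \<bullet> v}" by (rule convex_halfspace_ge)
  moreover have "V \<subseteq> {x. l i \<bullet> x \<ge> l i \<bullet> v}" using cone[OF assms(2)] by (auto simp: inner_diff_right)
  ultimately have "P \<subseteq> {x. l i \<bullet> x \<ge> l i \<bullet> v}" by (intro hull_minimal)
  then show ?thesis using assms(1) by (auto simp: inner_diff_right)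
qed

text \<open>
  The sum of the other two dual vectors is nonnegative on the polytope, and on the vertices it
  vanishes only along the ray through \<open>n i\<close>.
\<close>

lemma edge_exists: assumes i: "i < 3" shows "closed_segment v (n i) edge_of P"
proof -
  define c where "c = (\<Sum>j\<in>{..<3} - {i}. l j)"
  have c: "c \<bullet> (x - v) = (\<Sum>j\<in>{..<3} - {i}. l j \<bullet> (x - v))" for x by (simp add: c_def inner_sum_left)
  have ge: "c \<bullet> (x - v) \<ge> 0" if "x \<in> P" for x
    unfolding c by (rule sum_nonneg) (use cone_hull[OF that] in auto)
  define A where "A = P \<inter> {x. c \<bullet> x = c \<bullet> v}"
  have A: "A face_of P"
    unfolding A_def by (rule face_of_Int_supporting_hyperplane_ge) (use ge in \<open>auto simp: inner_diff_right\<close>)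
  have "V \<inter> A = {v, n i}"
  proof (intro equalityI subsetI)
    fix w assume w: "w \<in> V \<inter> A"
    then have wV: "w \<in> V" and "c \<bullet> (w - v) = 0" by (auto simp: A_def inner_diff_right)
    then have "\<forall>j\<in>{..<3} - {i}. l j \<bullet> (w - v) = 0"
      unfolding c using cone[OF _ wV] by (subst (asm) sum_nonneg_eq_0_iff) auto
    then have "(\<Sum>j<3. (l j \<bullet> (w - v)) *\<^sub>R (n j - v)) = (l i \<bullet> (w - v)) *\<^sub>R (n i - v)"
      using i by (subst sum.remove[of _ i]) auto
    then have "w - v = (l i \<bullet> (w - v)) *\<^sub>R (n i - v)" by (rule trans[OF basis])
    then have "w = v + (l i \<bullet> (w - v)) *\<^sub>R (n i - v)" by (metis add.commute diff_add_cancel)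
    then show "w \<in> {v, n i}" using ray_vertices[OF wV i] by blast
  next
    fix w assume "w \<in> {v, n i}"
    moreover have "c \<bullet> (n i - v) = 0" unfolding c using dual[OF _ i] by auto
    ultimately show "w \<in> V \<inter> A"
      using v_V n_V[OF i] V_P by (auto simp: A_def inner_diff_right)
  qed
  then have "convex hull (V \<inter> A) = closed_segment v (n i)" by (simp only: segment_convex_hull)
  then have "A = closed_segment v (n i)" by (rule trans[OF face_eq_convex_hull[OF A]])
  moreover have "aff_dim (closed_segment v (n i)) = 1"
    using n_neq[OF i] by (simp add: segment_convex_hull aff_dim_convex_hull)
  ultimately show ?thesis using A by (simp add: edge_of_def)
qed

lemma aff_dim_3I: assumes "insert v (n ` {..<3}) \<subseteq> S" shows "aff_dim S = 3"
proof -
  have "x \<in> affine hull (insert v (n ` {..<3}))" for x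
  proof -
    have "(\<Sum>i<3. (l i \<bullet> (x - v)) *\<^sub>R (n i - v)) \<in> span ((\<lambda>y. - v + y) ` n ` {..<3})"
      by (intro span_sum span_scale span_base) auto
    then have "- v + x \<in> span ((\<lambda>y. - v + y) ` n ` {..<3})" using basis[of "x - v"] by simp
    then show ?thesis unfolding affine_hull_insert_span_gen by (rule rev_image_eqI) simp
  qed
  then have "affine hull S = UNIV" using hull_mono[OF assms, of affine] by blast
  then show ?thesis using aff_dim_affine_hull[of S] by simp
qed

lemma aff_dim_P: "aff_dim P = 3"
  by (rule aff_dim_3I) (use v_V n_V V_P in auto)

text \<open>
  The vertices of the facet spanned by the two edges at \<open>v\<close> other than the edge to \<open>n i\<close> (see
  \<open>facet_at_vertex\<close> and \<open>facet_exists\<close>).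
\<close>

definition fan :: "nat \<Rightarrow> (real^3) set" where
  "fan i = {w \<in> V. l i \<bullet> (w - v) = 0}"

text \<open>
  Let \<open>J\<close> index the edges at \<open>v\<close> that do not lie on the facet. If \<open>J\<close> were empty, the facet would be
  the whole polytope, and if it had two elements, the facet would lie in a line.
\<close>

lemma facet_at_vertex:
  assumes A: "A facet_of P" and "v \<in> A" obtains i where "i < 3" "vertex_set A = fan i"
proof -
  have face: "A face_of P" and dim: "aff_dim A = 2" using A by (simp_all add: facet_of_def aff_dim_P)
  obtain c where c: "\<And>x. x \<in> P \<Longrightarrow> c \<bullet> (x - v) \<le> 0" "\<And>x. x \<in> P \<Longrightarrow> x \<in> A \<longleftrightarrow> c \<bullet> (x - v) = 0"
    by (rule faces_exposed[OF face \<open>v \<in> A\<close>]) auto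
  define J where "J = {i \<in> {..<3}. c \<bullet> (n i - v) \<noteq> 0}"
  have VA: "w \<in> V \<inter> A \<longleftrightarrow> w \<in> V \<and> (\<forall>i\<in>J. l i \<bullet> (w - v) = 0)" for w
    using c(2)[of w] vertices_of_face[OF c(1), of w] V_P by (auto simp: J_def)
  have "J \<noteq> {}"
  proof
    assume "J = {}"
    then have "V \<inter> A = V" using VA by blast
    then have "convex hull (V \<inter> A) = P" by (rule arg_cong)
    then have "A = P" by (rule trans[OF face_eq_convex_hull[OF face]])
    with dim aff_dim_P show False by simp
  qed
  then obtain i where i: "i \<in> J" by blast
  have i3: "i < 3" using i by (simp add: J_def)
  have "J = {i}"
  proof (rule ccontr)
    assume "J \<noteq> {i}"
    then obtain j where j: "j \<in> J" "j \<noteq> i" using i by blast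
    have j3: "j < 3" using j by (simp add: J_def)
    have three: "{..<3::nat} = {0, 1, 2}" by auto
    have "i = 0 \<or> i = 1 \<or> i = 2" "j = 0 \<or> j = 1 \<or> j = 2" using i3 j3 by linarith+
    then have "\<exists>k. k < 3 \<and> k \<noteq> i \<and> k \<noteq> j \<and> {..<3} = {i, j, k}"
      using j(2) unfolding three by (intro exI[of _ "3 - i - j"]) (elim disjE; simp add: insert_commute)
    \<comment> \<open>Then only the edge to \<open>n k\<close> can lie on the facet.\<close>
    then obtain k where k: "k < 3" "k \<noteq> i" "k \<noteq> j" and k3: "{..<3} = {i, j, k}" by blast
    have "V \<inter> A \<subseteq> affine hull {v, n k}"
    proof
      fix w assume w: "w \<in> V \<inter> A"
      then have "l i \<bullet> (w - v) = 0" "l j \<bullet> (w - v) = 0" using VA i j by blast+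
      then have "w - v = (l k \<bullet> (w - v)) *\<^sub>R (n k - v)"
        using j(2) k(2,3) by (intro trans[OF basis[of "w - v"]]) (simp add: k3)
      then obtain t where "w - v = t *\<^sub>R (n k - v)" by (rule that)
      then have "w = v + t *\<^sub>R (n k - v)" by (metis add.commute diff_add_cancel)
      also have "\<dots> = (1 - t) *\<^sub>R v + t *\<^sub>R n k"
        by (simp only: scaleR_diff_left scaleR_diff_right scaleR_one) simp
      finally have "w = (1 - t) *\<^sub>R v + t *\<^sub>R n k" .
      then show "w \<in> affine hull {v, n k}"
        unfolding affine_hull_2 by (intro CollectI exI[of _ "1 - t"] exI[of _ t]) simp
    qed
    then have "aff_dim (V \<inter> A) \<le> aff_dim {v, n k}"
      using aff_dim_subset[of "V \<inter> A" "affine hull {v, n k}"] by (simp only: aff_dim_affine_hull)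
    also have "\<dots> \<le> 1" by simp
    also have "aff_dim (V \<inter> A) = aff_dim A"
      using arg_cong[OF face_eq_convex_hull[OF face], of aff_dim] by (simp only: aff_dim_convex_hull)
    finally have "aff_dim A \<le> 1" .
    with dim show False by simp
  qed
  then have "V \<inter> A = fan i" unfolding fan_def using VA by blast
  then have "vertex_set A = fan i" by (simp only: vertex_set_face[OF face])
  with i3 that show thesis by blast
qed

lemma facet_exists: assumes i: "i < 3" obtains A where "A facet_of P" "vertex_set A = fan i"
proof -
  define A where "A = P \<inter> {x. l i \<bullet> x = l i \<bullet> v}"
  have A: "A face_of P"
    unfolding A_def by (rule face_of_Int_supporting_hyperplane_ge) (use cone_hull[OF _ i] in \<open>auto simp: inner_diff_right\<close>)
  have vs: "vertex_set A = fan i"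
    unfolding vertex_set_face[OF A] using V_P by (auto simp: A_def fan_def inner_diff_right)
  have inA: "v \<in> A" using v_V V_P by (auto simp: A_def)
  have njA: "n j \<in> A" if "j < 3" "j \<noteq> i" for j
    using dual[OF i that(1)] that n_V V_P by (auto simp: A_def inner_diff_right)
  have "n i \<notin> A" using dual[OF i i] by (simp add: A_def inner_diff_right)
  then have "A \<noteq> P" using n_V[OF i] V_P by blast
  then have "aff_dim A < 3" using face_of_aff_dim_lt[OF convex_convex_hull A] aff_dim_P by simp
  moreover have "aff_dim (insert (n i) A) = 3"
    by (rule aff_dim_3I) (use inA njA in auto)
  then have "aff_dim A \<ge> 2" using aff_dim_insert[of "n i" A] by (auto split: if_splits)
  ultimately have "A facet_of P" using A inA aff_dim_P by (auto simp: facet_of_def)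
  with vs that show thesis by blast
qed

end

text \<open>
  Rotations act transitively on the vertices, and \<open>C\<close> is a third of a turn about \<open>v\<close> that permutes
  the three edges at \<open>v\<close> cyclically.
\<close>

locale regular_solid = simple_vertex +
  fixes C :: "real^3 \<Rightarrow> real^3"
  assumes transitive: "\<And>w. w \<in> V \<Longrightarrow> \<exists>g\<in>rotations (convex hull V). g v = w"
    and C: "C \<in> rotations (convex hull V)" "C v = v" "C (n 0) = n 1" "C (n 1) = n 2" "C (n 2) = n 0"
begin

lemma rot: "g \<in> rotations P \<Longrightarrow> orthogonal_transformation g" "g \<in> rotations P \<Longrightarrow> g ` P = P"
  by (simp_all add: rotations_def)

lemma rot_V: "g \<in> rotations P \<Longrightarrow> g ` V = V"
proof -
  assume g: "g \<in> rotations P"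
  have "vertex_set (g ` P) = g ` vertex_set P"
    by (intro vertex_set_linear_image orthogonal_transformation_linear orthogonal_transformation_inj rot(1)[OF g])
  then show ?thesis by (simp add: rot(2)[OF g] vertex_set_inscribed[OF V_S2])
qed

lemma vertex_set_P: "vertex_set P = rot_orbit P v"
proof -
  have "V = rot_orbit P v"
  proof (intro equalityI subsetI)
    fix w assume "w \<in> V" then show "w \<in> rot_orbit P v" using transitive unfolding rot_orbit_def by blast
  next
    fix w assume "w \<in> rot_orbit P v"
    then obtain g where "g \<in> rotations P" "w = g v" unfolding rot_orbit_def by blast
    then show "w \<in> V" using rot_V v_V by blast
  qed
  then show ?thesis by (simp add: vertex_set_inscribed[OF V_S2])
qed

lemma rot_n: assumes i: "i < 3" obtains g where "g \<in> rotations P" "g v = v" "g (n 0) = n i"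
proof -
  have "i = 0 \<or> i = 1 \<or> i = 2" using i by linarith
  then show thesis
  proof (elim disjE)
    assume "i = 0" then show thesis using that[OF rotations_id] by simp
  next
    assume "i = 1" then show thesis using that[OF C(1)] C by simp
  next
    assume "i = 2" then show thesis using that[OF rotations_comp[OF C(1) C(1)]] C by simp
  qed
qed

lemma rot_inv:
  assumes "g \<in> rotations P"
  shows "\<exists>g'\<in>rotations P. (\<forall>x. g' (g x) = x) \<and> (\<forall>x. g (g' x) = x)"
  using orthogonal_inv_comp[OF rot(1)[OF assms]]
  by (intro bexI[OF _ rotations_inv[OF assms]]) (simp add: fun_eq_iff)

lemma C_dual: "l 1 \<bullet> C x = l 0 \<bullet> x" "l 2 \<bullet> C x = l 1 \<bullet> x"
proof -
  have lin: "linear C" using rot(1)[OF C(1)] by (rule orthogonal_transformation_linear)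
  have "x = (l 0 \<bullet> x) *\<^sub>R (n 0 - v) + (l 1 \<bullet> x) *\<^sub>R (n 1 - v) + (l 2 \<bullet> x) *\<^sub>R (n 2 - v)"
    by (subst basis) (simp add: eval_nat_numeral)
  then have "C x = C ((l 0 \<bullet> x) *\<^sub>R (n 0 - v) + (l 1 \<bullet> x) *\<^sub>R (n 1 - v) + (l 2 \<bullet> x) *\<^sub>R (n 2 - v))"
    by (rule arg_cong)
  also have "\<dots> = (l 0 \<bullet> x) *\<^sub>R (n 1 - v) + (l 1 \<bullet> x) *\<^sub>R (n 2 - v) + (l 2 \<bullet> x) *\<^sub>R (n 0 - v)"
    by (simp only: linear_add[OF lin] linear_cmul[OF lin] linear_diff[OF lin] C(2-5))
  finally have Cx: "C x = (l 0 \<bullet> x) *\<^sub>R (n 1 - v) + (l 1 \<bullet> x) *\<^sub>R (n 2 - v) + (l 2 \<bullet> x) *\<^sub>R (n 0 - v)" .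
  have add: "l i \<bullet> C x = (l 0 \<bullet> x) * (l i \<bullet> (n 1 - v)) + (l 1 \<bullet> x) * (l i \<bullet> (n 2 - v)) + (l 2 \<bullet> x) * (l i \<bullet> (n 0 - v))" for i
    unfolding Cx by (simp only: inner_add_right inner_scaleR_right)
  show "l 1 \<bullet> C x = l 0 \<bullet> x" "l 2 \<bullet> C x = l 1 \<bullet> x"
    unfolding add by (simp_all add: dual del: One_nat_def)
qed

lemma C_fan: "C ` fan 0 = fan 1" "C ` fan 1 = fan 2"
proof -
  have lin: "linear C" using rot(1)[OF C(1)] by (rule orthogonal_transformation_linear)
  have "C ` fan i = fan j" if dual: "\<And>x. l j \<bullet> C x = l i \<bullet> x" for i j
  proof -
    have iff: "l j \<bullet> (C w - v) = 0 \<longleftrightarrow> l i \<bullet> (w - v) = 0" for w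
      using dual[of "w - v"] by (simp only: linear_diff[OF lin] C(2))
    have "fan j = {w \<in> C ` V. l j \<bullet> (w - v) = 0}" by (simp only: fan_def rot_V[OF C(1)])
    also have "\<dots> = C ` fan i" unfolding fan_def using iff by blast
    finally show ?thesis by simp
  qed
  then show "C ` fan 0 = fan 1" "C ` fan 1 = fan 2" using C_dual by blast+
qed

lemma rot_fan: assumes i: "i < 3" shows "\<exists>k\<in>rotations P. k ` fan 0 = fan i"
proof -
  have "i = 0 \<or> i = 1 \<or> i = 2" using i by linarith
  then show ?thesis
  proof (elim disjE)
    assume "i = 0" then show ?thesis using rotations_id by (intro bexI[of _ id]) simp_all
  next
    assume "i = 1" then show ?thesis using C(1) C_fan(1) by (intro bexI[of _ C]) simp_all
  next
    assume i2: "i = 2"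
    have "(C \<circ> C) ` fan 0 = fan i" by (simp only: image_comp[symmetric] C_fan i2)
    then show ?thesis using rotations_comp[OF C(1) C(1)] by blast
  qed
qed

text \<open>
  A rotation moves an end of the given edge to \<open>v\<close>, and a power of \<open>C\<close> then moves the edge to the
  one leading to \<open>n 0\<close>.
\<close>

lemma edge_points_P: "edge_points P = rot_orbit P (sgn (midpoint v (n 0)))"
proof (intro equalityI subsetI)
  fix y assume "y \<in> edge_points P"
  then obtain a b where y: "y = sgn (midpoint a b)" "closed_segment a b edge_of P" by (auto simp: edge_points_def)
  have "a \<in> V"
    using extreme_point_of_face[of "closed_segment a b" P a] y(2)
    by (simp add: edge_of_def extreme_point_of_segment extreme_iff)
  then obtain g where g: "g \<in> rotations P" "g v = a" using transitive by blast
  obtain g' where g': "g' \<in> rotations P" "\<And>x. g' (g x) = x" "\<And>x. g (g' x) = x" using rot_inv[OF g(1)] by blast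
  have "closed_segment v (g' b) edge_of P"
  proof -
    have lin: "linear g" "inj g"
      using rot(1)[OF g(1)] by (simp_all add: orthogonal_transformation_linear orthogonal_transformation_inj)
    have "g ` closed_segment v (g' b) = closed_segment a b"
      using closed_segment_linear_image[OF lin(1), of v "g' b"] g(2) g'(3) by simp
    then show ?thesis using edge_of_linear_image[OF lin, of "closed_segment v (g' b)" P] y(2) rot(2)[OF g(1)] by simp
  qed
  then obtain i where i: "i < 3" "g' b = n i" by (rule edge_at_vertex)
  obtain k where k: "k \<in> rotations P" "k v = v" "k (n 0) = n i" by (rule rot_n[OF i(1)])
  have gk: "g \<circ> k \<in> rotations P" by (rule rotations_comp[OF g(1) k(1)])
  have lin: "linear (g \<circ> k)" using rot(1)[OF gk] by (rule orthogonal_transformation_linear)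
  have "(g \<circ> k) v = a" "(g \<circ> k) (n 0) = b" using g(2) k(2,3) i(2) g'(3)[of b] by simp_all
  then have "(g \<circ> k) (midpoint v (n 0)) = midpoint a b"
    by (simp only: midpoint_def linear_add[OF lin] linear_cmul[OF lin])
  then have "y = (g \<circ> k) (sgn (midpoint v (n 0)))" by (simp only: sgn_orthogonal[OF rot(1)[OF gk], symmetric] y(1))
  then show "y \<in> rot_orbit P (sgn (midpoint v (n 0)))" using gk unfolding rot_orbit_def by blast
next
  fix y assume "y \<in> rot_orbit P (sgn (midpoint v (n 0)))"
  then obtain g where g: "g \<in> rotations P" "y = g (sgn (midpoint v (n 0)))" by (auto simp: rot_orbit_def)
  have "sgn (midpoint v (n 0)) \<in> edge_points P" using edge_exists[of 0] unfolding edge_points_def by auto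
  then show "y \<in> edge_points P"
    using edge_points_orthogonal_image[OF rot(1)[OF g(1)], of P] rot(2)[OF g(1)] g(2) by auto
qed

text \<open>
  A rotation moves a vertex of the given facet to \<open>v\<close>, and a power of \<open>C\<close> then moves its vertices to
  \<open>fan 0\<close>.
\<close>

lemma face_points_P: "face_points P = rot_orbit P (sgn (centroid (fan 0)))"
proof (intro equalityI subsetI)
  fix y assume "y \<in> face_points P"
  then obtain A where y: "y = sgn (centroid (vertex_set A))" "A facet_of P" by (auto simp: face_points_def)
  have face: "A face_of P" "A \<noteq> {}" using y(2) by (simp_all add: facet_of_def)
  then have "V \<inter> A \<noteq> {}" using face_eq_convex_hull[OF face(1)] by auto
  then obtain a where a: "a \<in> V" "a \<in> A" by blast
  obtain g where g: "g \<in> rotations P" "g v = a" using transitive a(1) by blast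
  obtain g' where g': "g' \<in> rotations P" "\<And>x. g' (g x) = x" "\<And>x. g (g' x) = x" using rot_inv[OF g(1)] by blast
  have lin: "linear g" "inj g" "linear g'" "inj g'"
    using rot(1)[OF g(1)] rot(1)[OF g'(1)]
    by (simp_all add: orthogonal_transformation_linear orthogonal_transformation_inj)
  have "(g' ` A) facet_of P" using facet_of_linear_image[OF lin(3,4), of A P] y(2) rot(2)[OF g'(1)] by simp
  moreover have "v \<in> g' ` A" using a(2) g(2) g'(2) by (metis imageI)
  ultimately obtain i where i: "i < 3" "vertex_set (g' ` A) = fan i" by (rule facet_at_vertex)
  have "g ` fan i = vertex_set A"
  proof -
    have "g ` (g' ` A) = A" using g'(3) by (simp add: image_image)
    then show ?thesis using vertex_set_linear_image[OF lin(1,2), of "g' ` A"] i(2) by simp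
  qed
  obtain k where k: "k \<in> rotations P" "k ` fan 0 = fan i" using rot_fan[OF i(1)] by blast
  have gk: "g \<circ> k \<in> rotations P" by (rule rotations_comp[OF g(1) k(1)])
  have lin: "linear (g \<circ> k)" "inj (g \<circ> k)"
    using rot(1)[OF gk] by (simp_all add: orthogonal_transformation_linear orthogonal_transformation_inj)
  have "vertex_set A = (g \<circ> k) ` fan 0" by (simp only: image_comp[symmetric] k(2) \<open>g ` fan i = vertex_set A\<close>)
  then have "y = (g \<circ> k) (sgn (centroid (fan 0)))"
    by (simp only: y(1) centroid_linear_image[OF lin] sgn_orthogonal[OF rot(1)[OF gk]])
  then show "y \<in> rot_orbit P (sgn (centroid (fan 0)))" using gk unfolding rot_orbit_def by blast
next
  fix y assume "y \<in> rot_orbit P (sgn (centroid (fan 0)))"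
  then obtain g where g: "g \<in> rotations P" "y = g (sgn (centroid (fan 0)))" by (auto simp: rot_orbit_def)
  obtain B where B: "B facet_of P" "vertex_set B = fan 0" by (rule facet_exists[of 0]) auto
  then have "sgn (centroid (fan 0)) \<in> face_points P" unfolding face_points_def by (auto simp flip: B(2))
  then show "y \<in> face_points P"
    using face_points_orthogonal_image[OF rot(1)[OF g(1)], of P] rot(2)[OF g(1)] g(2) by auto
qed

end

section \<open>The cube and the dodecahedron\<close>

abbreviation vec3 :: "real \<Rightarrow> real \<Rightarrow> real \<Rightarrow> real^3" where
  "vec3 a b c \<equiv> vector [a, b, c]"

lemma vec3_eq_iff: "vec3 a b c = vec3 a' b' c' \<longleftrightarrow> a = a' \<and> b = b' \<and> c = c'"
  by (metis vector_3)

lemma vec3_ops: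
  "vec3 a b c + vec3 a' b' c' = vec3 (a + a') (b + b') (c + c')"
  "vec3 a b c - vec3 a' b' c' = vec3 (a - a') (b - b') (c - c')"
  "- vec3 a b c = vec3 (- a) (- b) (- c)"
  "r *\<^sub>R vec3 a b c = vec3 (r * a) (r * b) (r * c)"
  "vec3 a b c \<bullet> vec3 a' b' c' = a * a' + b * b' + c * c'"
  by (auto intro!: vec3_eqI simp: inner3)

lemma vec3_cases: obtains a b c where "x = vec3 a b c"
  by (rule that[of "x $ 1" "x $ 2" "x $ 3"]) (simp add: vec3_eqI)

text \<open>
  A third of a turn about the axis through \<open>(1, 1, 1)\<close>.
\<close>

definition cyc :: "real^3 \<Rightarrow> real^3" where
  "cyc x = vec3 (x $ 2) (x $ 3) (x $ 1)"

lemma cyc_vec3: "cyc (vec3 a b c) = vec3 b c a"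
  by (simp add: cyc_def)

lemma rotation_cyc: "rotation cyc"
proof -
  have "linear cyc" by (rule linearI) (simp_all add: cyc_def vec3_ops)
  then have "orthogonal_transformation cyc"
    by (simp add: orthogonal_transformation_def cyc_def inner3)
  moreover have "det (matrix cyc) = 1" by (simp add: det_3 matrix_def cyc_def axis_def)
  ultimately show ?thesis by (simp add: rotation_def)
qed

lemma half_turn_axes:
  "half_turn (vec3 1 0 0) (vec3 a b c) = vec3 a (- b) (- c)"
  "half_turn (vec3 0 1 0) (vec3 a b c) = vec3 (- a) b (- c)"
  "half_turn (vec3 0 0 1) (vec3 a b c) = vec3 (- a) (- b) c"
  by (simp_all add: half_turn_def vec3_ops vec3_eq_iff)

lemma norm_axes: "norm (vec3 1 0 0) = 1" "norm (vec3 0 1 0) = 1" "norm (vec3 0 0 1) = 1"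
  by (simp_all add: norm_eq_sqrt_inner vec3_ops)

text \<open>
  Both solids have simple coordinates on the sphere of radius \<open>sqrt 3\<close>; all computations are done
  there and then scaled down.
\<close>

definition inscribed :: "(real^3) set \<Rightarrow> (real^3) set" where
  "inscribed W = (\<lambda>w. w /\<^sub>R sqrt 3) ` W"

lemma inverse_sqrt_mult:
  "inverse (sqrt 3) * (inverse (sqrt 3) * x) = x / 3" "inverse (sqrt 2) * (inverse (sqrt 2) * x) = x / 2"
  "inverse (sqrt 2) * inverse (sqrt 2) = 1 / 2"
  by (simp_all add: field_simps)

lemma rotations_inscribedI:
  assumes g: "rotation g" and "finite W" "g ` W \<subseteq> W"
  shows "g \<in> rotations (convex hull (inscribed W))"
proof -
  have lin: "linear g" and inj: "inj g"
    using rotation_orthogonal[OF g]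
    by (simp_all add: orthogonal_transformation_linear orthogonal_transformation_inj)
  have "card (g ` W) = card W" by (rule card_image) (rule inj_on_subset[OF inj], simp)
  then have gW: "g ` W = W" by (rule card_subset_eq[OF assms(2,3)])
  have "g ` inscribed W = (\<lambda>w. w /\<^sub>R sqrt 3) ` (g ` W)"
    by (simp add: inscribed_def image_image linear_cmul[OF lin])
  also have "\<dots> = inscribed W" unfolding gW inscribed_def ..
  finally have "g ` (convex hull (inscribed W)) = convex hull (inscribed W)"
    using convex_hull_linear_image[OF lin, of "inscribed W"] by simp
  then show ?thesis using g by (simp add: rotations_iff)
qed

lemma regular_solid_inscribed:
  assumes "finite W" and norm: "\<And>w. w \<in> W \<Longrightarrow> w \<bullet> w = 3" and "v \<in> W" and "\<And>i. i < 3 \<Longrightarrow> n i \<in> W"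
    and dual: "\<And>i j. i < 3 \<Longrightarrow> j < 3 \<Longrightarrow> l i \<bullet> (n j - v) = (if i = j then 1 else 0)"
    and basis: "\<And>x. x = (\<Sum>i<3. (l i \<bullet> x) *\<^sub>R (n i - v))"
    and cone: "\<And>i w. i < 3 \<Longrightarrow> w \<in> W \<Longrightarrow> l i \<bullet> (w - v) \<ge> 0"
    and transitive: "\<And>w. w \<in> W \<Longrightarrow> \<exists>g\<in>rotations (convex hull (inscribed W)). g v = w"
    and C: "C \<in> rotations (convex hull (inscribed W))" "C v = v" "C (n 0) = n 1" "C (n 1) = n 2" "C (n 2) = n 0"
  shows "regular_solid (inscribed W) (v /\<^sub>R sqrt 3) (\<lambda>i. n i /\<^sub>R sqrt 3) (\<lambda>i. sqrt 3 *\<^sub>R l i) C"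
proof
  have diff: "a /\<^sub>R sqrt 3 - b /\<^sub>R sqrt 3 = (a - b) /\<^sub>R sqrt 3" for a b :: "real^3"
    by (simp only: scaleR_diff_right)
  have inner: "(sqrt 3 *\<^sub>R a) \<bullet> (b /\<^sub>R sqrt 3) = a \<bullet> b" for a b :: "real^3" by simp
  have C_lin: "linear C" using C(1) by (simp add: rotations_def orthogonal_transformation_linear)
  show "finite (inscribed W)" using assms(1) by (simp add: inscribed_def)
  show "inscribed W \<subseteq> S2"
  proof
    fix x assume "x \<in> inscribed W"
    then obtain w where "w \<in> W" "x = w /\<^sub>R sqrt 3" by (auto simp: inscribed_def)
    then show "x \<in> S2" using norm[of w] by (simp add: norm_eq_sqrt_inner inverse_sqrt_mult)
  qed
  show "v /\<^sub>R sqrt 3 \<in> inscribed W" using assms(3) by (simp add: inscribed_def)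
  show "n i /\<^sub>R sqrt 3 \<in> inscribed W" if "i < 3" for i using assms(4)[OF that] by (simp add: inscribed_def)
  show "(sqrt 3 *\<^sub>R l i) \<bullet> (n j /\<^sub>R sqrt 3 - v /\<^sub>R sqrt 3) = (if i = j then 1 else 0)" if "i < 3" "j < 3" for i j
    unfolding diff inner by (rule dual[OF that])
  show "x = (\<Sum>i<3. ((sqrt 3 *\<^sub>R l i) \<bullet> x) *\<^sub>R (n i /\<^sub>R sqrt 3 - v /\<^sub>R sqrt 3))" for x
  proof -
    have "((sqrt 3 *\<^sub>R a) \<bullet> x) *\<^sub>R (b /\<^sub>R sqrt 3) = (a \<bullet> x) *\<^sub>R b" for a b :: "real^3"
      by (simp add: field_simps)
    then show ?thesis unfolding diff using basis[of x] by (simp only:)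
  qed
  show "(sqrt 3 *\<^sub>R l i) \<bullet> (w - v /\<^sub>R sqrt 3) \<ge> 0" if i: "i < 3" and w: "w \<in> inscribed W" for i w
  proof -
    obtain w' where w': "w' \<in> W" "w = w' /\<^sub>R sqrt 3" using w by (auto simp: inscribed_def)
    show ?thesis unfolding w'(2) diff inner by (rule cone[OF i w'(1)])
  qed
  show "\<exists>g\<in>rotations (convex hull (inscribed W)). g (v /\<^sub>R sqrt 3) = w" if w: "w \<in> inscribed W" for w
  proof -
    obtain w' where w': "w' \<in> W" "w = w' /\<^sub>R sqrt 3" using w by (auto simp: inscribed_def)
    obtain g where g: "g \<in> rotations (convex hull (inscribed W))" "g v = w'" using transitive[OF w'(1)] by blast
    have "orthogonal_transformation g" using g(1) by (simp add: rotations_def)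
    then have "g (v /\<^sub>R sqrt 3) = w" using g(2) w'(2) by (simp add: orthogonal_transformation_scaleR)
    then show ?thesis using g(1) by blast
  qed
  show "C \<in> rotations (convex hull (inscribed W))" by (rule C(1))
  show "C (v /\<^sub>R sqrt 3) = v /\<^sub>R sqrt 3" "C (n 0 /\<^sub>R sqrt 3) = n 1 /\<^sub>R sqrt 3"
    "C (n 1 /\<^sub>R sqrt 3) = n 2 /\<^sub>R sqrt 3" "C (n 2 /\<^sub>R sqrt 3) = n 0 /\<^sub>R sqrt 3"
    by (simp_all only: linear_cmul[OF C_lin] C(2-5))
qed

subsection \<open>The cube\<close>

definition cube_vertices :: "(real^3) set" where
  "cube_vertices = {vec3 1 1 1, vec3 1 1 (-1), vec3 1 (-1) 1, vec3 1 (-1) (-1),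
     vec3 (-1) 1 1, vec3 (-1) 1 (-1), vec3 (-1) (-1) 1, vec3 (-1) (-1) (-1)}"

lemma std_cube_eq: "std_cube = convex hull (inscribed cube_vertices)"
proof -
  have "{vec3 s t u /\<^sub>R sqrt 3 | s t u. s \<in> signs \<and> t \<in> signs \<and> u \<in> signs} = inscribed cube_vertices"
  proof (intro equalityI subsetI)
    fix x assume "x \<in> {vec3 s t u /\<^sub>R sqrt 3 | s t u. s \<in> signs \<and> t \<in> signs \<and> u \<in> signs}"
    then obtain s t u where "x = vec3 s t u /\<^sub>R sqrt 3" "s \<in> {-1, 1}" "t \<in> {-1, 1}" "u \<in> {-1, 1}"
      unfolding signs_def by blast
    moreover have "vec3 s t u \<in> cube_vertices"
      using calculation(2-4) by (elim insertE emptyE) (simp_all add: cube_vertices_def)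
    ultimately show "x \<in> inscribed cube_vertices" by (simp add: inscribed_def)
  next
    have "\<exists>s t u. w = vec3 s t u \<and> s \<in> {-1, 1} \<and> t \<in> {-1, 1} \<and> u \<in> {-1, 1}" if "w \<in> cube_vertices" for w
      using that unfolding cube_vertices_def by (elim insertE emptyE) (simp_all add: vec3_eq_iff)
    moreover fix x assume "x \<in> inscribed cube_vertices"
    ultimately show "x \<in> {vec3 s t u /\<^sub>R sqrt 3 | s t u. s \<in> signs \<and> t \<in> signs \<and> u \<in> signs}"
      unfolding inscribed_def signs_def by blast
  qed
  then show ?thesis by (simp add: std_cube_def)
qed

lemma finite_cube_vertices: "finite cube_vertices"
  by (simp add: cube_vertices_def)

lemma card_cube_vertices: "card cube_vertices = 8"
  by (simp add: cube_vertices_def vec3_eq_iff)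

text \<open>
  An axis through the midpoints of two opposite edges; the half-turn about it exchanges \<open>(1, 1, 1)\<close>
  and its antipode.
\<close>

definition cube_axis :: "real^3" where
  "cube_axis = vec3 1 (-1) 0 /\<^sub>R sqrt 2"

lemma norm_cube_axis: "norm cube_axis = 1"
  by (simp add: cube_axis_def norm_eq_sqrt_inner vec3_ops inverse_sqrt_mult)

lemma half_turn_cube_axis: "half_turn cube_axis (vec3 a b c) = vec3 (- b) (- a) (- c)"
proof -
  have "(2 * (cube_axis \<bullet> vec3 a b c)) *\<^sub>R cube_axis = vec3 (a - b) (b - a) 0"
    by (simp add: cube_axis_def vec3_ops vec3_eq_iff) (simp add: field_simps)
  then show ?thesis by (simp add: half_turn_def vec3_ops vec3_eq_iff)
qed

lemma rotations_std_cube: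
  "half_turn (vec3 1 0 0) \<in> rotations std_cube" "half_turn (vec3 0 1 0) \<in> rotations std_cube"
  "half_turn (vec3 0 0 1) \<in> rotations std_cube" "cyc \<in> rotations std_cube" "half_turn cube_axis \<in> rotations std_cube"
  unfolding std_cube_eq
  by (intro rotations_inscribedI rotation_half_turn rotation_cyc norm_axes norm_cube_axis finite_cube_vertices;
    simp add: cube_vertices_def half_turn_axes cyc_vec3 half_turn_cube_axis)+

subsection \<open>The dodecahedron\<close>

lemma phi_mult: "phi * phi = phi + 1" "phi * (phi * x) = phi * x + x"
proof -
  show sq: "phi * phi = phi + 1" by (simp add: phi_def field_simps)
  have "phi * (phi * x) = (phi * phi) * x" by simp
  then show "phi * (phi * x) = phi * x + x" by (simp add: sq distrib_right)
qed

lemma phi_bounds: "phi > 3 / 2" "phi < 2"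
proof -
  have "2 < sqrt 5" by (rule real_less_rsqrt) simp
  moreover have "sqrt 5 < 3" by (rule real_less_lsqrt) simp_all
  ultimately show "phi > 3 / 2" "phi < 2" by (simp_all add: phi_def)
qed

lemma inverse_phi: "s / phi = s * (phi - 1)"
proof -
  have "s = (s * (phi - 1)) * phi" by (simp add: algebra_simps phi_mult)
  then have "s / phi = (s * (phi - 1)) * phi / phi" by (rule arg_cong)
  then show ?thesis using phi_bounds by simp
qed

text \<open>
  The golden ratio satisfies \<open>1 / phi = phi - 1\<close>, which turns all coordinates into polynomials in
  \<^const>\<open>phi\<close>.
\<close>

definition dodecahedron_vertices :: "(real^3) set" where
  "dodecahedron_vertices = cube_vertices \<union>
     {vec3 0 (phi - 1) phi, vec3 0 (phi - 1) (- phi), vec3 0 (1 - phi) phi, vec3 0 (1 - phi) (- phi),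
      vec3 (phi - 1) phi 0, vec3 (phi - 1) (- phi) 0, vec3 (1 - phi) phi 0, vec3 (1 - phi) (- phi) 0,
      vec3 phi 0 (phi - 1), vec3 phi 0 (1 - phi), vec3 (- phi) 0 (phi - 1), vec3 (- phi) 0 (1 - phi)}"

lemma std_dodecahedron_eq: "std_dodecahedron = convex hull (inscribed dodecahedron_vertices)"
proof -
  let ?A = "{vec3 s t u | s t u. s \<in> signs \<and> t \<in> signs \<and> u \<in> signs}"
  let ?B = "{vec3 0 (s / phi) (t * phi) | s t. s \<in> signs \<and> t \<in> signs}"
  let ?C = "{vec3 (s / phi) (t * phi) 0 | s t. s \<in> signs \<and> t \<in> signs}"
  let ?D = "{vec3 (t * phi) 0 (s / phi) | s t. s \<in> signs \<and> t \<in> signs}"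
  have signs2: "{f s t | s t. s \<in> signs \<and> t \<in> signs} = {f (-1) (-1), f (-1) 1, f 1 (-1), f 1 1}" for f :: "real \<Rightarrow> real \<Rightarrow> real^3"
    by (auto simp: signs_def)
  have signs3: "?A = cube_vertices"
    by (auto simp: signs_def cube_vertices_def vec3_eq_iff)
  have "?A \<union> ?B \<union> ?C \<union> ?D = dodecahedron_vertices"
    unfolding signs2 signs3 dodecahedron_vertices_def by (simp add: inverse_phi insert_commute Un_assoc)
  moreover have "std_dodecahedron = convex hull (inscribed (?A \<union> ?B \<union> ?C \<union> ?D))"
  proof -
    have "inscribed (?A \<union> ?B \<union> ?C \<union> ?D) = inscribed ?A \<union> inscribed ?B \<union> inscribed ?C \<union> inscribed ?D"
      by (simp only: inscribed_def image_Un)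
    moreover have "inscribed ?A = {vec3 s t u /\<^sub>R sqrt 3 | s t u. s \<in> signs \<and> t \<in> signs \<and> u \<in> signs}"
      "inscribed ?B = {vec3 0 (s / phi) (t * phi) /\<^sub>R sqrt 3 | s t. s \<in> signs \<and> t \<in> signs}"
      "inscribed ?C = {vec3 (s / phi) (t * phi) 0 /\<^sub>R sqrt 3 | s t. s \<in> signs \<and> t \<in> signs}"
      "inscribed ?D = {vec3 (t * phi) 0 (s / phi) /\<^sub>R sqrt 3 | s t. s \<in> signs \<and> t \<in> signs}"
      unfolding inscribed_def by blast+
    ultimately show ?thesis by (simp only: std_dodecahedron_def)
  qed
  ultimately show ?thesis by simp
qed

lemma finite_dodecahedron_vertices: "finite dodecahedron_vertices"
  by (simp add: dodecahedron_vertices_def finite_cube_vertices)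

lemma card_dodecahedron_vertices: "card dodecahedron_vertices = 20"
proof -
  have "phi \<noteq> 0" "phi \<noteq> 1" "phi \<noteq> 2" "phi \<noteq> -1" "- phi \<noteq> 1" "phi - 1 \<noteq> - phi" "1 - phi \<noteq> phi" "phi \<noteq> - phi" "phi - 1 \<noteq> 1 - phi"
    using phi_bounds by auto
  then show ?thesis
    by (simp add: dodecahedron_vertices_def cube_vertices_def vec3_eq_iff)
qed

text \<open>
  The axis through the midpoint of the edge from \<open>(1, 1, 1)\<close> to \<open>(0, phi - 1, phi)\<close>, whose ends are
  exchanged by the half-turn about it.
\<close>

definition dodecahedron_axis :: "real^3" where
  "dodecahedron_axis = vec3 ((phi - 1) / 2) (1 / 2) (phi / 2)"

lemma norm_dodecahedron_axis: "norm dodecahedron_axis = 1"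
proof -
  have "dodecahedron_axis \<bullet> dodecahedron_axis = 1"
    by (simp add: dodecahedron_axis_def vec3_ops field_simps phi_mult)
  then show ?thesis by (simp add: norm_eq_sqrt_inner)
qed

lemma half_turn_dodecahedron_axis:
  "half_turn dodecahedron_axis (vec3 a b c) = vec3 ((- (phi * a) + (phi * b - b) + c) / 2)
     ((phi * a - a - b + phi * c) / 2) ((a + phi * b + (phi * c - c)) / 2)"
  by (simp add: dodecahedron_axis_def half_turn_def vec3_ops vec3_eq_iff) (simp add: field_simps phi_mult)

lemma rotations_std_dodecahedron:
  "half_turn (vec3 1 0 0) \<in> rotations std_dodecahedron" "half_turn (vec3 0 1 0) \<in> rotations std_dodecahedron"
  "half_turn (vec3 0 0 1) \<in> rotations std_dodecahedron" "cyc \<in> rotations std_dodecahedron"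
  unfolding std_dodecahedron_eq
  by (intro rotations_inscribedI rotation_half_turn rotation_cyc norm_axes finite_dodecahedron_vertices;
    simp add: dodecahedron_vertices_def cube_vertices_def half_turn_axes cyc_vec3)+

lemma phi_halves: "(phi * 2 - 2) / 2 = phi - 1" "(2 - phi * 2) / 2 = 1 - phi"
  by simp_all

lemma half_turn_axis_std_dodecahedron: "half_turn dodecahedron_axis \<in> rotations std_dodecahedron"
  unfolding std_dodecahedron_eq
  by (intro rotations_inscribedI rotation_half_turn norm_dodecahedron_axis finite_dodecahedron_vertices)
    (simp add: dodecahedron_vertices_def cube_vertices_def half_turn_dodecahedron_axis algebra_simps phi_mult phi_halves)

subsection \<open>Regularity\<close>

lemma rot_orbit_self: "X \<in> rot_orbit P X"
  unfolding rot_orbit_def using rotations_id[of P] by (intro CollectI exI[of _ id]) simp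

lemma rot_orbit_step: "k \<in> rotations P \<Longrightarrow> w \<in> rot_orbit P X \<Longrightarrow> k w \<in> rot_orbit P X"
proof -
  assume k: "k \<in> rotations P" and "w \<in> rot_orbit P X"
  then obtain g where g: "g \<in> rotations P" "w = g X" unfolding rot_orbit_def by blast
  then have "k w = (k \<circ> g) X" by simp
  then show ?thesis unfolding rot_orbit_def using rotations_comp[OF k g(1)] by blast
qed

lemma less_3_cases: "i < 3 \<Longrightarrow> i = 0 \<or> i = 1 \<or> i = (2::nat)"
  by linarith

definition triple :: "'a \<Rightarrow> 'a \<Rightarrow> 'a \<Rightarrow> nat \<Rightarrow> 'a" where
  "triple a b c i = (if i = 0 then a else if i = 1 then b else c)"

lemma triple_simps: "triple a b c 0 = a" "triple a b c 1 = b" "triple a b c (Suc 0) = b" "triple a b c 2 = c"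
  by (simp_all add: triple_def)

lemma sum_less_3: "(\<Sum>i<3. f i) = f 0 + f 1 + f (2::nat)" for f :: "nat \<Rightarrow> 'a::comm_monoid_add"
  by (simp add: eval_nat_numeral)

text \<open>
  The neighbours of \<open>(1, 1, 1)\<close> are listed in the order in which \<^const>\<open>cyc\<close> permutes them. The dual
  vectors are the rows of the inverse of the matrix whose columns are the edge vectors.
\<close>

abbreviation "cube_n \<equiv> triple (vec3 (-1) 1 1) (vec3 1 1 (-1)) (vec3 1 (-1) 1)"
abbreviation "cube_l \<equiv> triple (vec3 (-1/2) 0 0) (vec3 0 0 (-1/2)) (vec3 0 (-1/2) 0)"

lemma cube_transitive:
  assumes "w \<in> cube_vertices" shows "w \<in> rot_orbit std_cube (vec3 1 1 1)"
proof -
  let ?O = "rot_orbit std_cube (vec3 1 1 1)"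
  have 1: "vec3 1 1 1 \<in> ?O" by (rule rot_orbit_self)
  have signs: "vec3 a (- b) (- c) \<in> ?O" "vec3 (- a) b (- c) \<in> ?O" "vec3 (- a) (- b) c \<in> ?O"
    "vec3 (- b) (- a) (- c) \<in> ?O" if "vec3 a b c \<in> ?O" for a b c
    using rot_orbit_step[OF rotations_std_cube(1) that] rot_orbit_step[OF rotations_std_cube(2) that]
      rot_orbit_step[OF rotations_std_cube(3) that] rot_orbit_step[OF rotations_std_cube(5) that]
    by (simp_all only: half_turn_axes half_turn_cube_axis)
  \<comment> \<open>The half-turns about the coordinate axes change an even number of signs, so the antipode of \<open>(1, 1, 1)\<close> gives the other half.\<close>
  have m: "vec3 (-1) (-1) (-1) \<in> ?O" using signs(4)[OF 1] by simp
  have "vec3 1 (-1) (-1) \<in> ?O" "vec3 (-1) 1 (-1) \<in> ?O" "vec3 (-1) (-1) 1 \<in> ?O"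
    "vec3 (-1) 1 1 \<in> ?O" "vec3 1 (-1) 1 \<in> ?O" "vec3 1 1 (-1) \<in> ?O"
    using signs[OF 1] signs[OF m] by simp_all
  with 1 m assms show ?thesis unfolding cube_vertices_def by (elim insertE emptyE) simp_all
qed

lemma regular_solid_cube:
  "regular_solid (inscribed cube_vertices) (vec3 1 1 1 /\<^sub>R sqrt 3) (\<lambda>i. cube_n i /\<^sub>R sqrt 3)
     (\<lambda>i. sqrt 3 *\<^sub>R cube_l i) cyc"
proof (rule regular_solid_inscribed)
  show "finite cube_vertices" by (rule finite_cube_vertices)
  show "w \<bullet> w = 3" if "w \<in> cube_vertices" for w
    using that unfolding cube_vertices_def by (elim insertE emptyE) (simp_all add: vec3_ops)
  show "vec3 1 1 1 \<in> cube_vertices" by (simp add: cube_vertices_def)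
  show "cube_n i \<in> cube_vertices" if "i < 3" for i
    using less_3_cases[OF that] by (elim disjE) (simp_all add: triple_simps cube_vertices_def)
  show "cube_l i \<bullet> (cube_n j - vec3 1 1 1) = (if i = j then 1 else 0)" if "i < 3" "j < 3" for i j
    using less_3_cases[OF that(1)] less_3_cases[OF that(2)]
    by (elim disjE) (simp_all add: triple_simps vec3_ops)
  show "x = (\<Sum>i<3. (cube_l i \<bullet> x) *\<^sub>R (cube_n i - vec3 1 1 1))" for x
    by (rule vec3_cases[of x]) (simp add: sum_less_3 triple_simps vec3_ops)
  show "cube_l i \<bullet> (w - vec3 1 1 1) \<ge> 0" if "i < 3" "w \<in> cube_vertices" for i w
    using less_3_cases[OF that(1)] that(2) unfolding cube_vertices_def
    by (elim disjE insertE emptyE) (simp_all add: triple_simps vec3_ops)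
  show "\<exists>g\<in>rotations (convex hull (inscribed cube_vertices)). g (vec3 1 1 1) = w" if "w \<in> cube_vertices" for w
    using cube_transitive[OF that] unfolding rot_orbit_def std_cube_eq by blast
  show "cyc \<in> rotations (convex hull (inscribed cube_vertices))"
    using rotations_std_cube(4) by (simp only: std_cube_eq)
qed (simp_all add: triple_simps cyc_vec3)

abbreviation "dodecahedron_n \<equiv> triple (vec3 0 (phi - 1) phi) (vec3 (phi - 1) phi 0) (vec3 phi 0 (phi - 1))"
abbreviation "dodecahedron_l \<equiv> triple (vec3 (- phi / 2) (-1/2) 0) (vec3 (-1/2) 0 (- phi / 2)) (vec3 0 (- phi / 2) (-1/2))"

lemma dodecahedron_transitive:
  assumes "w \<in> dodecahedron_vertices" shows "w \<in> rot_orbit std_dodecahedron (vec3 1 1 1)"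
proof -
  let ?O = "rot_orbit std_dodecahedron (vec3 1 1 1)"
  have 1: "vec3 1 1 1 \<in> ?O" by (rule rot_orbit_self)
  have signs: "vec3 a (- b) (- c) \<in> ?O" "vec3 (- a) b (- c) \<in> ?O" "vec3 (- a) (- b) c \<in> ?O"
    if "vec3 a b c \<in> ?O" for a b c
    using rot_orbit_step[OF rotations_std_dodecahedron(1) that] rot_orbit_step[OF rotations_std_dodecahedron(2) that]
      rot_orbit_step[OF rotations_std_dodecahedron(3) that] by (simp_all only: half_turn_axes)
  have cyc: "vec3 b c a \<in> ?O" if "vec3 a b c \<in> ?O" for a b c
    using rot_orbit_step[OF rotations_std_dodecahedron(4) that] by (simp only: cyc_vec3)
  have axis: "vec3 ((- (phi * a) + (phi * b - b) + c) / 2) ((phi * a - a - b + phi * c) / 2)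
      ((a + phi * b + (phi * c - c)) / 2) \<in> ?O" if "vec3 a b c \<in> ?O" for a b c
    using rot_orbit_step[OF half_turn_axis_std_dodecahedron that] by (simp only: half_turn_dodecahedron_axis)
  have n: "vec3 0 (phi - 1) phi \<in> ?O" using axis[OF 1] by (simp add: algebra_simps phi_halves)
  have n': "vec3 0 (1 - phi) (- phi) \<in> ?O" "vec3 0 (phi - 1) (- phi) \<in> ?O" "vec3 0 (1 - phi) phi \<in> ?O"
    using signs[OF n] by simp_all
  have c: "vec3 (phi - 1) phi 0 \<in> ?O" "vec3 (1 - phi) (- phi) 0 \<in> ?O" "vec3 (phi - 1) (- phi) 0 \<in> ?O"
    "vec3 (1 - phi) phi 0 \<in> ?O"
    using cyc[OF n] cyc[OF n'(1)] cyc[OF n'(2)] cyc[OF n'(3)] by simp_all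
  have d: "vec3 phi 0 (phi - 1) \<in> ?O" "vec3 (- phi) 0 (1 - phi) \<in> ?O" "vec3 (- phi) 0 (phi - 1) \<in> ?O"
    "vec3 phi 0 (1 - phi) \<in> ?O"
    using cyc[OF c(1)] cyc[OF c(2)] cyc[OF c(3)] cyc[OF c(4)] by simp_all
  \<comment> \<open>The vertices with a zero coordinate are reached; one of them leads to the other half of the cube.\<close>
  have m: "vec3 (-1) 1 1 \<in> ?O" using axis[OF d(1)] by (simp add: algebra_simps phi_mult)
  have "vec3 1 (-1) (-1) \<in> ?O" "vec3 (-1) 1 (-1) \<in> ?O" "vec3 (-1) (-1) 1 \<in> ?O"
    "vec3 (-1) (-1) (-1) \<in> ?O" "vec3 1 1 (-1) \<in> ?O" "vec3 1 (-1) 1 \<in> ?O"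
    using signs[OF 1] signs[OF m] by simp_all
  with 1 m n n' c d assms show ?thesis
    unfolding dodecahedron_vertices_def cube_vertices_def by (elim UnE insertE emptyE) simp_all
qed

lemma regular_solid_dodecahedron:
  "regular_solid (inscribed dodecahedron_vertices) (vec3 1 1 1 /\<^sub>R sqrt 3) (\<lambda>i. dodecahedron_n i /\<^sub>R sqrt 3)
     (\<lambda>i. sqrt 3 *\<^sub>R dodecahedron_l i) cyc"
proof (rule regular_solid_inscribed)
  show "finite dodecahedron_vertices" by (rule finite_dodecahedron_vertices)
  show "w \<bullet> w = 3" if "w \<in> dodecahedron_vertices" for w
    using that unfolding dodecahedron_vertices_def cube_vertices_def
    by (elim UnE insertE emptyE) (simp_all add: vec3_ops algebra_simps phi_mult)
  show "vec3 1 1 1 \<in> dodecahedron_vertices" by (simp add: dodecahedron_vertices_def cube_vertices_def)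
  show "dodecahedron_n i \<in> dodecahedron_vertices" if "i < 3" for i
    using less_3_cases[OF that] by (elim disjE) (simp_all add: triple_simps dodecahedron_vertices_def)
  show "dodecahedron_l i \<bullet> (dodecahedron_n j - vec3 1 1 1) = (if i = j then 1 else 0)" if "i < 3" "j < 3" for i j
    using less_3_cases[OF that(1)] less_3_cases[OF that(2)]
    by (elim disjE) (simp_all add: triple_simps vec3_ops field_simps phi_mult)
  show "x = (\<Sum>i<3. (dodecahedron_l i \<bullet> x) *\<^sub>R (dodecahedron_n i - vec3 1 1 1))" for x
    by (rule vec3_cases[of x]) (simp add: sum_less_3 triple_simps vec3_ops vec3_eq_iff field_simps phi_mult)
  show "dodecahedron_l i \<bullet> (w - vec3 1 1 1) \<ge> 0" if "i < 3" "w \<in> dodecahedron_vertices" for i w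
    using less_3_cases[OF that(1)] that(2) phi_bounds unfolding dodecahedron_vertices_def cube_vertices_def
    by (elim disjE UnE insertE emptyE) (simp_all add: triple_simps vec3_ops field_simps phi_mult)
  show "\<exists>g\<in>rotations (convex hull (inscribed dodecahedron_vertices)). g (vec3 1 1 1) = w"
    if "w \<in> dodecahedron_vertices" for w
    using dodecahedron_transitive[OF that] unfolding rot_orbit_def std_dodecahedron_eq by blast
  show "cyc \<in> rotations (convex hull (inscribed dodecahedron_vertices))"
    using rotations_std_dodecahedron(4) by (simp only: std_dodecahedron_eq)
qed (simp_all add: triple_simps cyc_vec3)

section \<open>The rotation groups of the cube and the dodecahedron\<close>

context regular_solid
begin

lemma finite_sphere_rotations: assumes "card V \<ge> 3" shows "finite (sphere_rotations P)"
proof (rule finite_subset[OF _ finite_moebius_fixing[OF V_S2 finite_V assms]])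
  show "sphere_rotations P \<subseteq> moebius_fixing V"
  proof
    fix a assume a: "a \<in> sphere_rotations P"
    then obtain f where f: "f \<in> rotations P" "a = restrict f S2" by (auto simp: sphere_rotations_def)
    have "a ` V = f ` V" unfolding f(2) by (rule image_cong[OF refl]) (use V_S2 in \<open>simp add: subset_iff\<close>)
    then show "a \<in> moebius_fixing V"
      using subsetD[OF sphere_rotations_subset a] rot_V[OF f(1)] by (simp add: moebius_fixing_def)
  qed
qed

text \<open>
  Whether a point is orthogonal to some vertex depends only on its orbit. The edge points are
  (witnessed by \<open>u\<close>); the vertices and the face points are not.
\<close>

lemma orbits_distinct:
  assumes e: "u \<in> V" "u \<bullet> (v + n 0) = 0"
    and v: "\<And>w. w \<in> V \<Longrightarrow> w \<bullet> v \<noteq> 0"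
    and f: "\<And>w. w \<in> V \<Longrightarrow> w \<bullet> centroid (fan 0) \<noteq> 0"
    and fv: "sgn (centroid (fan 0)) \<notin> V"
  shows "vertex_set P \<noteq> edge_points P" "face_points P \<noteq> edge_points P" "vertex_set P \<noteq> face_points P"
proof -
  define E where "E = sgn (midpoint v (n 0))"
  have uE: "u \<bullet> E = 0" using e(2) by (simp add: E_def sgn_div_norm midpoint_def)
  have key: "y \<notin> rot_orbit P x" if "\<And>w. w \<in> V \<Longrightarrow> w \<bullet> x \<noteq> 0" "u \<bullet> y = 0" for x y
  proof
    assume "y \<in> rot_orbit P x"
    then obtain g where g: "g \<in> rotations P" "y = g x" unfolding rot_orbit_def by blast
    have "u \<in> g ` V" using rot_V[OF g(1)] e(1) by simp
    then obtain w where w: "w \<in> V" "u = g w" by blast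
    have "u \<bullet> y = w \<bullet> x" using rot(1)[OF g(1)] w(2) g(2) by (simp add: orthogonal_transformation_def)
    with that(1)[OF w(1)] that(2) show False by simp
  qed
  have EE: "E \<in> edge_points P" unfolding edge_points_P E_def by (rule rot_orbit_self)
  have "E \<notin> vertex_set P" unfolding vertex_set_P by (rule key[OF v uE])
  with EE show "vertex_set P \<noteq> edge_points P" by blast
  have "w \<bullet> sgn (centroid (fan 0)) \<noteq> 0" if "w \<in> V" for w
  proof -
    have "centroid (fan 0) \<noteq> 0" using f[OF that] by auto
    then show ?thesis using f[OF that] by (simp add: sgn_div_norm)
  qed
  then have "E \<notin> face_points P" unfolding face_points_P by (rule key[OF _ uE])
  with EE show "face_points P \<noteq> edge_points P" by blast
  have "sgn (centroid (fan 0)) \<in> face_points P" unfolding face_points_P by (rule rot_orbit_self)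
  then show "vertex_set P \<noteq> face_points P" using fv vertex_set_inscribed[OF V_S2] by blast
qed

end

text \<open>
  The third of a turn \<^const>\<open>cyc\<close> and its conjugate by a half-turn about a coordinate axis; the squares
  of both are their inverses.
\<close>

lemma noncommuting_squares_rotations:
  assumes c: "cyc \<in> rotations P" and d: "half_turn (vec3 1 0 0) \<in> rotations P"
  shows "noncommuting_squares (sphere_group (sphere_rotations P))"
proof -
  let ?d = "half_turn (vec3 1 0 0)" and ?r = "\<lambda>f. restrict f S2"
  define b where "b = ?d \<circ> (cyc \<circ> ?d)"
  have b: "b \<in> rotations P" unfolding b_def by (intro rotations_comp c d)
  have rot: "rotation f" if "f \<in> rotations P" for f using that by (simp add: rotations_iff)
  have mult: "?r f \<otimes>\<^bsub>BijGroup S2\<^esub> ?r g = ?r (f \<circ> g)" if "f \<in> rotations P" "g \<in> rotations P" for f g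
    by (rule restrict_rotation_mult[OF rot[OF that(1)] rot[OF that(2)]])
  have cc: "cyc \<circ> cyc \<in> rotations P" and bb: "b \<circ> b \<in> rotations P" by (intro rotations_comp b c)+
  have b_vec3: "b (vec3 x y z) = vec3 (- y) z (- x)" for x y z
    by (simp add: b_def half_turn_axes cyc_vec3)
  have "vec3 0 1 0 \<in> S2" using norm_axes(2) by simp
  moreover have "((cyc \<circ> cyc) \<circ> (b \<circ> b)) (vec3 0 1 0) \<noteq> ((b \<circ> b) \<circ> (cyc \<circ> cyc)) (vec3 0 1 0)"
    by (simp add: b_vec3 cyc_vec3 vec3_eq_iff)
  ultimately have "?r ((cyc \<circ> cyc) \<circ> (b \<circ> b)) \<noteq> ?r ((b \<circ> b) \<circ> (cyc \<circ> cyc))"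
    by (metis restrict_apply')
  then have "(?r cyc \<otimes>\<^bsub>BijGroup S2\<^esub> ?r cyc) \<otimes>\<^bsub>BijGroup S2\<^esub> (?r b \<otimes>\<^bsub>BijGroup S2\<^esub> ?r b)
      \<noteq> (?r b \<otimes>\<^bsub>BijGroup S2\<^esub> ?r b) \<otimes>\<^bsub>BijGroup S2\<^esub> (?r cyc \<otimes>\<^bsub>BijGroup S2\<^esub> ?r cyc)"
    by (simp only: mult c b cc bb simp_thms)
  moreover have "?r cyc \<in> sphere_rotations P" "?r b \<in> sphere_rotations P"
    using b c by (simp_all add: sphere_rotations_def)
  ultimately show ?thesis
    unfolding noncommuting_squares_def by (intro bexI[of _ "?r cyc"] bexI[of _ "?r b"]) simp_all
qed

lemma card_inscribed: "card (inscribed W) = card W"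
  unfolding inscribed_def by (rule card_image) (simp add: inj_on_def)

text \<open>
  That a rotation group has only orbits of at least three points follows from two noncommuting
  squares, as for stabilizers. Together with the orbit formed by the vertices this determines its
  order.
\<close>

lemma rotation_action:
  assumes "regular_solid (inscribed W) v n l C" "card W \<ge> 3" "P = convex hull (inscribed W)"
    and "cyc \<in> rotations P" "half_turn (vec3 1 0 0) \<in> rotations P"
  shows "two_fixed_points_action (sphere_group (sphere_rotations P)) S2 (\<lambda>f. f)"
    and "finite (sphere_rotations P)"
    and "card (orbit (sphere_group (sphere_rotations P)) (\<lambda>f. f) v) = card W"
proof -
  interpret regular_solid "inscribed W" v n l C by (rule assms(1))
  show fin: "finite (sphere_rotations P)"
    using finite_sphere_rotations assms(2) card_inscribed assms(3) by simp
  show "two_fixed_points_action (sphere_group (sphere_rotations P)) S2 (\<lambda>f. f)"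
    by (rule moebius_group_two_fixed_points_action[OF sphere_rotations_subgroup fin sphere_rotations_subset
      noncommuting_squares_rotations[OF assms(4,5)]])
  have "v \<in> S2" using V_S2 v_V by blast
  then have "orbit (sphere_group (sphere_rotations P)) (\<lambda>f. f) v = rot_orbit P v" by (rule rot_orbit_eq[symmetric])
  also have "\<dots> = inscribed W" using vertex_set_P vertex_set_inscribed[OF V_S2] assms(3) by simp
  finally show "card (orbit (sphere_group (sphere_rotations P)) (\<lambda>f. f) v) = card W" by (simp add: card_inscribed)
qed

lemmas cube_action = rotation_action[OF regular_solid_cube _ std_cube_eq rotations_std_cube(4,1),
    unfolded card_cube_vertices, simplified]
lemmas dodecahedron_action = rotation_action[OF regular_solid_dodecahedron _ std_dodecahedron_eq
    rotations_std_dodecahedron(4,1), unfolded card_dodecahedron_vertices, simplified]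

lemma restrict_image: "W \<subseteq> E \<Longrightarrow> restrict f E ` W = f ` W"
  by (rule image_cong[OF refl]) (simp add: subset_iff)

abbreviation "corner \<equiv> vec3 1 1 1 /\<^sub>R sqrt 3"

lemma corner_S2: "corner \<in> S2"
  by (simp add: norm_eq_sqrt_inner vec3_ops inverse_sqrt_mult) (simp add: field_simps)

text \<open>
  In the list of possible orbit sizes, 8 occurs only for a group of order 24.
\<close>

lemma card_cube_rotations: "card (sphere_rotations std_cube) = 24"
proof -
  interpret two_fixed_points_action "sphere_group (sphere_rotations std_cube)" S2 "\<lambda>f. f" by (rule cube_action(1))
  show ?thesis using orbit_card_cases[OF corner_S2] cube_action(3) by (simp add: order_def)
qed

text \<open>
  In the list of possible orbit sizes, 20 occurs only for a group of order 60.
\<close>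

lemma card_dodecahedron_rotations: "card (sphere_rotations std_dodecahedron) = 60"
proof -
  interpret two_fixed_points_action "sphere_group (sphere_rotations std_dodecahedron)" S2 "\<lambda>f. f"
    by (rule dodecahedron_action(1))
  show ?thesis using orbit_card_cases[OF corner_S2] dodecahedron_action(3) by (simp add: order_def)
qed

text \<open>
  The block is a pair of opposite vertices, and its four translates are the diagonals of the cube.
  They are permuted faithfully by a group of order 24, which is therefore all of \<open>S\<^sub>4\<close>.
\<close>

theorem cube_rotations_iso: "sphere_group (sphere_rotations std_cube) \<cong> sym_group 4"
proof -
  let ?H = "sphere_rotations std_cube"
  interpret two_fixed_points_action "sphere_group ?H" S2 "\<lambda>f. f" by (rule cube_action(1))
  let ?r = "\<lambda>f. restrict f S2"
  define W where "W = {corner, - corner}"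
  have W: "W \<subseteq> S2" using corner_S2 by (simp add: W_def)
  have H: "?r f \<in> ?H" if "f \<in> rotations std_cube" for f using that by (simp add: sphere_rotations_def)
  have lin: "f (- x) = - f x" "f (c *\<^sub>R x) = c *\<^sub>R f x" if "f \<in> rotations std_cube" for f c x
  proof -
    have "linear f" using that by (simp add: rotations_def orthogonal_transformation_linear)
    then show "f (- x) = - f x" "f (c *\<^sub>R x) = c *\<^sub>R f x" by (rule linear_neg, rule linear_cmul)
  qed
  have corner_image: "f corner = f (vec3 1 1 1) /\<^sub>R sqrt 3" if "f \<in> rotations std_cube" for f
    by (rule lin(2)[OF that])
  have image: "?r f ` W = {f corner, - f corner}" if "f \<in> rotations std_cube" for f
    unfolding restrict_image[OF W] by (simp only: W_def image_insert image_empty lin(1)[OF that])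
  have hc: "half_turn cube_axis corner = - corner"
    unfolding corner_image[OF rotations_std_cube(5)] half_turn_cube_axis by (simp add: vec3_ops)
  have card_W: "card W = 2"
  proof -
    have "corner \<noteq> - corner" by (simp add: vec3_ops vec3_eq_iff)
    then show ?thesis by (simp add: W_def)
  qed
  have order: "order (sphere_group ?H) = 24" by (simp add: order_def card_cube_rotations)
  obtain h where "h \<in> hom (sphere_group ?H) (sym_group 4)" "inj_on h ?H"
  proof (rule block_action_embedding[OF sphere_rotations_subgroup cube_action(1) W])
    show "finite W" "corner \<in> W" by (simp_all add: W_def)
    show "card (orbit (sphere_group ?H) (\<lambda>f. f) corner) = 4 * card W"
      using cube_action(3) card_W by simp
    show "\<exists>g\<in>?H. g ` W = W \<and> g corner = y" if "y \<in> W" for y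
    proof -
      have "y = corner \<or> y = - corner" using that by (simp add: W_def)
      then show ?thesis
      proof
        assume y: "y = corner"
        have "?r id ` W = W" unfolding restrict_image[OF W] by simp
        moreover have "?r id corner = y" using corner_S2 y by (simp only: restrict_apply' id_apply)
        ultimately show ?thesis using H[OF rotations_id] by blast
      next
        assume y: "y = - corner"
        have "?r (half_turn cube_axis) ` W = W"
          unfolding image[OF rotations_std_cube(5)] hc by (simp add: W_def insert_commute)
        moreover have "?r (half_turn cube_axis) corner = y" using corner_S2 y hc by (simp only: restrict_apply')
        ultimately show ?thesis using H[OF rotations_std_cube(5)] by blast
      qed
    qed
    show "g ` W = W" if gH: "g \<in> ?H" and gc: "g corner = corner" for g
    proof -
      obtain f where f: "f \<in> rotations std_cube" "g = ?r f" using gH by (auto simp: sphere_rotations_def)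
      have "f corner = corner" using gc corner_S2 unfolding f(2) by (simp only: restrict_apply')
      then show ?thesis unfolding f(2) image[OF f(1)] by (simp only: W_def)
    qed
    \<comment> \<open>The turn about the diagonal through \<open>corner\<close> preserves it and moves another diagonal.\<close>
    show "?r cyc \<in> ?H" "?r (half_turn (vec3 1 0 0)) \<in> ?H" by (intro H rotations_std_cube)+
    have cc: "cyc corner = corner"
      unfolding corner_image[OF rotations_std_cube(4)] by (simp add: cyc_vec3)
    show "?r cyc ` W = W" unfolding image[OF rotations_std_cube(4)] cc by (simp add: W_def)
    have dW: "?r (half_turn (vec3 1 0 0)) ` W = {vec3 1 (-1) (-1) /\<^sub>R sqrt 3, - (vec3 1 (-1) (-1) /\<^sub>R sqrt 3)}"
      unfolding image[OF rotations_std_cube(1)] corner_image[OF rotations_std_cube(1)] half_turn_axes ..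
    have dW_S2: "{vec3 1 (-1) (-1) /\<^sub>R sqrt 3, - (vec3 1 (-1) (-1) /\<^sub>R sqrt 3)} \<subseteq> S2"
      by (simp add: norm_eq_sqrt_inner vec3_ops inverse_sqrt_mult) (simp add: field_simps)
    have "?r cyc ` ?r (half_turn (vec3 1 0 0)) ` W = {vec3 (-1) (-1) 1 /\<^sub>R sqrt 3, - (vec3 (-1) (-1) 1 /\<^sub>R sqrt 3)}"
      unfolding dW restrict_image[OF dW_S2]
      by (simp only: image_insert image_empty lin[OF rotations_std_cube(4)] cyc_vec3)
    then have in_cdW: "vec3 (-1) (-1) 1 /\<^sub>R sqrt 3 \<in> ?r cyc ` ?r (half_turn (vec3 1 0 0)) ` W" by (simp only: insert_iff simp_thms)
    have "vec3 (-1) (-1) 1 /\<^sub>R sqrt 3 \<notin> {vec3 1 (-1) (-1) /\<^sub>R sqrt 3, - (vec3 1 (-1) (-1) /\<^sub>R sqrt 3)}"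
      by (simp add: vec3_ops vec3_eq_iff)
    then have "vec3 (-1) (-1) 1 /\<^sub>R sqrt 3 \<notin> ?r (half_turn (vec3 1 0 0)) ` W" unfolding dW .
    with in_cdW show "?r cyc ` ?r (half_turn (vec3 1 0 0)) ` W \<noteq> ?r (half_turn (vec3 1 0 0)) ` W" by metis
    show "card ?H \<le> 4 * (card (orbit (sphere_group ?H) (\<lambda>f. f) y) + 1)" if "y \<in> S2" for y
      using orbit_card_cases[OF that] order card_cube_rotations by auto
  qed
  then show ?thesis
    by (intro embedding_iso_sym_group[OF group_G]) (simp_all add: order fact_numeral)
qed

text \<open>
  The block consists of the six unit vectors on the coordinate axes. They are edge points, whose
  orbit has \<open>30 = 5 * 6\<close> points, so there are five such frames. They are permuted faithfully by a
  group of order 60, which is therefore a subgroup of index two in \<open>S\<^sub>5\<close>.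
\<close>

theorem dodecahedron_rotations_iso: "sphere_group (sphere_rotations std_dodecahedron) \<cong> alt_group 5"
proof -
  let ?P = std_dodecahedron
  let ?H = "sphere_rotations ?P"
  let ?G = "sphere_group ?H"
  interpret two_fixed_points_action ?G S2 "\<lambda>f. f" by (rule dodecahedron_action(1))
  let ?r = "\<lambda>f. restrict f S2"
  let ?e = "vec3 1 0 0" and ?d = "half_turn (vec3 1 0 0)"
  define W where "W = {vec3 1 0 0, vec3 (-1) 0 0, vec3 0 1 0, vec3 0 (-1) 0, vec3 0 0 1, vec3 0 0 (-1)}"
  have W: "W \<subseteq> S2" unfolding W_def by (simp add: norm_eq_sqrt_inner vec3_ops)
  have e: "?e \<in> S2" using W by (simp only: W_def insert_subset)
  note rots = rotations_std_dodecahedron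
  have H: "?r f \<in> ?H" if "f \<in> rotations ?P" for f using that by (simp add: sphere_rotations_def)
  have order: "order ?G = 60" by (simp add: order_def card_dodecahedron_rotations)
  have card_W: "card W = 6" by (simp add: W_def vec3_eq_iff)
  have dW: "?r ?d ` W = W" and d2W: "?r (half_turn (vec3 0 1 0)) ` W = W" and cW: "?r cyc ` W = W"
    unfolding restrict_image[OF W] by (auto simp: W_def half_turn_axes cyc_vec3)
  define stab where "stab = stabilizer ?G (\<lambda>f. f) ?e"
  have one: "\<one>\<^bsub>?G\<^esub> \<in> stab" unfolding stab_def by (rule stabilizer_one_closed[OF e])
  have d_stab: "?r ?d \<in> stab"
    using H[OF rots(1)] e by (simp add: stab_def stabilizer_def half_turn_axes)
  have d_one: "?r ?d \<noteq> \<one>\<^bsub>?G\<^esub>"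
  proof
    assume "?r ?d = \<one>\<^bsub>?G\<^esub>"
    then have "?r ?d (vec3 0 1 0) = vec3 0 1 0" using W by (simp add: W_def BijGroup_def)
    then show False using W by (simp add: W_def half_turn_axes vec3_eq_iff)
  qed
  have os: "card (orbit ?G (\<lambda>f. f) ?e) * card stab = 60"
    using orbit_stabilizer_theorem[OF e] order by (simp add: stab_def)
  \<comment> \<open>The stabilizer of \<open>?e\<close> contains a half-turn. So its order is even, which leaves only 30 for the size of the orbit.\<close>
  have even: "2 dvd card stab"
  proof -
    interpret G: group ?G by (rule group_G)
    let ?S = "{\<one>\<^bsub>?G\<^esub>, ?r ?d}"
    have dd: "?r ?d \<otimes>\<^bsub>?G\<^esub> ?r ?d = \<one>\<^bsub>?G\<^esub>"
    proof -
      have rd: "rotation ?d" by (rule rotation_half_turn[OF norm_axes(1)])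
      have "?d \<circ> ?d = id" using half_turn_half_turn[OF norm_axes(1)] by (simp add: fun_eq_iff)
      then show ?thesis
        using restrict_rotation_mult[OF rd rd] by (simp add: BijGroup_def restrict_def id_def)
    qed
    have dG: "?r ?d \<in> carrier ?G" using H[OF rots(1)] by simp
    have inv: "inv\<^bsub>?G\<^esub> (?r ?d) = ?r ?d" by (rule G.inv_equality[OF dd dG dG])
    have S: "subgroup ?S ?G"
    proof (rule G.subgroupI)
      show "?S \<subseteq> carrier ?G" using dG G.one_closed by simp
      show "inv\<^bsub>?G\<^esub> a \<in> ?S" if "a \<in> ?S" for a
        using that inv G.inv_one by auto
      show "a \<otimes>\<^bsub>?G\<^esub> b \<in> ?S" if "a \<in> ?S" "b \<in> ?S" for a b
        using that dd G.l_one[OF dG] G.r_one[OF dG] G.l_one[OF G.one_closed] by (elim insertE emptyE) simp_all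
    qed simp
    have "subgroup ?S (BijGroup S2)" "subgroup stab (BijGroup S2)"
      using group.incl_subgroup[OF group_BijGroup sphere_rotations_subgroup] S stabilizer_subgroup[OF e]
      by (simp_all add: stab_def)
    then have "card ?S dvd card stab" using one d_stab by (intro card_dvd_of_subset) auto
    moreover have "card ?S = 2" using d_one by auto
    ultimately show ?thesis by simp
  qed
  have orbit_card: "card (orbit ?G (\<lambda>f. f) ?e) = 30"
  proof -
    consider "card (orbit ?G (\<lambda>f. f) ?e) = 60" | "card (orbit ?G (\<lambda>f. f) ?e) = 30"
      | "card (orbit ?G (\<lambda>f. f) ?e) = 20" | "card (orbit ?G (\<lambda>f. f) ?e) = 12"
      using orbit_card_cases[OF e] order by auto
    then show ?thesis
    proof cases
      case 1 with os have "card stab = 1" by simp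
      with even show ?thesis by simp
    next
      case 3 with os have "card stab = 3" by simp
      with even show ?thesis by simp
    next
      case 4 with os have "card stab = 5" by simp
      with even show ?thesis by simp
    qed
  qed
  then have "card stab = 2" using os by simp
  then have stab: "stab = {\<one>\<^bsub>?G\<^esub>, ?r ?d}"
    using one d_stab d_one by (intro card_subset_eq[symmetric]) (auto intro: card_ge_0_finite)
  have action_rotation: "\<exists>g\<in>?H. g ` W = W \<and> g ?e = f ?e" if "f \<in> rotations ?P" "?r f ` W = W" for f
  proof (rule bexI[OF _ H[OF that(1)]])
    show "?r f ` W = W \<and> ?r f ?e = f ?e" using that(2) e by (simp only: restrict_apply' simp_thms)
  qed
  have comp_W: "?r (f \<circ> g) ` W = W" if "?r f ` W = W" "?r g ` W = W" for f g
    using that unfolding restrict_image[OF W] image_comp[symmetric] by simp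
  obtain h where h: "h \<in> hom ?G (sym_group 5)" "inj_on h ?H"
  proof (rule block_action_embedding[OF sphere_rotations_subgroup dodecahedron_action(1) W])
    show "finite W" "?e \<in> W" by (simp_all add: W_def)
    show "card (orbit ?G (\<lambda>f. f) ?e) = 5 * card W" by (simp add: orbit_card card_W)
    show "\<exists>g\<in>?H. g ` W = W \<and> g ?e = y" if y: "y \<in> W" for y
    proof -
      let ?d2 = "half_turn (vec3 0 1 0)"
      have "?r id ` W = W" unfolding restrict_image[OF W] by simp
      note r = action_rotation[OF rotations_id this] action_rotation[OF rots(2) d2W]
        action_rotation[OF rots(4) cW]
        action_rotation[OF rotations_comp[OF rots(4) rots(2)] comp_W[OF cW d2W]]
        action_rotation[OF rotations_comp[OF rots(4) rots(4)] comp_W[OF cW cW]]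
        action_rotation[OF rotations_comp[OF rots(4) rotations_comp[OF rots(4) rots(2)]] comp_W[OF cW comp_W[OF cW d2W]]]
      have "?d2 ?e = vec3 (-1) 0 0" "cyc ?e = vec3 0 0 1" "(cyc \<circ> ?d2) ?e = vec3 0 0 (-1)"
        "(cyc \<circ> cyc) ?e = vec3 0 1 0" "(cyc \<circ> (cyc \<circ> ?d2)) ?e = vec3 0 (-1) 0"
        by (simp_all add: half_turn_axes cyc_vec3)
      note r' = r[unfolded this id_apply]
      have "y = ?e \<or> y = vec3 (-1) 0 0 \<or> y = vec3 0 1 0 \<or> y = vec3 0 (-1) 0 \<or> y = vec3 0 0 1 \<or> y = vec3 0 0 (-1)"
        using y by (simp only: W_def insert_iff empty_iff simp_thms)
      then show ?thesis using r' by (elim disjE) (simp_all only:)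
    qed
    show "g ` W = W" if "g \<in> ?H" "g ?e = ?e" for g
    proof -
      have "g \<in> stab" using that by (simp add: stab_def stabilizer_def)
      then have "g = \<one>\<^bsub>?G\<^esub> \<or> g = ?r ?d" by (simp add: stab)
      then show ?thesis
      proof
        assume "g = \<one>\<^bsub>?G\<^esub>"
        then have "g = ?r id" by (simp add: BijGroup_def restrict_def id_def)
        then show ?thesis using restrict_image[OF W, of id] by simp
      qed (simp only: dW)
    qed
    \<comment> \<open>The half-turn \<open>?d\<close> preserves the standard frame and moves its image under \<open>?u\<close>.\<close>
    let ?u = "half_turn dodecahedron_axis"
    show "?r ?d \<in> ?H" "?r ?u \<in> ?H" by (intro H rots(1) half_turn_axis_std_dodecahedron)+
    show "?r ?d ` W = W" by (rule dW)
    have uW: "?r ?u ` W = ?u ` W" by (rule restrict_image[OF W])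
    have "?u ` W \<subseteq> S2"
      using image_mono[OF W, of ?u] unfolding orthogonal_S2[OF orthogonal_half_turn[OF norm_dodecahedron_axis]] .
    then have duW: "?r ?d ` ?r ?u ` W = ?d ` ?u ` W" unfolding uW by (rule restrict_image)
    have "?d (?u ?e) \<in> ?d ` ?u ` W" by (intro imageI) (simp add: W_def)
    then have in_duW: "?d (?u ?e) \<in> ?r ?d ` ?r ?u ` W" unfolding duW .
    have "?d (?u ?e) \<notin> ?u ` W"
    proof
      assume "?d (?u ?e) \<in> ?u ` W"
      then show False
        unfolding W_def image_insert image_empty half_turn_dodecahedron_axis half_turn_axes insert_iff vec3_eq_iff
        using phi_bounds by (elim disjE conjE emptyE; simp; linarith)
    qed
    then have "?d (?u ?e) \<notin> ?r ?u ` W" unfolding uW .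
    with in_duW show "?r ?d ` ?r ?u ` W \<noteq> ?r ?u ` W" by metis
    show "card ?H \<le> 5 * (card (orbit ?G (\<lambda>f. f) y) + 1)" if "y \<in> S2" for y
      using orbit_card_cases[OF that] order card_dodecahedron_rotations by auto
  qed
  show ?thesis
    by (rule embedding_iso_alt_group[OF group_G h(1)]) (simp_all add: h(2) order fact_numeral)
qed

section \<open>The orbits of vertices, face points and edge points\<close>

text \<open>
  What the component index requires of the solid: the three special sets are three different orbits.
\<close>

definition solid_orbits :: "(real^3) set \<Rightarrow> bool" where
  "solid_orbits P \<longleftrightarrow> vertex_set P \<in> rot_orbits P \<and> face_points P \<in> rot_orbits P \<and> edge_points P \<in> rot_orbits P
     \<and> vertex_set P \<noteq> edge_points P \<and> face_points P \<noteq> edge_points P \<and> vertex_set P \<noteq> face_points P"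

lemma (in regular_solid) solid_orbits_P:
  assumes e: "u \<in> V" "u \<bullet> (v + n 0) = 0" "v + n 0 \<noteq> 0"
    and v: "\<And>w. w \<in> V \<Longrightarrow> w \<bullet> v \<noteq> 0"
    and f: "\<And>w. w \<in> V \<Longrightarrow> w \<bullet> centroid (fan 0) \<noteq> 0"
    and fv: "sgn (centroid (fan 0)) \<notin> V"
  shows "solid_orbits P"
proof -
  have orb: "rot_orbit P (sgn x) \<in> rot_orbits P" if "x \<noteq> 0" for x
    using that by (simp add: rot_orbits_def norm_sgn)
  have "centroid (fan 0) \<noteq> 0" using f[OF v_V] by auto
  moreover have "midpoint v (n 0) \<noteq> 0" using e(3) by (simp add: midpoint_def)
  moreover have "rot_orbit P v \<in> rot_orbits P" using V_S2 v_V by (auto simp: rot_orbits_def)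
  ultimately have "vertex_set P \<in> rot_orbits P" "face_points P \<in> rot_orbits P" "edge_points P \<in> rot_orbits P"
    unfolding vertex_set_P face_points_P edge_points_P using orb by simp_all
  then show ?thesis using orbits_distinct[OF e(1,2) v f fv] by (simp add: solid_orbits_def)
qed

text \<open>
  The hypotheses are stated for the coordinates before scaling. \<open>Z\<close> is the set of vertices of a
  facet, and the last hypothesis says that no vertex lies on the line through the origin and the
  centre of that facet.
\<close>

lemma solid_orbits_inscribed:
  assumes R: "regular_solid (inscribed W) (v /\<^sub>R sqrt 3) (\<lambda>i. n i /\<^sub>R sqrt 3) (\<lambda>i. sqrt 3 *\<^sub>R l i) C"
    and e: "u \<in> W" "u \<bullet> (v + n 0) = 0" "v + n 0 \<noteq> 0"
    and v: "\<And>w. w \<in> W \<Longrightarrow> w \<bullet> v \<noteq> 0"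
    and fan: "{w \<in> W. l 0 \<bullet> (w - v) = 0} = Z" "finite Z" "Z \<noteq> {}"
    and f: "\<And>w. w \<in> W \<Longrightarrow> w \<bullet> (\<Sum>z\<in>Z. z) \<noteq> 0"
    and fv: "\<And>w t. w \<in> W \<Longrightarrow> w \<noteq> t *\<^sub>R (\<Sum>z\<in>Z. z)"
  shows "solid_orbits (convex hull (inscribed W))"
proof -
  interpret regular_solid "inscribed W" "v /\<^sub>R sqrt 3" "\<lambda>i. n i /\<^sub>R sqrt 3" "\<lambda>i. sqrt 3 *\<^sub>R l i" C by (rule R)
  have fan0: "simple_vertex.fan (inscribed W) (v /\<^sub>R sqrt 3) (\<lambda>i. sqrt 3 *\<^sub>R l i) 0 = inscribed Z"
  proof -
    have iff: "(sqrt 3 *\<^sub>R l 0) \<bullet> (w /\<^sub>R sqrt 3 - v /\<^sub>R sqrt 3) = l 0 \<bullet> (w - v)" for w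
      by (simp only: scaleR_diff_right[symmetric]) simp
    have "fan 0 = {x \<in> inscribed W. (sqrt 3 *\<^sub>R l 0) \<bullet> (x - v /\<^sub>R sqrt 3) = 0}" by (rule fan_def)
    also have "\<dots> = (\<lambda>w. w /\<^sub>R sqrt 3) ` {w \<in> W. l 0 \<bullet> (w - v) = 0}"
    proof -
      have "{x \<in> h ` W. Q x} = h ` {w \<in> W. Q (h w)}" for h :: "real^3 \<Rightarrow> real^3" and Q by blast
      from this[of "\<lambda>w. w /\<^sub>R sqrt 3" "\<lambda>x. (sqrt 3 *\<^sub>R l 0) \<bullet> (x - v /\<^sub>R sqrt 3) = 0"]
      show ?thesis unfolding iff inscribed_def .
    qed
    finally show ?thesis unfolding fan(1) inscribed_def .
  qed
  define k where "k = inverse (real (card Z)) * inverse (sqrt 3)"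
  have k: "k > 0" using fan(2,3) by (simp add: k_def card_gt_0_iff)
  have c: "centroid (fan 0) = k *\<^sub>R (\<Sum>z\<in>Z. z)"
  proof -
    have "inj_on (\<lambda>w :: real^3. w /\<^sub>R sqrt 3) Z" by (simp add: inj_on_def)
    then have "(\<Sum>x\<in>inscribed Z. x) = (\<Sum>z\<in>Z. z /\<^sub>R sqrt 3)"
      unfolding inscribed_def by (subst sum.reindex) simp_all
    also have "\<dots> = (\<Sum>z\<in>Z. z) /\<^sub>R sqrt 3" by (simp only: scaleR_sum_right)
    finally show ?thesis unfolding fan0 centroid_def card_inscribed by (simp add: k_def)
  qed
  show ?thesis
  proof (rule solid_orbits_P)
    show "u /\<^sub>R sqrt 3 \<in> inscribed W" using e(1) by (simp add: inscribed_def)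
    have vn: "v /\<^sub>R sqrt 3 + n 0 /\<^sub>R sqrt 3 = (v + n 0) /\<^sub>R sqrt 3" by (simp only: scaleR_add_right)
    show "(u /\<^sub>R sqrt 3) \<bullet> (v /\<^sub>R sqrt 3 + n 0 /\<^sub>R sqrt 3) = 0" unfolding vn using e(2) by simp
    show "v /\<^sub>R sqrt 3 + n 0 /\<^sub>R sqrt 3 \<noteq> 0" unfolding vn using e(3) by simp
    fix w assume "w \<in> inscribed W"
    then obtain w' where w: "w' \<in> W" "w = w' /\<^sub>R sqrt 3" by (auto simp: inscribed_def)
    show "w \<bullet> (v /\<^sub>R sqrt 3) \<noteq> 0" using v[OF w(1)] by (simp add: w(2))
    show "w \<bullet> centroid (fan 0) \<noteq> 0" using f[OF w(1)] k by (simp add: w(2) c)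
  next
    show "sgn (centroid (fan 0)) \<notin> inscribed W"
    proof
      assume "sgn (centroid (fan 0)) \<in> inscribed W"
      then obtain w where w: "w \<in> W" "sgn (centroid (fan 0)) = w /\<^sub>R sqrt 3" by (auto simp: inscribed_def)
      have "w = sqrt 3 *\<^sub>R (w /\<^sub>R sqrt 3)" by simp
      also have "\<dots> = (sqrt 3 * (inverse (norm (centroid (fan 0))) * k)) *\<^sub>R (\<Sum>z\<in>Z. z)"
        unfolding w(2)[symmetric] sgn_div_norm by (simp add: c)
      finally show False using fv[OF w(1)] by blast
    qed
  qed
qed

lemma solid_orbits_std_cube: "solid_orbits std_cube"
proof -
  let ?Z = "{vec3 1 1 1, vec3 1 1 (-1), vec3 1 (-1) 1, vec3 1 (-1) (-1)}"
  have sum: "(\<Sum>z\<in>?Z. z) = vec3 4 0 0" by (simp add: vec3_eq_iff vec3_ops)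
  show ?thesis unfolding std_cube_eq
  proof (rule solid_orbits_inscribed[OF regular_solid_cube, where u = "vec3 1 1 (-1)" and Z = ?Z])
    show "vec3 1 1 (-1) \<in> cube_vertices" by (simp add: cube_vertices_def)
    show "vec3 1 1 (- 1) \<bullet> (vec3 1 1 1 + cube_n 0) = 0" by (simp add: triple_simps vec3_ops)
    show "vec3 1 1 1 + cube_n 0 \<noteq> 0"
    proof
      assume "vec3 1 1 1 + cube_n 0 = 0"
      then have "(vec3 1 1 1 + cube_n 0) $ 2 = 0" by simp
      then show False by (simp add: triple_simps)
    qed
    show "w \<bullet> vec3 1 1 1 \<noteq> 0" if "w \<in> cube_vertices" for w
      using that unfolding cube_vertices_def by (elim insertE emptyE) (simp_all add: vec3_ops)
    show "{w \<in> cube_vertices. cube_l 0 \<bullet> (w - vec3 1 1 1) = 0} = ?Z"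
    proof (intro equalityI subsetI)
      fix w assume "w \<in> {w \<in> cube_vertices. cube_l 0 \<bullet> (w - vec3 1 1 1) = 0}"
      then have "w \<in> cube_vertices" "cube_l 0 \<bullet> (w - vec3 1 1 1) = 0" by simp_all
      then show "w \<in> ?Z"
        unfolding cube_vertices_def by (elim insertE emptyE) (simp_all add: triple_simps vec3_ops)
    next
      fix w assume "w \<in> ?Z"
      then show "w \<in> {w \<in> cube_vertices. cube_l 0 \<bullet> (w - vec3 1 1 1) = 0}"
        by (elim insertE emptyE) (simp_all add: cube_vertices_def triple_simps vec3_ops)
    qed
    show "w \<bullet> (\<Sum>z\<in>?Z. z) \<noteq> 0" if "w \<in> cube_vertices" for w
      using that unfolding sum cube_vertices_def by (elim insertE emptyE) (simp_all add: vec3_ops)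
    show "w \<noteq> t *\<^sub>R (\<Sum>z\<in>?Z. z)" if "w \<in> cube_vertices" for w t
      using that unfolding sum cube_vertices_def by (elim insertE emptyE) (simp_all add: vec3_ops vec3_eq_iff)
  qed simp_all
qed

lemma solid_orbits_std_dodecahedron: "solid_orbits std_dodecahedron"
proof -
  let ?Z = "{vec3 1 1 1, vec3 1 1 (-1), vec3 (phi - 1) phi 0, vec3 phi 0 (phi - 1), vec3 phi 0 (1 - phi)}"
  have ne: "phi \<noteq> 0" "phi \<noteq> 1" "phi \<noteq> 2" "phi - 1 \<noteq> 1 - phi" using phi_bounds by auto
  have sum: "(\<Sum>z\<in>?Z. z) = vec3 (1 + 3 * phi) (2 + phi) 0"
    using ne by (simp add: vec3_eq_iff vec3_ops)
  note defs = dodecahedron_vertices_def cube_vertices_def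
  show ?thesis unfolding std_dodecahedron_eq
  proof (rule solid_orbits_inscribed[OF regular_solid_dodecahedron, where u = "vec3 1 1 (-1)" and Z = ?Z])
    show "vec3 1 1 (-1) \<in> dodecahedron_vertices" by (simp add: defs)
    show "vec3 1 1 (- 1) \<bullet> (vec3 1 1 1 + dodecahedron_n 0) = 0" by (simp add: triple_simps vec3_ops)
    show "vec3 1 1 1 + dodecahedron_n 0 \<noteq> 0"
    proof
      assume "vec3 1 1 1 + dodecahedron_n 0 = 0"
      then have "(vec3 1 1 1 + dodecahedron_n 0) $ 1 = 0" by simp
      then show False by (simp add: triple_simps)
    qed
    show "w \<bullet> vec3 1 1 1 \<noteq> 0" if "w \<in> dodecahedron_vertices" for w
      using that phi_bounds unfolding defs by (elim UnE insertE emptyE) (simp_all add: vec3_ops)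
    show "{w \<in> dodecahedron_vertices. dodecahedron_l 0 \<bullet> (w - vec3 1 1 1) = 0} = ?Z"
    proof (intro equalityI subsetI)
      fix w assume "w \<in> {w \<in> dodecahedron_vertices. dodecahedron_l 0 \<bullet> (w - vec3 1 1 1) = 0}"
      then have "w \<in> dodecahedron_vertices" "dodecahedron_l 0 \<bullet> (w - vec3 1 1 1) = 0" by simp_all
      then show "w \<in> ?Z"
        using phi_bounds unfolding defs
        by (elim UnE insertE emptyE) (simp_all add: triple_simps vec3_ops algebra_simps phi_mult)
    next
      fix w assume "w \<in> ?Z"
      then show "w \<in> {w \<in> dodecahedron_vertices. dodecahedron_l 0 \<bullet> (w - vec3 1 1 1) = 0}"
        by (elim insertE emptyE) (simp_all add: defs triple_simps vec3_ops field_simps phi_mult)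
    qed
    show "w \<bullet> (\<Sum>z\<in>?Z. z) \<noteq> 0" if "w \<in> dodecahedron_vertices" for w
      using that phi_bounds unfolding sum defs
      by (elim UnE insertE emptyE) (simp_all add: vec3_ops algebra_simps phi_mult)
    show "w \<noteq> t *\<^sub>R (\<Sum>z\<in>?Z. z)" if w: "w \<in> dodecahedron_vertices" for w t
    proof
      assume "w = t *\<^sub>R (\<Sum>z\<in>?Z. z)"
      then have "w $ 3 = 0" "w $ 1 * (2 + phi) = w $ 2 * (1 + 3 * phi)"
        unfolding sum by (simp_all add: algebra_simps)
      with w phi_bounds show False
        unfolding defs by (elim UnE insertE emptyE) (simp_all add: algebra_simps phi_mult)
    qed
  qed simp_all
qed

section \<open>Arbitrary position and the component index\<close>

text \<open>
  Conjugation preserves the determinant, even if \<open>f\<close> reverses the orientation.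
\<close>

lemma conj_rotation:
  assumes f: "orthogonal_transformation f" and g: "rotation g"
  shows "rotation (f \<circ> g \<circ> Hilbert_Choice.inv f)"
proof -
  let ?f' = "Hilbert_Choice.inv f"
  have f': "orthogonal_transformation ?f'" by (rule orthogonal_transformation_inv[OF f])
  have g': "orthogonal_transformation g" "det (matrix g) = 1" using g by (simp_all add: rotation_def)
  have fg: "orthogonal_transformation (f \<circ> g)" by (rule orthogonal_transformation_comp[OF f g'(1)])
  have "det (matrix (f \<circ> g \<circ> ?f')) = det (matrix f) * det (matrix g) * det (matrix ?f')"
    by (simp only: det_matrix_comp orthogonal_transformation_linear f f' g'(1) fg)
  also have "\<dots> = 1" using det_inv_orthogonal[OF f] g'(2) by (simp add: mult.commute)
  finally show ?thesis using orthogonal_transformation_comp[OF fg f'] by (simp add: rotation_def)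
qed

lemma rotations_orthogonal_image:
  assumes f: "orthogonal_transformation f"
  shows "rotations (f ` P) = (\<lambda>g. f \<circ> g \<circ> Hilbert_Choice.inv f) ` rotations P"
proof -
  let ?f' = "Hilbert_Choice.inv f"
  have ff': "?f' (f x) = x" "f (?f' x) = x" for x
    using orthogonal_inv_comp[OF f] by (simp_all add: fun_eq_iff)
  have f': "orthogonal_transformation ?f'" by (rule orthogonal_transformation_inv[OF f])
  have inv_f': "Hilbert_Choice.inv ?f' = f"
    by (rule inv_inv_eq) (rule orthogonal_transformation_bij[OF f])
  have f'fP: "?f' ` f ` P = P" by (simp add: image_image ff')
  have mem: "f \<circ> g \<circ> Hilbert_Choice.inv f \<in> rotations (f ` P)"
    if "orthogonal_transformation f" "g \<in> rotations P" for f g P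
  proof -
    have "rotation g" "g ` P = P" using that(2) by (simp_all add: rotations_iff)
    have "Hilbert_Choice.inv f ` f ` P = P"
      using orthogonal_inv_comp(1)[OF that(1)] by (simp add: image_comp)
    then have "(f \<circ> g \<circ> Hilbert_Choice.inv f) ` f ` P = f ` P"
      by (simp only: image_comp[symmetric] \<open>g ` P = P\<close>)
    then show ?thesis using conj_rotation[OF that(1) \<open>rotation g\<close>] by (simp add: rotations_iff)
  qed
  show ?thesis
  proof (intro equalityI subsetI)
    fix k assume k: "k \<in> rotations (f ` P)"
    have "?f' \<circ> k \<circ> f \<in> rotations P" using mem[OF f' k] unfolding inv_f' f'fP .
    moreover have "k = f \<circ> (?f' \<circ> k \<circ> f) \<circ> ?f'" by (simp add: fun_eq_iff ff')
    ultimately show "k \<in> (\<lambda>g. f \<circ> g \<circ> ?f') ` rotations P" by (intro rev_image_eqI)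
  next
    fix k assume "k \<in> (\<lambda>g. f \<circ> g \<circ> ?f') ` rotations P"
    then obtain g where "g \<in> rotations P" "k = f \<circ> g \<circ> ?f'" by (rule imageE)
    then show "k \<in> rotations (f ` P)" using mem[OF f] by simp
  qed
qed

lemma rot_orbits_orthogonal_image:
  assumes f: "orthogonal_transformation f"
  shows "rot_orbits (f ` P) = (`) f ` rot_orbits P"
proof -
  have ff': "Hilbert_Choice.inv f (f x) = x" for x
    using orthogonal_inv_comp[OF f] by (simp add: fun_eq_iff)
  have "rot_orbit (f ` P) (f x) = f ` rot_orbit P x" for x
    unfolding rot_orbit_def setcompr_eq_image rotations_orthogonal_image[OF f] image_image
    by (simp add: image_image ff')
  then have "rot_orbit (f ` P) ` (f ` S2) = (`) f ` (rot_orbit P ` S2)" by (simp only: image_image)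
  then show ?thesis unfolding rot_orbits_def orthogonal_S2[OF f] .
qed

lemma solid_orbits_orthogonal_image:
  assumes f: "orthogonal_transformation f" and "solid_orbits P" shows "solid_orbits (f ` P)"
proof -
  have lin: "linear f" and inj: "inj f"
    using f by (simp_all add: orthogonal_transformation_linear orthogonal_transformation_inj)
  show ?thesis
    using assms(2) inj_image_eq_iff[OF inj]
    unfolding solid_orbits_def vertex_set_linear_image[OF lin inj] face_points_orthogonal_image[OF f]
      edge_points_orthogonal_image[OF f] rot_orbits_orthogonal_image[OF f]
    by simp
qed

lemma sphere_rotations_orthogonal_image_iso:
  assumes f: "orthogonal_transformation f"
  shows "sphere_group (sphere_rotations P) \<cong> sphere_group (sphere_rotations (f ` P))"
proof -
  let ?f' = "Hilbert_Choice.inv f"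
  have ff': "?f' (f x) = x" "f (?f' x) = x" for x
    using orthogonal_inv_comp[OF f] by (simp_all add: fun_eq_iff)
  have f': "orthogonal_transformation ?f'" by (rule orthogonal_transformation_inv[OF f])
  have fS: "f x \<in> S2" "?f' x \<in> S2" if "x \<in> S2" for x
    using that by (simp_all add: orthogonal_transformation_norm[OF f] orthogonal_transformation_norm[OF f'])
  define h where "h a = restrict (f \<circ> a \<circ> ?f') S2" for a :: "real^3 \<Rightarrow> real^3"
  have h_restrict: "h (restrict g S2) = restrict (f \<circ> g \<circ> ?f') S2" for g
    unfolding h_def by (rule ext) (use fS(2) in \<open>simp add: restrict_def del: mem_sphere_0\<close>)
  have img: "h ` sphere_rotations P = sphere_rotations (f ` P)"
    unfolding sphere_rotations_def rotations_orthogonal_image[OF f] image_image h_restrict ..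
  have rot: "rotation g" if "g \<in> rotations P" for g using that by (simp add: rotations_iff)
  have "h \<in> hom (sphere_group (sphere_rotations P)) (sphere_group (sphere_rotations (f ` P)))"
  proof (rule homI)
    show "h a \<in> carrier (sphere_group (sphere_rotations (f ` P)))" if "a \<in> carrier (sphere_group (sphere_rotations P))" for a
      using imageI[of a "sphere_rotations P" h] that unfolding img by simp
    fix a b assume "a \<in> carrier (sphere_group (sphere_rotations P))" "b \<in> carrier (sphere_group (sphere_rotations P))"
    then obtain g k where g: "g \<in> rotations P" "a = restrict g S2" and k: "k \<in> rotations P" "b = restrict k S2"
      by (auto simp: sphere_rotations_def)
    have "(f \<circ> g \<circ> ?f') \<circ> (f \<circ> k \<circ> ?f') = f \<circ> (g \<circ> k) \<circ> ?f'" by (simp add: fun_eq_iff ff')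
    then have "h (restrict (g \<circ> k) S2) = h a \<otimes>\<^bsub>BijGroup S2\<^esub> h b"
      unfolding g(2) k(2) h_restrict
      by (simp only: restrict_rotation_mult[OF conj_rotation[OF f rot[OF g(1)]] conj_rotation[OF f rot[OF k(1)]]])
    then show "h (a \<otimes>\<^bsub>sphere_group (sphere_rotations P)\<^esub> b)
        = h a \<otimes>\<^bsub>sphere_group (sphere_rotations (f ` P))\<^esub> h b"
      using restrict_rotation_mult[OF rot[OF g(1)] rot[OF k(1)]] g(2) k(2) by simp
  qed
  moreover have "inj_on h (sphere_rotations P)"
  proof (rule inj_onI)
    fix a b assume a: "a \<in> sphere_rotations P" and b: "b \<in> sphere_rotations P" and eq: "h a = h b"
    show "a = b"
    proof (rule extensionalityI[where A = S2])
      show "a \<in> extensional S2" "b \<in> extensional S2"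
        using subsetD[OF sphere_rotations_subset a] subsetD[OF sphere_rotations_subset b]
        by (simp_all add: moebius_S2_def Bij_def)
      fix x :: "real^3" assume x: "x \<in> S2"
      have ev: "h c (f x) = f (c x)" for c
        unfolding h_def using fS(1)[OF x] by (simp only: restrict_apply' comp_apply ff')
      have "f (a x) = f (b x)" using fun_cong[OF eq, of "f x"] unfolding ev .
      then show "a x = b x" using ff'(1) by metis
    qed
  qed
  ultimately have "h \<in> iso (sphere_group (sphere_rotations P)) (sphere_group (sphere_rotations (f ` P)))"
    using img by (simp add: iso_def bij_betw_def)
  then show ?thesis by (auto simp: is_iso_def)
qed

lemma maximal_rotation_group_orthogonal_image:
  fixes K :: "'k monoid"
  assumes f: "orthogonal_transformation f" and "sphere_group (sphere_rotations P) \<cong> K"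
    and "noncommuting_squares K" "order K \<in> {24, 60}"
  shows "maximal_rotation_group (f ` P) K"
proof
  have "sphere_group (sphere_rotations (f ` P)) \<cong> sphere_group (sphere_rotations P)"
    by (rule group.iso_sym[OF sphere_group_group[OF sphere_rotations_subgroup]
      sphere_rotations_orthogonal_image_iso[OF f]])
  then show "sphere_group (sphere_rotations (f ` P)) \<cong> K" using assms(2) by (rule iso_trans)
qed (use assms in auto)

context maximal_rotation_group
begin

lemma orbit_disjoint: "Z \<in> rot_orbits P \<Longrightarrow> Z' \<in> rot_orbits P \<Longrightarrow> x \<in> Z \<Longrightarrow> x \<in> Z' \<Longrightarrow> Z = Z'"
  using disjoint_union[of Z Z'] unfolding rot_orbits_eq by blast

lemma orbit_ne: "Z \<in> rot_orbits P \<Longrightarrow> Z \<noteq> {}"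
  unfolding rot_orbits_def using rot_orbit_self by blast

lemma orbit_subset_Union_iff:
  assumes "Z \<subseteq> rot_orbits P" "W \<in> rot_orbits P" shows "W \<subseteq> \<Union> Z \<longleftrightarrow> W \<in> Z"
proof
  assume "W \<subseteq> \<Union> Z"
  obtain x where x: "x \<in> W" using orbit_ne[OF assms(2)] by blast
  then obtain W' where "W' \<in> Z" "x \<in> W'" using \<open>W \<subseteq> \<Union> Z\<close> by blast
  then have "W = W'" using orbit_disjoint[OF assms(2) _ x] assms(1) by blast
  then show "W \<in> Z" using \<open>W' \<in> Z\<close> by simp
qed blast

text \<open>
  Distinct orbits are disjoint, so the orbits contained in the union are exactly the members of \<open>Z\<close>;
  those that contain a generic point are the ones different from the three special orbits.
\<close>

lemma component_index_Union:
  assumes "solid_orbits P" and Z: "Z \<subseteq> rot_orbits P" "finite Z"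
  shows "component_index P (\<Union> Z) = (if vertex_set P \<in> Z then 1 else 0, if face_points P \<in> Z then 1 else 0,
     if edge_points P \<in> Z then 1 else 0, card (Z - {vertex_set P, face_points P, edge_points P}))"
proof -
  have VFE: "vertex_set P \<in> rot_orbits P" "face_points P \<in> rot_orbits P" "edge_points P \<in> rot_orbits P"
    using assms(1) by (simp_all add: solid_orbits_def)
  have single: "card {W \<in> rot_orbits P. W \<subseteq> \<Union> Z \<and> W = U} = (if U \<in> Z then 1 else 0)"
    if U: "U \<in> rot_orbits P" for U
  proof -
    have "{W \<in> rot_orbits P. W \<subseteq> \<Union> Z \<and> W = U} = (if U \<in> Z then {U} else {})"
      using orbit_subset_Union_iff[OF Z(1) U] U by auto
    then show ?thesis by simp
  qed
  have "{W \<in> rot_orbits P. W \<subseteq> \<Union> Z \<and> (\<exists>X\<in>generic_points P. W = rot_orbit P X)}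
      = Z - {vertex_set P, face_points P, edge_points P}"
  proof (intro equalityI subsetI)
    fix W assume "W \<in> {W \<in> rot_orbits P. W \<subseteq> \<Union> Z \<and> (\<exists>X\<in>generic_points P. W = rot_orbit P X)}"
    then obtain X where W: "W \<in> rot_orbits P" "W \<subseteq> \<Union> Z" and X: "X \<in> generic_points P" "W = rot_orbit P X" by blast
    have "W \<in> Z" using orbit_subset_Union_iff[OF Z(1) W(1)] W(2) by blast
    moreover have "X \<in> W" unfolding X(2) by (rule rot_orbit_self)
    ultimately show "W \<in> Z - {vertex_set P, face_points P, edge_points P}"
      using X(1) unfolding generic_points_def by blast
  next
    fix W assume W: "W \<in> Z - {vertex_set P, face_points P, edge_points P}"
    then have Wo: "W \<in> rot_orbits P" and WZ: "W \<in> Z" using Z(1) by blast+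
    then obtain X where X: "X \<in> S2" "W = rot_orbit P X" unfolding rot_orbits_def by blast
    have XW: "X \<in> W" unfolding X(2) by (rule rot_orbit_self)
    have "X \<notin> U" if "U \<in> rot_orbits P" "W \<noteq> U" for U
      using orbit_disjoint[OF Wo that(1) XW] that(2) by blast
    then have "X \<in> generic_points P" unfolding generic_points_def using VFE W X(1) by blast
    then show "W \<in> {W \<in> rot_orbits P. W \<subseteq> \<Union> Z \<and> (\<exists>X\<in>generic_points P. W = rot_orbit P X)}"
      using Wo WZ X(2) by blast
  qed
  then show ?thesis unfolding component_index_def by (simp only: single VFE)
qed

text \<open>
  Take the special orbits selected by the first three entries and \<open>k\<close> of the infinitely many others.
  The union is nonempty, so its stabilizer is the rotation group.
\<close>

theorem component_index_realised:
  assumes "solid_orbits P" and \<nu>: "\<nu> \<in> {0, 1}" and \<mu>: "\<mu> \<in> {0, 1}" and \<epsilon>: "\<epsilon> \<in> {0, 1}"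
    and nz: "(\<nu>, \<mu>, \<epsilon>, k) \<noteq> (0, 0, 0, 0 :: nat)"
  shows "\<exists>\<alpha>. finite \<alpha> \<and> \<alpha> \<subseteq> S2 \<and> moebius_stabilizer \<alpha> \<cong> K \<and> finite_union_of_orbits P \<alpha>
    \<and> component_index P \<alpha> = (\<nu>, \<mu>, \<epsilon>, k)"
proof -
  let ?V = "vertex_set P" and ?F = "face_points P" and ?E = "edge_points P"
  have VFE: "?V \<in> rot_orbits P" "?F \<in> rot_orbits P" "?E \<in> rot_orbits P" "?V \<noteq> ?E" "?F \<noteq> ?E" "?V \<noteq> ?F"
    using assms(1) by (simp_all add: solid_orbits_def)
  obtain Y where Y: "Y \<subseteq> rot_orbits P - {?V, ?F, ?E}" "finite Y" "card Y = k"
    by (rule obtain_orbits[of "{?V, ?F, ?E}"]) simp_all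
  define Z0 where "Z0 = (if \<nu> = 1 then {?V} else {}) \<union> (if \<mu> = 1 then {?F} else {}) \<union> (if \<epsilon> = 1 then {?E} else {})"
  define Z where "Z = Z0 \<union> Y"
  have Z0: "Z0 \<subseteq> {?V, ?F, ?E}" "finite Z0" by (auto simp: Z0_def)
  have Z: "Z \<subseteq> rot_orbits P" "finite Z" unfolding Z_def using Z0 Y VFE(1-3) by auto
  have mem: "?V \<in> Z \<longleftrightarrow> \<nu> = 1" "?F \<in> Z \<longleftrightarrow> \<mu> = 1" "?E \<in> Z \<longleftrightarrow> \<epsilon> = 1"
    unfolding Z_def Z0_def using Y(1) VFE(4-6) by auto
  have diff: "Z - {?V, ?F, ?E} = Y" unfolding Z_def using Z0(1) Y(1) by blast
  have index: "component_index P (\<Union> Z) = (\<nu>, \<mu>, \<epsilon>, k)"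
    unfolding component_index_Union[OF assms(1) Z] diff Y(3) mem using \<nu> \<mu> \<epsilon> by auto
  have "Z \<noteq> {}"
  proof
    assume "Z = {}"
    then have "Y = {}" "\<nu> \<noteq> 1" "\<mu> \<noteq> 1" "\<epsilon> \<noteq> 1" using mem by (simp_all add: Z_def)
    then show False using nz Y(3) \<nu> \<mu> \<epsilon> by simp
  qed
  note st = moebius_stabilizer_Union[OF Z this]
  have "finite_union_of_orbits P (\<Union> Z)" unfolding finite_union_of_orbits_def using Z by blast
  with st index show ?thesis by (intro exI[of _ "\<Union> Z"]) simp
qed

end

theorem corollary7:
  fixes D C :: "(real^3) set"
  assumes "inscribed_dodecahedron D" and "inscribed_cube C"
  shows "(\<forall>\<nu>\<in>{0,1::nat}. \<forall>\<mu>\<in>{0,1::nat}. \<forall>\<epsilon>\<in>{0,1::nat}. \<forall>k::nat. (\<nu>, \<mu>, \<epsilon>, k) \<noteq> (0, 0, 0, 0) \<longrightarrow>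
           (\<exists>\<alpha> \<beta>. finite \<alpha> \<and> \<alpha> \<subseteq> S2 \<and> finite \<beta> \<and> \<beta> \<subseteq> S2
              \<and> moebius_stabilizer \<alpha> \<cong> alt_group 5
              \<and> moebius_stabilizer \<beta> \<cong> sym_group 4
              \<and> finite_union_of_orbits D \<alpha> \<and> component_index D \<alpha> = (\<nu>, \<mu>, \<epsilon>, k)
              \<and> finite_union_of_orbits C \<beta> \<and> component_index C \<beta> = (\<nu>, \<mu>, \<epsilon>, k)))
       \<and> {card \<alpha> | \<alpha>. \<alpha> \<subseteq> S2 \<and> finite \<alpha> \<and> moebius_stabilizer \<alpha> \<cong> alt_group 5}
           = {x + 60 * k | x k :: nat. x \<in> {0, 12, 20, 30, 32, 42, 50, 62} \<and> x\<^sup>2 + k\<^sup>2 \<noteq> 0}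
       \<and> {card \<beta> | \<beta>. \<beta> \<subseteq> S2 \<and> finite \<beta> \<and> moebius_stabilizer \<beta> \<cong> sym_group 4}
           = {x + 24 * k | x k :: nat. x \<in> {0, 6, 8, 12, 14, 18, 20, 26} \<and> x\<^sup>2 + k\<^sup>2 \<noteq> 0}"
proof -
  obtain f where f: "orthogonal_transformation f" "D = f ` std_dodecahedron"
    using assms(1) unfolding inscribed_dodecahedron_def by blast
  obtain g where g: "orthogonal_transformation g" "C = g ` std_cube"
    using assms(2) unfolding inscribed_cube_def by blast
  interpret D: maximal_rotation_group D "alt_group 5"
    unfolding f(2)
    by (rule maximal_rotation_group_orthogonal_image[OF f(1) dodecahedron_rotations_iso noncommuting_squares_alt_group])
      (simp add: order_alt_group_5)
  interpret C: maximal_rotation_group C "sym_group 4"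
    unfolding g(2)
    by (rule maximal_rotation_group_orthogonal_image[OF g(1) cube_rotations_iso noncommuting_squares_sym_group])
      (simp add: order_sym_group_4)
  have D_orbits: "solid_orbits D"
    unfolding f(2) by (rule solid_orbits_orthogonal_image[OF f(1) solid_orbits_std_dodecahedron])
  have C_orbits: "solid_orbits C"
    unfolding g(2) by (rule solid_orbits_orthogonal_image[OF g(1) solid_orbits_std_cube])
  show ?thesis
  proof (intro conjI ballI allI impI)
    fix \<nu> \<mu> \<epsilon> k :: nat
    assume index: "\<nu> \<in> {0, 1}" "\<mu> \<in> {0, 1}" "\<epsilon> \<in> {0, 1}" "(\<nu>, \<mu>, \<epsilon>, k) \<noteq> (0, 0, 0, 0)"
    show "\<exists>\<alpha> \<beta>. finite \<alpha> \<and> \<alpha> \<subseteq> S2 \<and> finite \<beta> \<and> \<beta> \<subseteq> S2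
        \<and> moebius_stabilizer \<alpha> \<cong> alt_group 5 \<and> moebius_stabilizer \<beta> \<cong> sym_group 4
        \<and> finite_union_of_orbits D \<alpha> \<and> component_index D \<alpha> = (\<nu>, \<mu>, \<epsilon>, k)
        \<and> finite_union_of_orbits C \<beta> \<and> component_index C \<beta> = (\<nu>, \<mu>, \<epsilon>, k)"
      using D.component_index_realised[OF D_orbits index] C.component_index_realised[OF C_orbits index] by blast
  next
    obtain a b c where abc: "(order (alt_group 5), a, b, c) \<in> {(24, 12, 8, 6), (60, 30, 20, 12)}"
      and eq: "{card \<alpha> | \<alpha>. \<alpha> \<subseteq> S2 \<and> finite \<alpha> \<and> moebius_stabilizer \<alpha> \<cong> alt_group 5}
        = {x + order (alt_group 5) * k | x k :: nat. x \<in> {0, a, b, c, a + b, a + c, b + c, a + b + c} \<and> x\<^sup>2 + k\<^sup>2 \<noteq> 0}"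
      by (rule D.stabilizer_cards)
    have "a = 30" "b = 20" "c = 12" using abc order_alt_group_5 by simp_all
    then have "{0, a, b, c, a + b, a + c, b + c, a + b + c} = {0, 12, 20, 30, 32, 42, 50, 62}"
      by (simp add: insert_commute)
    with eq show "{card \<alpha> | \<alpha>. \<alpha> \<subseteq> S2 \<and> finite \<alpha> \<and> moebius_stabilizer \<alpha> \<cong> alt_group 5}
        = {x + 60 * k | x k :: nat. x \<in> {0, 12, 20, 30, 32, 42, 50, 62} \<and> x\<^sup>2 + k\<^sup>2 \<noteq> 0}"
      by (simp only: order_alt_group_5)
  next
    obtain a b c where abc: "(order (sym_group 4), a, b, c) \<in> {(24, 12, 8, 6), (60, 30, 20, 12)}"
      and eq: "{card \<beta> | \<beta>. \<beta> \<subseteq> S2 \<and> finite \<beta> \<and> moebius_stabilizer \<beta> \<cong> sym_group 4}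
        = {x + order (sym_group 4) * k | x k :: nat. x \<in> {0, a, b, c, a + b, a + c, b + c, a + b + c} \<and> x\<^sup>2 + k\<^sup>2 \<noteq> 0}"
      by (rule C.stabilizer_cards)
    have "a = 12" "b = 8" "c = 6" using abc order_sym_group_4 by simp_all
    then have "{0, a, b, c, a + b, a + c, b + c, a + b + c} = {0, 6, 8, 12, 14, 18, 20, 26}"
      by (simp add: insert_commute)
    with eq show "{card \<beta> | \<beta>. \<beta> \<subseteq> S2 \<and> finite \<beta> \<and> moebius_stabilizer \<beta> \<cong> sym_group 4}
        = {x + 24 * k | x k :: nat. x \<in> {0, 6, 8, 12, 14, 18, 20, 26} \<and> x\<^sup>2 + k\<^sup>2 \<noteq> 0}"
      by (simp only: order_sym_group_4)
  qed
qed

end
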